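(* Let $X=(x_1,\dots,x_p)\in\mathbb{R}^{n\times p}$, $y\in\mathbb{R}^n$, $\beta^*\in\mathbb{R}^p$, $\xi>1$ and $S=\mathrm{supp}(\beta^* )$. Let $(\widehat\beta,\widehat\sigma)$ be the scaled lasso estimator with prefixed penalty level $\lambda_0$, $\widehat S=\mathrm{supp}(\widehat\beta)$, and $(\overline\beta,\overline\sigma)$ the least squares estimator in the model $\widehat S$: $$\overline\beta=\arg\min_\beta\{|y-X\beta|_2^2:\mathrm{supp}(\beta)\subseteq\widehat S\},\qquad \overline\sigma=|y-X\overline\beta|_2/\sqrt n.$$ Let $\sigma^*=|y-X\beta^*|_2/n^{1/2}$, $z^*=|X'(y-X\beta^* )/n|_\infty/\sigma^*$ and $\tau_*=\{\lambda_0\mu(\sigma^*\lambda_0,\xi)/\sigma^*\}^{1/2}$, with $\mu,\eta_*,\kappa,\kappa_\pm,\sigma^*_{m,S}$ defined in the context. Let $m$ be an integer satisfying $|S|\xi^2/\kappa^2(\xi,S)<m/\kappa_+(m,S)$. If $z^*\le(1-\tau_*^2)\lambda_0(\xi-1)/(\xi+1)$, then $$|\widehat S\setminus S|<m,\qquad \widehat\sigma^2-\{\sigma^*_{m-1,S}+\sqrt{\eta_*(\widehat\lambda,\xi)}\}^2\le\overline\sigma^2\le\widehat\sigma^2,$$ with $\widehat\lambda=\widehat\sigma\lambda_0\le\sigma^*\lambda_0/(1-\tau_*^2)$, and $$\kappa_-(m-1,S)\,|\overline\beta-\beta^*|_2^2\le|X\overline\beta-X\beta^*|_2^2/n\le\big\{\sigma^*_{m-1,S}+2\sqrt{\eta_*(\widehat\lambda,\xi)}\big\}^2.$$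 Moreover, suppose $|x_j|_2^2=n$ for all $j$. In addition to the probability bound $$\mathrm{pr}_{\beta^*,\sigma}\{z^*\le(1-\tau_*^2)\lambda_0(\xi-1)/(\xi+1)\}\ge1-\{1+o(1)\}\epsilon/\{\pi\log(p/\epsilon)\}^{1/2},$$ which holds for $\lambda_0\ge\{(2/n)\log(p/\epsilon)\}^{1/2}(\xi+1)/\{(\xi-1)(1-\tau_*^2)\}$, for all $\epsilon>0$ and $n-2>\log(p/\epsilon)\to\infty$, one has, for all integers $1\le m\le p$ and $\epsilon>0$, $$\mathrm{pr}_{\beta^*,\sigma}\Big[\sigma^*_{m,S}\sqrt n/\sigma\ge\sqrt{m+|S|}+\sqrt{2m\log(ep/m)+2\log(1/\epsilon)}\Big]\le\frac{\epsilon/m}{\sqrt{2\pi}}.$$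
   Context: $|v|_q$ is the $\ell_q$ norm, $|v|_\infty=\max_j|v_j|$; $\mathrm{supp}(\beta)=\{j:\beta_j\ne0\}$; $v_T$ is the subvector of $v$ with indices in $T\subset\{1,\dots,p\}$ and $T^c$ is the complement of $T$; $X_B$ is the submatrix of columns of $X$ with indices in $B$; $P_B$ is the orthogonal projection onto the linear span of $\{x_j:j\in B\}$. $\mathrm{pr}_{\beta,\sigma}$ is the probability measure under which $y-X\beta\sim N(0,\sigma^2I_n)$. The asymptotics are for $n\to\infty$, and all parameters and variables may depend on $n$. Scaled lasso: $(\widehat\beta,\widehat\sigma)=\arg\min_{\beta,\sigma}\big\{|y-X\beta|_2^2/(2n\sigma)+\sigma/2+\lambda_0|\beta|_1\big\}$, where $\lambda_0$ does not depend on the noise level. Compatibility factor: with the cone $\mathscr{C}(\xi,T)=\{u\in\mathbb{R}^p:|u_{T^c}|_1\le\xi|u_T|_1\}$, $$\kappa(\xi,T)=\min\Big\{\frac{|T|^{1/2}|Xu|_2}{n^{1/2}|u_T|_1}:u\in\mathscr{C}(\xi,T),\,u\ne0\Big\}.$$ For $\lambda>0$, $w\in\mathbb{R}^p$ and $T\subset\{1,\dots,p\}$, let $\delta_{w,T}=1-I(w=\beta^*,T=\emptyset)$, $$\eta(\lambda,\xi,w,T)=\frac{|X\beta^*-Xw|_2^2}{n}+(1+\delta_{w,T})2\lambda|w_{T^c}|_1+\frac{4\xi^2\lambda^2|T|}{(\xi+1)^2\kappa^2(\xi,T)},\quad \eta_*(\lambda,\xi)=\inf_{w,T}\eta(\lambda,\xi,w,T),$$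 $$\mu(\lambda,\xi)=(\xi+1)\min_{T}\inf_{0<\nu<1}\max\Big[\frac{|\beta^*_{T^c}|_1}{\nu},\frac{\lambda|T|/\{2(1-\nu)\}}{\kappa^2\{(\xi+\nu)/(1-\nu),T\}}\Big],$$ where the terms with $|T|/\kappa^2(\cdot,T)$ vanish for $T=\emptyset$. Sparse eigenvalues: with $\lambda_{\min},\lambda_{\max}$ the smallest and largest eigenvalues of a matrix, $$\kappa_-(m,T)=\min_{B\supset T,\,|B\setminus T|\le m}\lambda_{\min}(X_B'X_B/n),\qquad \kappa_+(m,T)=\max_{B\cap T=\emptyset,\,|B|\le m}\lambda_{\max}(X_B'X_B/n).$$ Finally, $$\sigma^*_{m,S}=\max_{B\supseteq S,\,|B\setminus S|=m}|P_B(y-X\beta^* )|_2/\sqrt n.$$ *)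

theory Defs
  imports "HOL-Probability.Probability"
    "Jordan_Normal_Form.Spectral_Radius"
    "Jordan_Normal_Form.DL_Submatrix"
begin

unbundle no vec_syntax
unbundle no inner_syntax

text \<open>
  The design \<open>X\<close> is an \<open>n \<times> p\<close> matrix with \<open>n = dim_row X\<close> and \<open>p = dim_col X\<close>.  Vectors are
  indexed from 0, so the coordinate index set is \<open>{..<p}\<close>.
\<close>

definition l2norm :: "real vec \<Rightarrow> real" where
  "l2norm v = sqrt (\<Sum>i<dim_vec v. (v $ i)\<^sup>2)"

definition linfnorm :: "real vec \<Rightarrow> real" where
  "linfnorm v = Max ((\<lambda>i. \<bar>v $ i\<bar>) ` {..<dim_vec v})"

text \<open>\<open>l1on T v\<close> is the \<open>l\<^sub>1\<close> norm of the subvector of \<open>v\<close> with indices in \<open>T\<close>.\<close>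

definition l1on :: "nat set \<Rightarrow> real vec \<Rightarrow> real" where
  "l1on T v = (\<Sum>i\<in>T. \<bar>v $ i\<bar>)"

definition l1norm :: "real vec \<Rightarrow> real" where
  "l1norm v = l1on {..<dim_vec v} v"

definition supp :: "real vec \<Rightarrow> nat set" where
  "supp b = {j. j < dim_vec b \<and> b $ j \<noteq> 0}"

definition columns :: "real mat \<Rightarrow> nat set \<Rightarrow> real mat" where
  "columns X B = submatrix X UNIV B"

definition proj :: "real mat \<Rightarrow> nat set \<Rightarrow> real vec \<Rightarrow> real vec" where
  "proj X B v = (THE w. w \<in> vec_space.col_space (dim_row X) (columns X B) \<and>
     (\<forall>j\<in>B. col X j \<bullet> (v - w) = 0))"

definition scaled_lasso_objective :: "real mat \<Rightarrow> real vec \<Rightarrow> real \<Rightarrow> real vec \<times> real \<Rightarrow> real" where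
  "scaled_lasso_objective X y lam0 = (\<lambda>(b, s).
     (l2norm (y - X *\<^sub>v b))\<^sup>2 / (2 * real (dim_row X) * s) + s / 2 + lam0 * l1norm b)"

definition is_scaled_lasso :: "real mat \<Rightarrow> real vec \<Rightarrow> real \<Rightarrow> real vec \<Rightarrow> real \<Rightarrow> bool" where
  "is_scaled_lasso X y lam0 bhat shat \<longleftrightarrow>
     is_arg_min (scaled_lasso_objective X y lam0)
       (\<lambda>(b, s). b \<in> carrier_vec (dim_col X) \<and> s > 0) (bhat, shat)"

definition is_least_squares :: "real mat \<Rightarrow> real vec \<Rightarrow> nat set \<Rightarrow> real vec \<Rightarrow> bool" where
  "is_least_squares X y A bbar \<longleftrightarrow>
     is_arg_min (\<lambda>b. (l2norm (y - X *\<^sub>v b))\<^sup>2)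
       (\<lambda>b. b \<in> carrier_vec (dim_col X) \<and> supp b \<subseteq> A) bbar"

text \<open>\<open>rms_residual\<close> gives \<open>\<sigma>\<^sup>*\<close> at the target vector and \<open>\<sigma>\<close>-bar at the least squares estimator.\<close>

definition rms_residual :: "real mat \<Rightarrow> real vec \<Rightarrow> real vec \<Rightarrow> real" where
  "rms_residual X y b = l2norm (y - X *\<^sub>v b) / sqrt (real (dim_row X))"

definition z_star :: "real mat \<Rightarrow> real vec \<Rightarrow> real vec \<Rightarrow> real" where
  "z_star X y b =
     linfnorm ((1 / real (dim_row X)) \<cdot>\<^sub>v (X\<^sup>T *\<^sub>v (y - X *\<^sub>v b))) / rms_residual X y b"

definition cone :: "nat \<Rightarrow> real \<Rightarrow> nat set \<Rightarrow> real vec set" where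
  "cone p xi T = {u \<in> carrier_vec p. l1on ({..<p} - T) u \<le> xi * l1on T u}"

text \<open>For nonempty \<open>T\<close> the infimum is attained.  For empty \<open>T\<close> the index set is empty; that value
  is never used, see \<open>card_over_kappa2\<close>.\<close>

definition kappa :: "real mat \<Rightarrow> real \<Rightarrow> nat set \<Rightarrow> real" where
  "kappa X xi T =
     (INF u \<in> cone (dim_col X) xi T - {0\<^sub>v (dim_col X)}.
        sqrt (real (card T)) * l2norm (X *\<^sub>v u) / (sqrt (real (dim_row X)) * l1on T u))"

text \<open>The quotient \<open>|T| / \<kappa>\<^sup>2(\<xi>, T)\<close>, formed in the extended reals so that it is \<open>\<infinity>\<close> (and not 0)
  when the compatibility factor of a nonempty \<open>T\<close> vanishes.\<close>

definition card_over_kappa2 :: "real mat \<Rightarrow> real \<Rightarrow> nat set \<Rightarrow> ereal" where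
  "card_over_kappa2 X xi T =
     (if T = {} then 0 else ereal (real (card T)) / ereal ((kappa X xi T)\<^sup>2))"

definition eta :: "real mat \<Rightarrow> real vec \<Rightarrow> real \<Rightarrow> real \<Rightarrow> real vec \<Rightarrow> nat set \<Rightarrow> ereal" where
  "eta X b lam xi w T =
     ereal ((l2norm (X *\<^sub>v b - X *\<^sub>v w))\<^sup>2 / real (dim_row X)
       + (1 + (if w = b \<and> T = {} then 0 else 1)) * 2 * lam * l1on ({..<dim_col X} - T) w)
     + ereal (4 * xi\<^sup>2 * lam\<^sup>2 / (xi + 1)\<^sup>2) * card_over_kappa2 X xi T"

text \<open>For \<open>\<lambda> > 0\<close> the infima defining \<open>eta_star\<close> and \<open>mu\<close> are finite, by taking \<open>T = {}\<close>.\<close>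

definition eta_star :: "real mat \<Rightarrow> real vec \<Rightarrow> real \<Rightarrow> real \<Rightarrow> real" where
  "eta_star X b lam xi = real_of_ereal
     (INF (w, T) \<in> carrier_vec (dim_col X) \<times> Pow {..<dim_col X}. eta X b lam xi w T)"

definition mu :: "real mat \<Rightarrow> real vec \<Rightarrow> real \<Rightarrow> real \<Rightarrow> real" where
  "mu X b lam xi = (xi + 1) * real_of_ereal
     (INF T \<in> Pow {..<dim_col X}. INF v \<in> {0<..<1}.
        max (ereal (l1on ({..<dim_col X} - T) b / v))
            (ereal (lam / (2 * (1 - v))) * card_over_kappa2 X ((xi + v) / (1 - v)) T))"

definition tau_star :: "real mat \<Rightarrow> real vec \<Rightarrow> real vec \<Rightarrow> real \<Rightarrow> real \<Rightarrow> real" where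
  "tau_star X y b lam0 xi =
     sqrt (lam0 * mu X b (rms_residual X y b * lam0) xi / rms_residual X y b)"

definition gram :: "real mat \<Rightarrow> nat set \<Rightarrow> real mat" where
  "gram X B = (1 / real (dim_row X)) \<cdot>\<^sub>m ((columns X B)\<^sup>T * columns X B)"

definition lambda_min :: "real mat \<Rightarrow> real" where
  "lambda_min A = Min (spectrum A)"

definition lambda_max :: "real mat \<Rightarrow> real" where
  "lambda_max A = Max (spectrum A)"

text \<open>The \<open>0 \<times> 0\<close> matrix has no eigenvalues, so \<open>B = {}\<close> is left out of the minimum in
  \<open>kappa_minus\<close> and contributes 0 to the maximum in \<open>kappa_plus\<close>.\<close>

definition kappa_minus :: "real mat \<Rightarrow> nat \<Rightarrow> nat set \<Rightarrow> real" where
  "kappa_minus X m T = Min {lambda_min (gram X B) | B.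
     T \<subseteq> B \<and> B \<subseteq> {..<dim_col X} \<and> card (B - T) \<le> m \<and> B \<noteq> {}}"

definition kappa_plus :: "real mat \<Rightarrow> nat \<Rightarrow> nat set \<Rightarrow> real" where
  "kappa_plus X m T = Max (insert 0 {lambda_max (gram X B) | B.
     B \<subseteq> {..<dim_col X} \<and> B \<inter> T = {} \<and> card B \<le> m \<and> B \<noteq> {}})"

text \<open>If fewer than \<open>m\<close> indices lie outside \<open>S\<close>, no \<open>B\<close> has \<open>|B - S| = m\<close>; then \<open>B\<close> is the full
  index set.\<close>

definition sigma_star_m :: "real mat \<Rightarrow> real vec \<Rightarrow> real vec \<Rightarrow> nat \<Rightarrow> nat set \<Rightarrow> real" where
  "sigma_star_m X y b m S =
     Max {l2norm (proj X B (y - X *\<^sub>v b)) / sqrt (real (dim_row X)) | B.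
       S \<subseteq> B \<and> B \<subseteq> {..<dim_col X} \<and> card (B - S) = min m (dim_col X - card S)}"

text \<open>\<open>M\<close> carries a response \<open>Y\<close> with \<open>Y - X b \<sim> N(0, s\<^sup>2 I\<^sub>n)\<close>.\<close>

definition gaussian_response ::
    "'a measure \<Rightarrow> ('a \<Rightarrow> real vec) \<Rightarrow> real mat \<Rightarrow> real vec \<Rightarrow> real \<Rightarrow> bool" where
  "gaussian_response M Y X b s \<longleftrightarrow>
     prob_space M \<and>
     (\<forall>\<omega>\<in>space M. Y \<omega> \<in> carrier_vec (dim_row X)) \<and>
     prob_space.indep_vars M (\<lambda>_. borel) (\<lambda>i \<omega>. (Y \<omega> - X *\<^sub>v b) $ i) {..<dim_row X} \<and>
     (\<forall>i<dim_row X. distributed M lborel (\<lambda>\<omega>. (Y \<omega> - X *\<^sub>v b) $ i) (normal_density 0 s))"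

end

theory Submission
  imports Defs "HOL-Real_Asymp.Real_Asymp"
begin

text \<open>
  After the rescaling by \<open>1 / sqrt n\<close> the deterministic part is inner product geometry.  A scaled
  lasso solution is a lasso solution at the level \<open>shat * lam0\<close>, and everything follows from its
  variational inequality.  Tested against the target it gives the \<open>l\<^sub>1\<close> error bound \<open>\<mu>\<close>, tested
  against an arbitrary \<open>w\<close> the prediction bound \<open>\<eta>\<^sub>*\<close>, and tested against a coordinate deletion
  the correlation lower bound that limits the number of false positives.  The lower bound
  \<open>shat \<ge> (1 - \<tau>\<^sup>2) \<sigma>\<^sup>*\<close>, which transfers the noise condition to the random level, comes from the
  monotonicity of residual norm over penalty level along the lasso path.

  For the tail of \<open>z\<^sup>*\<close>, rotation invariance reduces \<open>\<bar>c \<bullet> e\<bar> > x \<bar>e\<bar>\<close> to a normal variable against an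
  independent chi-square, the Mills ratio bounds the former, and the Laplace transform of the latter
  gives the sharp constant.  For \<open>\<sigma>\<^sup>*\<^sub>m\<close>, a Chernoff bound for \<open>\<bar>P e\<bar>\<close> is combined with a union
  bound; the second-order term of the exponent compensates the factor \<open>sqrt m\<close> that the union bound
  loses.
\<close>

section \<open>Finitely supported sequences as an inner product space\<close>

text \<open>Dimensions are variables here, so no fixed Euclidean type can hold the vectors. The
  finitely supported sequences form one inner product space containing every R^n, and the general
  theory of norms, spans and orthogonalisation applies to it. The obstacle in the deterministic part
  is a circle: the bound \<open>mu\<close> applies to a lasso solution only if the noise condition
  holds at the level of that solution, and \<open>shat * lam0\<close> is random. An auxiliary lasso
  solution at the deterministic level (1 - \<tau>^2) \<sigma>^* lam0 breaks it: there the condition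
  is given, and comparison with it shows that \<open>shat\<close> cannot be smaller. In z^* the
  noise scale cancels, so its tail is a question about spherical caps and no deviation bound for
  \<sigma>^* has to be spent. For \<sigma>^*_m the number of models is, by Stirling, at most of
  order (e p / m)^m / sqrt m, while the claim divides by \<open>m\<close>; closing this gap leaves
  so little room that small \<open>m\<close> need exact constants.\<close>

typedef fseq = "{f :: nat \<Rightarrow> real. finite {i. f i \<noteq> 0}}"
  morphisms coord Abs_fseq
  by (rule exI[of _ "\<lambda>_. 0"]) simp

lemma finite_supports_combine:
  fixes f g h :: "nat \<Rightarrow> real"
  assumes "finite {i. f i \<noteq> 0}" "finite {i. g i \<noteq> 0}" "\<And>i. f i = 0 \<Longrightarrow> g i = 0 \<Longrightarrow> h i = 0"
  shows "finite {i. h i \<noteq> 0}"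
  by (rule finite_subset[OF _ finite_UnI[OF assms(1,2)]]) (use assms(3) in auto)

setup_lifting type_definition_fseq

instantiation fseq :: real_inner
begin

lift_definition zero_fseq :: fseq is "\<lambda>_. 0" by simp
lift_definition plus_fseq :: "fseq \<Rightarrow> fseq \<Rightarrow> fseq" is "\<lambda>f g i. f i + g i"
  by (erule (1) finite_supports_combine) simp
lift_definition minus_fseq :: "fseq \<Rightarrow> fseq \<Rightarrow> fseq" is "\<lambda>f g i. f i - g i"
  by (erule (1) finite_supports_combine) simp
lift_definition uminus_fseq :: "fseq \<Rightarrow> fseq" is "\<lambda>f i. - f i" by simp
lift_definition scaleR_fseq :: "real \<Rightarrow> fseq \<Rightarrow> fseq" is "\<lambda>c f i. c * f i"
  by (erule rev_finite_subset) auto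
lift_definition inner_fseq :: "fseq \<Rightarrow> fseq \<Rightarrow> real" is
  "\<lambda>f g. \<Sum>i | f i \<noteq> 0. f i * g i" .

definition norm_fseq :: "fseq \<Rightarrow> real" where "norm_fseq x = sqrt (inner x x)"
definition dist_fseq :: "fseq \<Rightarrow> fseq \<Rightarrow> real" where "dist_fseq x y = norm (x - y)"
definition sgn_fseq :: "fseq \<Rightarrow> fseq" where "sgn_fseq x = inverse (norm x) *\<^sub>R x"
definition uniformity_fseq :: "(fseq \<times> fseq) filter" where
  "uniformity_fseq = (INF e\<in>{0<..}. principal {(x, y). dist x y < e})"
definition open_fseq :: "fseq set \<Rightarrow> bool" where
  "open_fseq U = (\<forall>x\<in>U. eventually (\<lambda>(x', y). x' = x \<longrightarrow> y \<in> U) uniformity)"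

text \<open>The defining sum runs over the support of the left argument only, an index set that
  changes with the argument. Freed of it, symmetry and additivity can be checked on one common
  finite set.\<close>

lemma inner_fseq_eq:
  assumes "finite A" "\<And>i. i \<notin> A \<Longrightarrow> coord x i = 0 \<or> coord y i = 0"
  shows "inner x y = (\<Sum>i\<in>A. coord x i * coord y i)"
proof -
  have fx: "finite {i. coord x i \<noteq> 0}" using coord[of x] by simp
  have "(\<Sum>i | coord x i \<noteq> 0. coord x i * coord y i)
      = (\<Sum>i\<in>A \<inter> {i. coord x i \<noteq> 0}. coord x i * coord y i)"
    using assms fx by (intro sum.mono_neutral_right) auto
  also have "\<dots> = (\<Sum>i\<in>A. coord x i * coord y i)"
    using assms fx by (intro sum.mono_neutral_left) auto
  finally show ?thesis by (simp add: inner_fseq.rep_eq)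
qed

instance
proof
  fix x y z :: fseq and a b :: real
  have fin: "finite {i. coord u i \<noteq> 0}" for u using coord[of u] by simp
  show "x + y + z = x + (y + z)" by transfer (simp add: add.assoc)
  show "x + y = y + x" by transfer (simp add: add.commute)
  show "0 + x = x" "- x + x = 0" "x - y = x + - y" by (transfer, simp)+
  show "a *\<^sub>R (x + y) = a *\<^sub>R x + a *\<^sub>R y" "(a + b) *\<^sub>R x = a *\<^sub>R x + b *\<^sub>R x"
    by (transfer, simp add: distrib_left distrib_right)+
  show "a *\<^sub>R b *\<^sub>R x = (a * b) *\<^sub>R x" by transfer (simp add: mult.assoc)
  show "1 *\<^sub>R x = x" by transfer simp
  let ?A = "{i. coord x i \<noteq> 0} \<union> {i. coord y i \<noteq> 0} \<union> {i. coord z i \<noteq> 0}"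
  have fA: "finite ?A" using fin by blast
  show "inner x y = inner y x"
    by (subst (1 2) inner_fseq_eq[OF fA]) (auto simp: mult.commute)
  show "inner (x + y) z = inner x z + inner y z"
    by (subst (1 2 3) inner_fseq_eq[OF fA]) (auto simp: plus_fseq.rep_eq algebra_simps sum.distrib)
  show "inner (a *\<^sub>R x) y = a * inner x y"
    by (subst (1 2) inner_fseq_eq[OF fA]) (auto simp: scaleR_fseq.rep_eq sum_distrib_left algebra_simps)
  show "0 \<le> inner x x" by transfer (simp add: sum_nonneg)
  show "(inner x x = 0) = (x = 0)"
    by transfer (auto simp: sum_nonneg_eq_0_iff fun_eq_iff)
  show "norm x = sqrt (inner x x)" by (rule norm_fseq_def)
qed (simp_all add: dist_fseq_def sgn_fseq_def uniformity_fseq_def open_fseq_def)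

end

lift_definition fseq_of :: "nat \<Rightarrow> (nat \<Rightarrow> real) \<Rightarrow> fseq" is "\<lambda>n f i. if i < n then f i else 0"
  by simp

lemma inner_fseq_of: "inner (fseq_of n f) (fseq_of n g) = (\<Sum>i<n. f i * g i)"
  by (subst inner_fseq_eq[of "{..<n}"]) (auto simp: fseq_of.rep_eq)

lemma inner_fseq_of_left: "inner (fseq_of n f) x = (\<Sum>i<n. f i * coord x i)"
  by (subst inner_fseq_eq[of "{..<n}"]) (auto simp: fseq_of.rep_eq)

lemma fseq_of_diff: "fseq_of n f - fseq_of n g = fseq_of n (\<lambda>i. f i - g i)"
  by transfer auto

lemma fseq_of_scaleR: "c *\<^sub>R fseq_of n f = fseq_of n (\<lambda>i. c * f i)"
  by transfer auto

lemma fseq_of_add: "fseq_of n f + fseq_of n g = fseq_of n (\<lambda>i. f i + g i)"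
  by transfer auto

lemma fseq_of_zero: "fseq_of n (\<lambda>_. 0) = 0"
  by transfer auto

lemma fseq_of_sum: "(\<Sum>j\<in>A. fseq_of n (F j)) = fseq_of n (\<lambda>i. \<Sum>j\<in>A. F j i)"
  by (induction A rule: infinite_finite_induct) (auto simp: fseq_of_zero fseq_of_add)

lemma fseq_of_cong: "(\<And>i. i < n \<Longrightarrow> f i = g i) \<Longrightarrow> fseq_of n f = fseq_of n g"
  by transfer auto

section \<open>The lasso in an inner product space\<close>

definition lin :: "(nat \<Rightarrow> 'v::real_vector) \<Rightarrow> nat \<Rightarrow> (nat \<Rightarrow> real) \<Rightarrow> 'v" where
  "lin a p u = (\<Sum>j<p. u j *\<^sub>R a j)"

definition l1 :: "nat set \<Rightarrow> (nat \<Rightarrow> real) \<Rightarrow> real" where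
  "l1 T u = (\<Sum>j\<in>T. \<bar>u j\<bar>)"

lemma lin_add: "lin a p (\<lambda>j. u j + w j) = lin a p u + lin a p w"
  by (simp add: lin_def scaleR_add_left sum.distrib)

lemma lin_diff: "lin a p (\<lambda>j. u j - w j) = lin a p u - lin a p w"
  by (simp add: lin_def scaleR_diff_left sum_subtractf)

lemma lin_scale: "lin a p (\<lambda>j. c * u j) = c *\<^sub>R lin a p u"
  by (simp add: lin_def scaleR_sum_right)

lemma l1_nonneg: "0 \<le> l1 T u"
  by (simp add: l1_def sum_nonneg)

lemma l1_split: "T \<subseteq> {..<p} \<Longrightarrow> l1 {..<p} u = l1 T u + l1 ({..<p} - T) u"
  unfolding l1_def by (metis add.commute finite_lessThan sum.subset_diff)

lemma inner_lin_le:
  assumes "\<And>j. j < p \<Longrightarrow> \<bar>inner (a j) e\<bar> \<le> Z"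
  shows "\<bar>inner e (lin a p u)\<bar> \<le> Z * l1 {..<p} u"
proof -
  have "\<bar>inner e (lin a p u)\<bar> \<le> (\<Sum>j<p. \<bar>u j * inner (a j) e\<bar>)"
    unfolding lin_def inner_sum_right
    by (rule order.trans[OF sum_abs]) (simp add: inner_commute)
  also have "\<dots> \<le> (\<Sum>j<p. Z * \<bar>u j\<bar>)"
    unfolding abs_mult by (subst mult.commute, intro sum_mono mult_right_mono) (use assms in auto)
  finally show ?thesis by (simp add: l1_def sum_distrib_left)
qed

text \<open>On \<open>T\<close> this is the triangle inequality; off \<open>T\<close> it is used as
  \<bar>c_j\<bar> \<ge> \<bar>c_j - b_j\<bar> - \<bar>b_j\<bar>, so the error off \<open>T\<close>
  enters with a negative sign. This asymmetry is what produces the cone conditions.\<close>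

lemma l1_decrease_le:
  assumes "T \<subseteq> {..<p}"
  shows "l1 {..<p} b - l1 {..<p} c
    \<le> l1 T (\<lambda>j. c j - b j) - l1 ({..<p} - T) (\<lambda>j. c j - b j) + 2 * l1 ({..<p} - T) b"
proof -
  have 1: "l1 T b - l1 T c \<le> l1 T (\<lambda>j. c j - b j)"
    unfolding l1_def sum_subtractf[symmetric] by (rule sum_mono) auto
  have 2: "l1 ({..<p} - T) b - l1 ({..<p} - T) c
      \<le> 2 * l1 ({..<p} - T) b - l1 ({..<p} - T) (\<lambda>j. c j - b j)"
    unfolding l1_def sum_subtractf[symmetric] sum_distrib_left by (rule sum_mono) auto
  show ?thesis using 1 2 l1_split[OF assms, of b] l1_split[OF assms, of c] by linarith
qed

text \<open>The response and the columns are meant after division by sqrt n, hence no factor 1/n in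
  the loss. Competitors are arbitrary functions, of which only the values below \<open>p\<close>
  matter.\<close>

definition lasso_sol ::
    "(nat \<Rightarrow> 'v::real_inner) \<Rightarrow> nat \<Rightarrow> 'v \<Rightarrow> real \<Rightarrow> (nat \<Rightarrow> real) \<Rightarrow> bool" where
  "lasso_sol a p y lam c \<longleftrightarrow> (\<forall>w. (norm (y - lin a p c))\<^sup>2 / 2 + lam * l1 {..<p} c
     \<le> (norm (y - lin a p w))\<^sup>2 / 2 + lam * l1 {..<p} w)"

text \<open>Convexity in place of subgradients: moving a fraction \<open>t\<close> from
  \<open>c\<close> towards \<open>w\<close> changes the penalty at most linearly in
  \<open>t\<close>, and the loss by its linear part plus t^2 \<bar>d\<bar>^2 / 2. Dividing by
  \<open>t\<close>, the remainder can be made arbitrarily small.\<close>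

lemma lasso_sol_variational:
  assumes sol: "lasso_sol a p y lam c" and lam: "0 \<le> lam"
  shows "inner (y - lin a p c) (lin a p w - lin a p c) \<le> lam * (l1 {..<p} w - l1 {..<p} c)"
proof -
  define r where "r = y - lin a p c"
  define d where "d = lin a p w - lin a p c"
  have step: "inner r d \<le> lam * (l1 {..<p} w - l1 {..<p} c) + t * ((norm d)\<^sup>2 / 2)"
    if t: "0 < t" "t \<le> 1" for t
  proof -
    let ?v = "\<lambda>j. c j + t * (w j - c j)"
    have "lin a p ?v = lin a p c + t *\<^sub>R d"
      unfolding lin_add lin_scale lin_diff d_def ..
    hence yv: "y - lin a p ?v = r - t *\<^sub>R d" by (simp add: r_def)
    have n: "(norm (r - t *\<^sub>R d))\<^sup>2 = (norm r)\<^sup>2 - 2 * t * inner r d + t\<^sup>2 * (norm d)\<^sup>2"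
      unfolding power2_norm_eq_inner
      by (simp add: inner_diff_left inner_diff_right inner_commute[of d r] power2_eq_square algebra_simps)
    have "l1 {..<p} ?v \<le> (\<Sum>j<p. (1 - t) * \<bar>c j\<bar> + t * \<bar>w j\<bar>)"
      unfolding l1_def
    proof (rule sum_mono)
      fix j
      have "?v j = (1 - t) * c j + t * w j" by (simp add: algebra_simps)
      thus "\<bar>?v j\<bar> \<le> (1 - t) * \<bar>c j\<bar> + t * \<bar>w j\<bar>"
        using t abs_triangle_ineq[of "(1 - t) * c j" "t * w j"] by (simp add: abs_mult)
    qed
    hence l: "lam * l1 {..<p} ?v \<le> lam * ((1 - t) * l1 {..<p} c + t * l1 {..<p} w)"
      using lam by (intro mult_left_mono) (simp_all add: l1_def sum.distrib sum_distrib_left)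
    have "(norm r)\<^sup>2 / 2 + lam * l1 {..<p} c \<le> (norm (r - t *\<^sub>R d))\<^sup>2 / 2 + lam * l1 {..<p} ?v"
      using sol[unfolded lasso_sol_def, rule_format, of ?v] unfolding yv r_def[symmetric] .
    hence "t * inner r d \<le> t * (lam * (l1 {..<p} w - l1 {..<p} c) + t * ((norm d)\<^sup>2 / 2))"
      using l n by (simp add: algebra_simps power2_eq_square)
    thus ?thesis using t by simp
  qed
  have "inner r d \<le> lam * (l1 {..<p} w - l1 {..<p} c) + e" if e: "0 < e" for e
  proof -
    define t where "t = min 1 (e / ((norm d)\<^sup>2 / 2 + 1))"
    have t: "0 < t" "t \<le> 1" using e by (auto simp: t_def intro!: divide_pos_pos add_nonneg_pos)
    have "t * ((norm d)\<^sup>2 / 2) \<le> (e / ((norm d)\<^sup>2 / 2 + 1)) * ((norm d)\<^sup>2 / 2)"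
      by (intro mult_right_mono) (auto simp: t_def)
    also have "\<dots> \<le> e" using e by (simp add: field_simps add_pos_nonneg)
    finally show ?thesis using step[OF t] by linarith
  qed
  thus ?thesis unfolding r_def d_def by (rule field_le_epsilon)
qed

text \<open>Tychonoff's theorem. It lets minimisation over R^p be carried out on
  \<open>nat \<Rightarrow> real\<close>, without a type for the dimension.\<close>

lemma compact_box: "compact {f :: nat \<Rightarrow> real. \<forall>i. \<bar>f i\<bar> \<le> R}"
proof -
  have "compactin (product_topology (\<lambda>i::nat. euclidean) UNIV) (PiE UNIV (\<lambda>i. {-R..R}))"
    by (subst compactin_PiE) auto
  moreover have "PiE UNIV (\<lambda>i::nat. {-R..R}) = {f. \<forall>i. \<bar>f i\<bar> \<le> R}"
    by (auto simp: PiE_def Pi_def abs_le_iff minus_le_iff)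
  ultimately show ?thesis by (simp add: euclidean_product_topology)
qed

lemma continuous_on_coordinate: "continuous_on A (\<lambda>f :: nat \<Rightarrow> real. f i)"
  by (rule continuous_on_subset[OF continuous_on_product_coordinates]) auto

lemma lasso_sol_exists:
  assumes lam: "0 < lam"
  shows "\<exists>c. lasso_sol a p y lam c"
proof -
  define F where "F f = (norm (y - lin a p f))\<^sup>2 / 2 + lam * l1 {..<p} f" for f
  define R where "R = F (\<lambda>_. 0) / lam"
  have R0: "0 \<le> R" using lam by (auto simp: R_def F_def intro!: divide_nonneg_pos add_nonneg_nonneg mult_nonneg_nonneg l1_nonneg)
  let ?K = "{f :: nat \<Rightarrow> real. \<forall>i. \<bar>f i\<bar> \<le> R}"
  have "continuous_on ?K F"
    unfolding F_def lin_def l1_def by (intro continuous_intros continuous_on_coordinate) auto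
  moreover have z: "(\<lambda>_. 0) \<in> ?K" using R0 by simp
  ultimately obtain c where c: "c \<in> ?K" "\<And>f. f \<in> ?K \<Longrightarrow> F c \<le> F f"
    using continuous_attains_inf[OF compact_box] by (metis (no_types, lifting) empty_iff)
  have "F c \<le> F f" for f
  proof (cases "F f \<le> F (\<lambda>_. 0)")
    case True
    \<comment> \<open>Coordinates from \<open>p\<close> on do not influence \<open>F\<close> but
      could lie outside the box, so they are set to 0.\<close>
    define g where "g j = (if j < p then f j else 0)" for j
    have Fg: "F g = F f" by (simp add: F_def lin_def l1_def g_def)
    have "lam * l1 {..<p} f \<le> F f" by (simp add: F_def)
    hence "l1 {..<p} f \<le> R" using True lam by (simp add: R_def field_simps)
    moreover have "\<bar>f j\<bar> \<le> l1 {..<p} f" if "j < p" for j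
      unfolding l1_def using that by (intro member_le_sum) auto
    ultimately have "g \<in> ?K" using R0 by (auto simp: g_def intro: order.trans)
    thus ?thesis using c(2) Fg by metis
  next
    case False
    thus ?thesis using c(2)[OF z] by linarith
  qed
  thus ?thesis unfolding lasso_sol_def F_def by blast
qed

text \<open>A positive lower bound \<open>k\<close> for the compatibility factor, written without
  division or infimum. For empty \<open>T\<close> every positive \<open>k\<close> qualifies, so that
  case needs no separate treatment in the oracle inequalities.\<close>

definition compat :: "(nat \<Rightarrow> 'v::real_inner) \<Rightarrow> nat \<Rightarrow> real \<Rightarrow> nat set \<Rightarrow> real \<Rightarrow> bool" where
  "compat a p xi T k \<longleftrightarrow> 0 < k \<and> (\<forall>u. l1 ({..<p} - T) u \<le> xi * l1 T u \<longrightarrow>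
     k * l1 T u \<le> sqrt (real (card T)) * norm (lin a p u))"

lemma compat_le:
  assumes "compat a p xi T k" "l1 ({..<p} - T) u \<le> xi * l1 T u"
  shows "l1 T u \<le> sqrt (real (card T)) / k * norm (lin a p u)"
  using assms by (auto simp: compat_def field_simps)

section \<open>Oracle inequalities for the estimation and the prediction error\<close>

lemma quadratic_max: "0 < (q :: real) \<Longrightarrow> s * x - x\<^sup>2 / (2 * q) \<le> q * s\<^sup>2 / 2"
proof -
  assume q: "0 < q"
  have "0 \<le> (x - q * s)\<^sup>2 / (2 * q)" using q by simp
  thus ?thesis using q by (simp add: field_simps power2_eq_square)
qed

lemma lasso_basic:
  assumes sol: "lasso_sol a p y lam c" and lam: "0 \<le> lam"
    and Z: "\<And>j. j < p \<Longrightarrow> \<bar>inner (a j) (y - lin a p b)\<bar> \<le> Z"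
  shows "(norm (lin a p (\<lambda>j. c j - b j)))\<^sup>2
    \<le> Z * l1 {..<p} (\<lambda>j. c j - b j) + lam * (l1 {..<p} b - l1 {..<p} c)"
proof -
  define e where "e = y - lin a p b"
  define d where "d = lin a p (\<lambda>j. c j - b j)"
  have r: "y - lin a p c = e - d" "lin a p b - lin a p c = - d" by (simp_all add: e_def d_def lin_diff)
  have "inner (e - d) (- d) \<le> lam * (l1 {..<p} b - l1 {..<p} c)"
    using lasso_sol_variational[OF sol lam, of b] unfolding r .
  hence "(norm d)\<^sup>2 \<le> inner e d + lam * (l1 {..<p} b - l1 {..<p} c)"
    by (simp add: power2_norm_eq_inner inner_diff_left)
  moreover have "inner e d \<le> Z * l1 {..<p} (\<lambda>j. c j - b j)"
    using inner_lin_le[of p a e Z "\<lambda>j. c j - b j"] Z by (simp add: d_def e_def)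
  ultimately show ?thesis by (simp add: d_def)
qed

text \<open>The parameter \<open>v\<close> decides which error dominates. If v \<bar>h\<bar>_1 is at
  most (xi + 1) times the l1 mass of \<open>b\<close> off \<open>T\<close>, the first term of the
  maximum results. Otherwise the basic inequality forces \<open>h\<close> into the cone with
  constant (xi + v) / (1 - v); compatibility then bounds the part on \<open>T\<close> by a multiple
  of the prediction error \<open>q\<close>, and maximising over \<open>q\<close> against - q^2 / (2
  lam) gives the second term.\<close>

lemma lasso_l1_bound:
  assumes sol: "lasso_sol a p y lam c" and lam: "0 < lam" and xi: "1 < xi"
    and Z: "\<And>j. j < p \<Longrightarrow> \<bar>inner (a j) (y - lin a p b)\<bar> \<le> Z"
    and noise: "Z \<le> lam * (xi - 1) / (xi + 1)"
    and T: "T \<subseteq> {..<p}" and v: "0 < v" "v < 1"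
    and comp: "compat a p ((xi + v) / (1 - v)) T k"
  shows "l1 {..<p} (\<lambda>j. c j - b j)
    \<le> (xi + 1) * max (l1 ({..<p} - T) b / v) (lam / (2 * (1 - v)) * (real (card T) / k\<^sup>2))"
proof -
  define h where "h = (\<lambda>j. c j - b j)"
  define q where "q = norm (lin a p h)"
  define A where "A = l1 T h"
  define C where "C = l1 ({..<p} - T) h"
  define B where "B = l1 ({..<p} - T) b"
  have H: "l1 {..<p} h = A + C" using l1_split[OF T] by (simp add: A_def C_def)
  have nn: "0 \<le> A" "0 \<le> C" "0 \<le> B" by (simp_all add: A_def B_def C_def l1_nonneg)
  have k: "0 < k" using comp by (simp add: compat_def)
  have dec: "l1 {..<p} b - l1 {..<p} c \<le> A - C + 2 * B"
    using l1_decrease_le[OF T, of b c] by (simp add: A_def B_def C_def h_def)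
  have "q\<^sup>2 \<le> Z * (A + C) + lam * (l1 {..<p} b - l1 {..<p} c)"
    using lasso_basic[OF sol, of b Z] lam Z by (simp add: q_def h_def[symmetric] H)
  also have "\<dots> \<le> lam * (xi - 1) / (xi + 1) * (A + C) + lam * (A - C + 2 * B)"
    using noise dec lam nn by (intro add_mono mult_right_mono mult_left_mono) auto
  also have "\<dots> = 2 * lam / (xi + 1) * (xi * A - C + (xi + 1) * B)"
    using xi by (simp add: field_simps)
  finally have main: "q\<^sup>2 \<le> 2 * lam / (xi + 1) * (xi * A - C + (xi + 1) * B)" .
  show ?thesis
  proof (cases "v * (A + C) \<le> (xi + 1) * B")
    case True
    hence "A + C \<le> (xi + 1) * (B / v)" using v by (simp add: field_simps)
    also have "\<dots> \<le> (xi + 1) * max (B / v) (lam / (2 * (1 - v)) * (real (card T) / k\<^sup>2))"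
      using xi by (intro mult_left_mono) auto
    finally show ?thesis unfolding h_def[symmetric] H B_def .
  next
    case False
    have "0 \<le> 2 * lam / (xi + 1) * (xi * A - C + (xi + 1) * B)" using main zero_le_power2[of q] by linarith
    hence "0 \<le> xi * A - C + (xi + 1) * B" using lam xi by (simp add: zero_le_mult_iff zero_le_divide_iff)
    hence "C * (1 - v) \<le> (xi + v) * A" using False by (simp add: algebra_simps)
    hence "C \<le> (xi + v) / (1 - v) * A" using v by (simp add: field_simps)
    hence A: "A \<le> sqrt (real (card T)) / k * q"
      using compat_le[OF comp, of h] by (simp add: A_def C_def q_def)
    have "xi * A - C + (xi + 1) * B \<le> (xi + 1) * A - (1 - v) * (A + C)"
      using False by (simp add: algebra_simps)
    hence "q\<^sup>2 \<le> 2 * lam / (xi + 1) * ((xi + 1) * A - (1 - v) * (A + C))"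
      using main lam xi by (smt (verit) mult_left_mono divide_nonneg_pos)
    also have "\<dots> = 2 * lam * (A - (1 - v) * (A + C) / (xi + 1))" using xi by (simp add: field_simps)
    finally have "(1 - v) * (A + C) / (xi + 1) \<le> A - q\<^sup>2 / (2 * lam)" using lam by (simp add: field_simps)
    also have "\<dots> \<le> sqrt (real (card T)) / k * q - q\<^sup>2 / (2 * lam)" using A by simp
    also have "\<dots> \<le> lam * (sqrt (real (card T)) / k)\<^sup>2 / 2" by (rule quadratic_max[OF lam])
    finally have "(1 - v) * (A + C) \<le> (xi + 1) * (lam * (real (card T) / k\<^sup>2) / 2)"
      using xi by (simp add: power_divide pos_divide_le_eq mult.commute)
    hence "A + C \<le> (xi + 1) * (lam * (real (card T) / k\<^sup>2) / 2) / (1 - v)"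
      using v by (subst pos_le_divide_eq) (simp_all add: mult.commute)
    also have "\<dots> = (xi + 1) * (lam / (2 * (1 - v)) * (real (card T) / k\<^sup>2))" by simp
    also have "\<dots> \<le> (xi + 1) * max (B / v) (lam / (2 * (1 - v)) * (real (card T) / k\<^sup>2))"
      using xi by (intro mult_left_mono) auto
    finally show ?thesis unfolding h_def[symmetric] H B_def .
  qed
qed

text \<open>Polarisation turns the inner product of X(c - b) and X(c - w) into two squares minus
  \<bar>X(b - w)\<bar>^2. The surplus square \<bar>X(c - w)\<bar>^2 is kept on the left to absorb
  the l1 terms later.\<close>

lemma lasso_prediction_aux:
  assumes sol: "lasso_sol a p y lam c" and lam: "0 < lam" and xi: "1 < xi"
    and Z: "\<And>j. j < p \<Longrightarrow> \<bar>inner (a j) (y - lin a p b)\<bar> \<le> Z"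
    and noise: "Z \<le> lam * (xi - 1) / (xi + 1)" and T: "T \<subseteq> {..<p}"
  shows "(norm (lin a p c - lin a p b))\<^sup>2 + (norm (lin a p (\<lambda>j. c j - w j)))\<^sup>2
    \<le> (norm (lin a p b - lin a p w))\<^sup>2 + 4 * lam * l1 ({..<p} - T) w
      + 4 * lam / (xi + 1) * (xi * l1 T (\<lambda>j. c j - w j) - l1 ({..<p} - T) (\<lambda>j. c j - w j))"
proof -
  define e where "e = y - lin a p b"
  define u where "u = (\<lambda>j. c j - w j)"
  define A where "A = l1 T u"
  define C where "C = l1 ({..<p} - T) u"
  define B where "B = l1 ({..<p} - T) w"
  have nn: "0 \<le> A" "0 \<le> C" by (simp_all add: A_def C_def l1_nonneg)
  have H: "l1 {..<p} u = A + C" using l1_split[OF T] by (simp add: A_def C_def)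
  define g where "g = lin a p c - lin a p b"
  have r: "y - lin a p c = e - g" "lin a p w - lin a p c = - lin a p u"
    by (simp_all add: e_def g_def u_def lin_diff)
  have "inner (e - g) (- lin a p u) \<le> lam * (l1 {..<p} w - l1 {..<p} c)"
    using lasso_sol_variational[OF sol, of w] lam unfolding r by simp
  hence 1: "inner g (lin a p u) \<le> inner e (lin a p u) + lam * (l1 {..<p} w - l1 {..<p} c)"
    by (simp add: inner_diff_left)
  have 2: "inner e (lin a p u) \<le> Z * (A + C)"
    using inner_lin_le[of p a e Z u] Z by (simp add: e_def H)
  have 3: "l1 {..<p} w - l1 {..<p} c \<le> A - C + 2 * B"
    using l1_decrease_le[OF T, of w c] by (simp add: A_def B_def C_def u_def)
  have wb: "lin a p b - lin a p w = lin a p u - g" by (simp add: g_def u_def lin_diff)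
  have 4: "2 * inner g (lin a p u)
      = (norm g)\<^sup>2 + (norm (lin a p u))\<^sup>2 - (norm (lin a p b - lin a p w))\<^sup>2"
    unfolding wb by (simp add: power2_norm_eq_inner inner_diff_left inner_diff_right inner_commute)
  have "inner g (lin a p u) \<le> lam * (xi - 1) / (xi + 1) * (A + C) + lam * (A - C + 2 * B)"
    using 1 2 mult_right_mono[OF noise, of "A + C"] mult_left_mono[OF 3, of lam] lam nn by linarith
  also have "\<dots> = 2 * lam / (xi + 1) * (xi * A - C) + 2 * lam * B"
    using xi by (simp add: field_simps)
  finally show ?thesis using 4 by (simp add: g_def u_def[symmetric] A_def B_def C_def)
qed

text \<open>Outside the cone the l1 terms have the favourable sign. Inside it compatibility bounds
  them by 2 m s q \<le> (m s)^2 + q^2, and q^2 is paid for by the surplus square.\<close>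

lemma lasso_prediction:
  assumes sol: "lasso_sol a p y lam c" and lam: "0 < lam" and xi: "1 < xi"
    and Z: "\<And>j. j < p \<Longrightarrow> \<bar>inner (a j) (y - lin a p b)\<bar> \<le> Z"
    and noise: "Z \<le> lam * (xi - 1) / (xi + 1)" and T: "T \<subseteq> {..<p}"
    and comp: "compat a p xi T k"
  shows "(norm (lin a p c - lin a p b))\<^sup>2 \<le> (norm (lin a p b - lin a p w))\<^sup>2
      + 4 * lam * l1 ({..<p} - T) w + 4 * xi\<^sup>2 * lam\<^sup>2 / (xi + 1)\<^sup>2 * (real (card T) / k\<^sup>2)"
proof -
  define u where "u = (\<lambda>j. c j - w j)"
  define A where "A = l1 T u"
  define C where "C = l1 ({..<p} - T) u"
  define q where "q = norm (lin a p u)"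
  define s where "s = sqrt (real (card T)) / k"
  have nn: "0 \<le> A" "0 \<le> C" by (simp_all add: A_def C_def l1_nonneg)
  have s2: "s\<^sup>2 = real (card T) / k\<^sup>2" by (simp add: s_def power_divide)
  note main = lasso_prediction_aux[OF sol lam xi Z noise T, of w, folded u_def, folded A_def C_def q_def]
  have "4 * lam / (xi + 1) * (xi * A - C) - q\<^sup>2 \<le> 4 * xi\<^sup>2 * lam\<^sup>2 / (xi + 1)\<^sup>2 * s\<^sup>2"
  proof (cases "xi * A < C")
    case True
    hence "4 * lam / (xi + 1) * (xi * A - C) \<le> 0"
      using lam xi by (intro mult_nonneg_nonpos) auto
    moreover have "0 \<le> 4 * xi\<^sup>2 * lam\<^sup>2 / (xi + 1)\<^sup>2 * s\<^sup>2" by simp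
    ultimately show ?thesis using zero_le_power2[of q] by linarith
  next
    case False
    hence A: "A \<le> s * q" using compat_le[OF comp, of u] by (simp add: A_def C_def q_def s_def)
    define m where "m = 2 * lam * xi / (xi + 1)"
    have m0: "0 \<le> m" using lam xi by (simp add: m_def)
    have "4 * lam / (xi + 1) * (xi * A - C) \<le> 4 * lam / (xi + 1) * (xi * A)"
      using nn lam xi by (intro mult_left_mono) auto
    also have "\<dots> = 2 * m * A" by (simp add: m_def)
    also have "\<dots> \<le> 2 * m * (s * q)" using A m0 by (intro mult_left_mono) auto
    also have "\<dots> \<le> (m * s)\<^sup>2 + q\<^sup>2" using zero_le_power2[of "m * s - q"] by (simp add: power2_diff algebra_simps)
    finally have "4 * lam / (xi + 1) * (xi * A - C) - q\<^sup>2 \<le> (m * s)\<^sup>2" by simp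
    also have "(m * s)\<^sup>2 = 4 * xi\<^sup>2 * lam\<^sup>2 / (xi + 1)\<^sup>2 * s\<^sup>2"
      by (simp add: m_def power_mult_distrib power_divide)
    finally show ?thesis .
  qed
  thus ?thesis using main unfolding s2 by linarith
qed

text \<open>With \<open>w = b\<close> and \<open>T = {}\<close> both squares on the left of the
  general inequality are the prediction error, which halves the bound. This is the case \<delta> = 0
  in the definition of \<eta>.\<close>

lemma lasso_prediction_slow:
  assumes "lasso_sol a p y lam c" "0 < lam" "1 < xi"
    and "\<And>j. j < p \<Longrightarrow> \<bar>inner (a j) (y - lin a p b)\<bar> \<le> Z"
    and "Z \<le> lam * (xi - 1) / (xi + 1)"
  shows "(norm (lin a p c - lin a p b))\<^sup>2 \<le> 2 * lam * l1 {..<p} b"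
proof -
  have "4 * lam / (xi + 1) * (xi * l1 {} (\<lambda>j. c j - b j) - l1 {..<p} (\<lambda>j. c j - b j)) \<le> 0"
    using assms(2,3) l1_nonneg[of "{..<p}" "\<lambda>j. c j - b j"]
    by (intro mult_nonneg_nonpos) (auto simp: l1_def)
  thus ?thesis using lasso_prediction_aux[OF assms, of "{}" b] by (simp add: lin_diff)
qed

section \<open>Residual norms: comparison with the target and along the lasso path\<close>

lemma residual_norm_decrease:
  assumes Z: "\<And>j. j < p \<Longrightarrow> \<bar>inner (a j) (y - lin a p b)\<bar> \<le> Z"
  shows "norm (y - lin a p b) * (norm (y - lin a p b) - norm (y - lin a p c))
    \<le> Z * l1 {..<p} (\<lambda>j. c j - b j)"
proof -
  define e where "e = y - lin a p b"
  define r where "r = y - lin a p c"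
  have "inner e (e - r) \<le> Z * l1 {..<p} (\<lambda>j. c j - b j)"
    using inner_lin_le[of p a e Z "\<lambda>j. c j - b j"] Z by (simp add: e_def r_def lin_diff)
  moreover have "inner e (e - r) = (norm e)\<^sup>2 - inner e r"
    by (simp add: inner_diff_right power2_norm_eq_inner)
  ultimately show ?thesis using norm_cauchy_schwarz[of e r]
    by (simp add: e_def[symmetric] r_def[symmetric] algebra_simps power2_eq_square)
qed

text \<open>Minimising out the scale turns the scaled lasso objective into \<bar>y - X w\<bar> + l0
  \<bar>w\<bar>_1; the inequality says that \<open>c\<close> does not exceed \<open>b\<close> in
  this criterion.\<close>

lemma scaled_lasso_residual_le:
  assumes sol: "lasso_sol a p y (norm (y - lin a p c) * l0) c" and l0: "0 \<le> l0"
    and pos: "0 < norm (y - lin a p c)"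
  shows "norm (y - lin a p c) \<le> norm (y - lin a p b) + l0 * (l1 {..<p} b - l1 {..<p} c)"
proof -
  define e where "e = y - lin a p b"
  define r where "r = y - lin a p c"
  have "inner r (r - e) \<le> norm r * l0 * (l1 {..<p} b - l1 {..<p} c)"
    using lasso_sol_variational[OF sol, of b] l0 by (simp add: e_def r_def)
  moreover have "inner r (r - e) \<ge> norm r * (norm r - norm e)"
    using norm_cauchy_schwarz[of r e] by (simp add: inner_diff_right power2_norm_eq_inner[symmetric] power2_eq_square algebra_simps)
  ultimately have "norm r * (norm r - norm e) \<le> norm r * (l0 * (l1 {..<p} b - l1 {..<p} c))"
    by (simp add: mult.assoc)
  thus ?thesis using pos by (simp add: e_def[symmetric] r_def[symmetric])
qed

text \<open>Along the lasso path the ratio of the residual norm to the penalty level decreases; at a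
  scaled lasso solution \<open>c\<close> the ratio is \<open>1 / l0\<close>.\<close>

lemma lasso_path_residual_le:
  assumes sol: "lasso_sol a p y (norm (y - lin a p c) * l0) c" and l0: "0 < l0"
    and pos: "0 < norm (y - lin a p c)"
    and sol': "lasso_sol a p y (t * l0) d" and t: "norm (y - lin a p c) < t"
  shows "norm (y - lin a p d) \<le> t"
proof (rule ccontr)
  assume neg: "\<not> norm (y - lin a p d) \<le> t"
  define r where "r = y - lin a p c"
  define q where "q = y - lin a p d"
  define D where "D = l0 * (l1 {..<p} c - l1 {..<p} d)"
  have rt: "0 < norm r" "norm r < t" "t < norm q" using pos t neg by (auto simp: r_def q_def)
  \<comment> \<open>Each solution is tested in the variational inequality of the other; the penalty
    difference \<open>D\<close> is then eliminated between the two inequalities.\<close>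
  have "inner q (q - r) \<le> t * l0 * (l1 {..<p} c - l1 {..<p} d)"
    using lasso_sol_variational[OF sol', of c] l0 rt by (simp add: q_def r_def)
  hence 1: "(norm q)\<^sup>2 - inner q r \<le> t * D"
    by (simp add: inner_diff_right power2_norm_eq_inner D_def algebra_simps)
  have "inner r (r - q) \<le> norm r * l0 * (l1 {..<p} d - l1 {..<p} c)"
    using lasso_sol_variational[OF sol, of d] l0 rt by (simp add: q_def r_def)
  hence 2: "norm r * D \<le> inner q r - (norm r)\<^sup>2"
    by (simp add: inner_diff_right power2_norm_eq_inner D_def algebra_simps inner_commute)
  have cs: "inner q r \<le> norm q * norm r" by (rule norm_cauchy_schwarz)
  have "norm r * D \<le> norm r * (norm q - norm r)" using 2 cs by (simp add: algebra_simps power2_eq_square)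
  hence D: "D \<le> norm q - norm r" using rt by simp
  have "(norm q)\<^sup>2 \<le> norm q * norm r + t * (norm q - norm r)"
    using 1 cs mult_left_mono[OF D, of t] rt by linarith
  hence "(norm q - norm r) * (norm q - t) \<le> 0" by (simp add: algebra_simps power2_eq_square)
  moreover have "0 < (norm q - norm r) * (norm q - t)" using rt by simp
  ultimately show False by simp
qed

text \<open>With u = (1 - t) s, the solution \<open>d\<close> at level u l0 satisfies the noise
  condition, so its l1 error is at most \<open>m\<close>. If the residual of \<open>c\<close> were
  below \<open>u\<close>, that of \<open>d\<close> would be at most \<open>u\<close>, a drop of at
  least s t from \<open>s\<close>. But an l1 error \<open>m\<close> lowers the residual by at most Z
  m / s, while s t = l0 m and Z < s l0. Only m = 0 escapes this contradiction.\<close>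

lemma scaled_lasso_lower:
  assumes sol: "lasso_sol a p y (norm (y - lin a p c) * l0) c" and l0: "0 < l0"
    and pos: "0 < norm (y - lin a p c)"
    and s: "norm (y - lin a p b) = s" "0 < s" and xi: "1 < xi"
    and Z: "\<And>j. j < p \<Longrightarrow> \<bar>inner (a j) (y - lin a p b)\<bar> \<le> Z" and Z0: "0 \<le> Z"
    and t: "s * t = l0 * m" "t < 1" and m: "0 \<le> m"
    and noise: "Z \<le> (1 - t) * s * l0 * (xi - 1) / (xi + 1)"
    and bound: "\<And>lam d. lasso_sol a p y lam d \<Longrightarrow> 0 < lam \<Longrightarrow> lam \<le> s * l0 \<Longrightarrow>
      Z \<le> lam * (xi - 1) / (xi + 1) \<Longrightarrow> l1 {..<p} (\<lambda>j. d j - b j) \<le> m"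
  shows "(1 - t) * s \<le> norm (y - lin a p c)"
proof (rule ccontr)
  assume neg: "\<not> (1 - t) * s \<le> norm (y - lin a p c)"
  define u where "u = (1 - t) * s"
  have u: "0 < u" using t s by (simp add: u_def)
  have t0: "0 \<le> t" using t(1) m l0 s by (metis mult_nonneg_nonneg order_less_imp_le zero_le_mult_iff not_le)
  have us: "u \<le> s" using t0 s by (simp add: u_def mult_le_cancel_right)
  obtain d where d: "lasso_sol a p y (u * l0) d" using lasso_sol_exists[of "u * l0" a p y] u l0 by auto
  have dm: "l1 {..<p} (\<lambda>j. d j - b j) \<le> m"
    using us l0 u noise by (intro bound[OF d]) (simp_all add: mult_right_mono u_def[symmetric])
  have le: "norm (y - lin a p d) \<le> u"
    using lasso_path_residual_le[OF sol l0 pos d] neg by (simp add: u_def)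
  have xi1: "(xi - 1) / (xi + 1) < 1" using xi by simp
  have Zlt: "Z < u * l0"
  proof -
    have "Z \<le> (u * l0) * ((xi - 1) / (xi + 1))" using noise by (simp add: u_def)
    also have "\<dots> < (u * l0) * 1" using u l0 xi1 by (intro mult_strict_left_mono) auto
    finally show ?thesis by simp
  qed
  have "s * (s - norm (y - lin a p d)) \<le> Z * m"
    using residual_norm_decrease[OF Z, where c = d] s mult_left_mono[OF dm Z0] by simp
  moreover have "s * (s - norm (y - lin a p d)) \<ge> s * (s * t)"
    using le s by (intro mult_left_mono) (auto simp: u_def algebra_simps)
  ultimately have 1: "s * (l0 * m) \<le> Z * m" using t(1) by simp
  have m0: "m = 0"
  proof (rule ccontr)
    assume "m \<noteq> 0"
    hence "Z * m < u * l0 * m" using Zlt m by simp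
    also have "\<dots> \<le> s * l0 * m" using us l0 m by (intro mult_right_mono) auto
    finally show False using 1 by (simp add: mult.assoc)
  qed
  \<comment> \<open>For \<open>m = 0\<close> the gap closes and another argument is needed:
    \<open>d\<close> coincides with the target, testing \<open>d\<close> against the zero vector
    with Z < s l0 makes the target vanish, and the same strict inequality then makes
    \<open>c\<close> vanish, so that its residual is not below \<open>s\<close>.\<close>
  hence t00: "t = 0" using t s by simp
  hence us: "u = s" by (simp add: u_def)
  have "l1 {..<p} (\<lambda>j. d j - b j) = 0" using dm m0 l1_nonneg[of "{..<p}" "\<lambda>j. d j - b j"] by simp
  hence db: "d j = b j" if "j < p" for j
    using that by (auto simp: l1_def sum_nonneg_eq_0_iff)
  have lb: "lin a p d = lin a p b" "l1 {..<p} d = l1 {..<p} b" by (simp_all add: lin_def l1_def db)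
  have "inner (y - lin a p b) (- lin a p b) \<le> s * l0 * (0 - l1 {..<p} b)"
    using lasso_sol_variational[OF d, of "\<lambda>_. 0"] u l0 unfolding lb us by (simp add: lin_def l1_def)
  moreover have "inner (y - lin a p b) (lin a p b) \<le> Z * l1 {..<p} b"
    using inner_lin_le[of p a "y - lin a p b" Z b] Z by simp
  ultimately have "(s * l0 - Z) * l1 {..<p} b \<le> 0" by (simp add: algebra_simps)
  hence b0: "l1 {..<p} b = 0"
    using Zlt us l1_nonneg[of "{..<p}" b] by (auto simp: mult_le_0_iff)
  hence bj: "b j = 0" if "j < p" for j using that by (auto simp: l1_def sum_nonneg_eq_0_iff)
  have cb: "l1 {..<p} (\<lambda>j. c j - b j) = l1 {..<p} c" by (simp add: l1_def bj)
  have "norm (y - lin a p c) \<le> s + l0 * (0 - l1 {..<p} c)"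
    using scaled_lasso_residual_le[OF sol _ pos, of b] l0 s b0 by simp
  hence A: "s * l0 * l1 {..<p} c \<le> s * (s - norm (y - lin a p c))"
    using mult_left_mono[of "l0 * l1 {..<p} c" "s - norm (y - lin a p c)" s] s by (simp add: mult.assoc)
  have B: "s * (s - norm (y - lin a p c)) \<le> Z * l1 {..<p} c"
    using residual_norm_decrease[OF Z, where c = c] s cb by simp
  have "(s * l0 - Z) * l1 {..<p} c \<le> 0" using A B by (simp add: algebra_simps)
  hence "l1 {..<p} c = 0" using Zlt us l1_nonneg[of "{..<p}" c] by (auto simp: mult_le_0_iff)
  hence "s * (s - norm (y - lin a p c)) \<le> 0" using B by simp
  hence "s \<le> norm (y - lin a p c)" using s by (simp add: mult_le_0_iff)
  thus False using neg t00 by simp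
qed

section \<open>Rayleigh quotients and orthogonal projections\<close>

text \<open>First-order optimality without derivatives, used for Rayleigh quotients and for least
  squares: a small step against the sign of \<open>b\<close> lets the linear term win.\<close>

lemma quadratic_nonneg_imp_linear_zero:
  fixes b c :: real
  assumes "\<And>t. 0 \<le> 2 * t * b + t\<^sup>2 * c"
  shows "b = 0"
proof (rule ccontr)
  assume b: "b \<noteq> 0"
  define C where "C = \<bar>c\<bar> + 1"
  have C: "0 < C" "c \<le> C" by (auto simp: C_def)
  have "0 \<le> 2 * (- b / C) * b + (- b / C)\<^sup>2 * c" by (rule assms)
  also have "\<dots> \<le> 2 * (- b / C) * b + (- b / C)\<^sup>2 * C" using C by (intro add_left_mono mult_left_mono) auto
  also have "\<dots> = - (b\<^sup>2 / C)" using C by (simp add: field_simps power2_eq_square)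
  finally have "b\<^sup>2 / C \<le> 0" by simp
  moreover have "0 < b\<^sup>2 / C" using b C by simp
  ultimately show False by simp
qed

text \<open>The minimum of the Rayleigh quotient is an eigenvalue: the first-order condition at a
  minimiser on the compact sphere is the eigenvector equation.\<close>

lemma symmetric_rayleigh_min:
  fixes g :: "nat \<Rightarrow> nat \<Rightarrow> real"
  assumes sym: "\<And>i j. i < d \<Longrightarrow> j < d \<Longrightarrow> g i j = g j i" and d: "0 < d"
  shows "\<exists>\<mu> v. (\<exists>i<d. v i \<noteq> 0) \<and> (\<forall>i<d. (\<Sum>j<d. g i j * v j) = \<mu> * v i)
    \<and> (\<forall>u. \<mu> * (\<Sum>i<d. (u i)\<^sup>2) \<le> (\<Sum>i<d. \<Sum>j<d. g i j * u i * u j))"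
proof -
  define Q where "Q f = (\<Sum>i<d. \<Sum>j<d. g i j * f i * f j)" for f
  define N where "N f = (\<Sum>i<d. (f i)\<^sup>2)" for f :: "nat \<Rightarrow> real"
  let ?B = "{f :: nat \<Rightarrow> real. \<forall>i. \<bar>f i\<bar> \<le> 1}"
  \<comment> \<open>\<open>N\<close> ignores the coordinates from \<open>d\<close> on, so the sphere
    alone is not compact in the function space; the box also bounds those coordinates.\<close>
  define K where "K = ?B \<inter> {f. N f = 1}"
  have cN: "continuous_on UNIV N" unfolding N_def by (intro continuous_intros continuous_on_coordinate)
  have "closed {f. N f = 1}" using closed_Collect_eq[OF cN continuous_on_const[of _ 1]] by simp
  hence "compact K" unfolding K_def by (intro compact_Int_closed compact_box)
  moreover have "(\<lambda>i. if i = 0 then 1 else 0) \<in> K"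
  proof -
    have "(\<Sum>i<d. (if i = 0 then 1 else 0 :: real)\<^sup>2) = (\<Sum>i<d. if i = 0 then 1 else 0)"
      by (rule sum.cong) auto
    thus ?thesis using d by (auto simp: K_def N_def)
  qed
  moreover have "continuous_on K Q" unfolding Q_def by (intro continuous_intros continuous_on_coordinate)
  ultimately obtain v where v: "v \<in> K" "\<And>f. f \<in> K \<Longrightarrow> Q v \<le> Q f"
    using continuous_attains_inf[of K Q] by (metis empty_iff)
  define \<mu> where "\<mu> = Q v"
  have Nv: "N v = 1" using v(1) by (simp add: K_def)
  have ray: "\<mu> * N u \<le> Q u" for u
  proof (cases "N u = 0")
    case True
    hence "\<forall>i<d. u i = 0" by (auto simp: N_def sum_nonneg_eq_0_iff)
    hence "Q u = 0" by (simp add: Q_def)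
    thus ?thesis using True by simp
  next
    case False
    have N0: "0 < N u" using False by (simp add: N_def sum_nonneg order_less_le)
    define w where "w i = (if i < d then u i / sqrt (N u) else 0)" for i
    have Nw: "N w = 1" using N0 by (simp add: N_def w_def power_divide sum_divide_distrib[symmetric])
    have "\<bar>w i\<bar> \<le> 1" for i
    proof (cases "i < d")
      case True
      have "(w i)\<^sup>2 \<le> N w" unfolding N_def using True by (intro member_le_sum) auto
      thus ?thesis using Nw abs_le_square_iff[of "w i" 1] by simp
    qed (simp add: w_def)
    hence "w \<in> K" using Nw by (simp add: K_def)
    hence "\<mu> \<le> Q w" unfolding \<mu>_def by (rule v(2))
    also have "Q w = Q u / N u"
      using N0 by (simp add: Q_def w_def sum_divide_distrib)
    finally show ?thesis using N0 by (simp add: field_simps)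
  qed
  \<comment> \<open>The defect of the eigenvector equation is itself taken as the direction of
    perturbation: the linear coefficient in \<open>t\<close> becomes twice its squared norm, which
    optimality forces to be 0.\<close>
  define s where "s i = (\<Sum>j<d. g i j * v j) - \<mu> * v i" for i
  have expand: "Q (\<lambda>i. v i + t * s i) - \<mu> * N (\<lambda>i. v i + t * s i)
      = 2 * t * N s + t\<^sup>2 * (Q s - \<mu> * N s)" for t
  proof -
    have sw: "(\<Sum>i<d. \<Sum>j<d. g i j * s i * v j) = (\<Sum>i<d. \<Sum>j<d. g i j * v i * s j)"
      by (subst sum.swap) (auto intro!: sum.cong simp: sym)
    have "Q (\<lambda>i. v i + t * s i) = Q v + t * (\<Sum>i<d. \<Sum>j<d. g i j * s i * v j)
        + t * (\<Sum>i<d. \<Sum>j<d. g i j * v i * s j) + t\<^sup>2 * Q s"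
      unfolding Q_def sum_distrib_left sum.distrib[symmetric]
      by (intro sum.cong refl) (simp add: algebra_simps power2_eq_square)
    also have "\<dots> = Q v + 2 * t * (\<Sum>i<d. \<Sum>j<d. g i j * s i * v j) + t\<^sup>2 * Q s"
      unfolding sw by simp
    also have "(\<Sum>i<d. \<Sum>j<d. g i j * s i * v j) = (\<Sum>i<d. s i * (\<Sum>j<d. g i j * v j))"
      by (simp add: sum_distrib_left algebra_simps)
    also have "\<dots> = (\<Sum>i<d. s i * s i + \<mu> * (s i * v i))"
      by (intro sum.cong refl) (simp add: s_def algebra_simps)
    finally have 1: "Q (\<lambda>i. v i + t * s i) = Q v + 2 * t * (N s + \<mu> * (\<Sum>i<d. s i * v i)) + t\<^sup>2 * Q s"
      by (simp add: sum.distrib N_def power2_eq_square sum_distrib_left)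
    have 2: "N (\<lambda>i. v i + t * s i) = N v + 2 * t * (\<Sum>i<d. s i * v i) + t\<^sup>2 * N s"
      unfolding N_def sum_distrib_left sum.distrib[symmetric]
      by (intro sum.cong refl) (simp add: algebra_simps power2_eq_square)
    show ?thesis unfolding 1 2 Nv \<mu>_def by (simp add: algebra_simps)
  qed
  have "0 \<le> 2 * t * N s + t\<^sup>2 * (Q s - \<mu> * N s)" for t
    using ray[of "\<lambda>i. v i + t * s i"] unfolding expand[symmetric] by simp
  hence "N s = 0" by (rule quadratic_nonneg_imp_linear_zero)
  hence "\<forall>i<d. s i = 0" by (auto simp: N_def sum_nonneg_eq_0_iff)
  hence eig: "\<forall>i<d. (\<Sum>j<d. g i j * v j) = \<mu> * v i" by (simp add: s_def)
  have "\<exists>i<d. v i \<noteq> 0"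
  proof (rule ccontr)
    assume "\<not> (\<exists>i<d. v i \<noteq> 0)"
    hence "N v = 0" by (simp add: N_def)
    thus False using Nv by simp
  qed
  thus ?thesis using eig ray unfolding Q_def N_def by (intro exI[of _ \<mu>] exI[of _ v] conjI allI impI) simp_all
qed

text \<open>Gram-Schmidt with zero vectors discarded. Columns may be dependent, so the cardinality
  is only bounded; this is enough, because the chi tail below needs only an upper bound on the
  number of directions.\<close>

lemma orthonormal_basis_exists:
  fixes A :: "'v::real_inner set"
  assumes "finite A"
  shows "\<exists>U. finite U \<and> card U \<le> card A \<and> span U = span A \<and> (\<forall>u\<in>U. norm u = 1)
    \<and> (\<forall>u\<in>U. \<forall>w\<in>U. u \<noteq> w \<longrightarrow> inner u w = 0)"
proof -
  obtain C where C: "finite C" "card C \<le> card A" "span C = span A" "pairwise real_inner_class.orthogonal C"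
    using basis_orthogonal[OF assms] by blast
  define f where "f u = inverse (norm u) *\<^sub>R u" for u :: 'v
  define U where "U = f ` (C - {0})"
  have "card U \<le> card C"
    unfolding U_def by (rule order.trans[OF card_image_le]) (use C(1) in \<open>auto intro: card_mono\<close>)
  moreover have "span U = span C"
  proof (rule span_eq[THEN iffD2], intro conjI subsetI)
    fix x assume "x \<in> U"
    thus "x \<in> span C" by (auto simp: U_def f_def intro: span_mul span_base)
  next
    fix x assume x: "x \<in> C"
    show "x \<in> span U"
    proof (cases "x = 0")
      case False
      have "norm x *\<^sub>R f x \<in> span U" using x False by (intro span_mul span_base) (auto simp: U_def)
      thus ?thesis using False by (simp add: f_def)
    qed (simp add: span_zero)
  qed
  moreover have "\<forall>u\<in>U. norm u = 1" by (auto simp: U_def f_def)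
  moreover have "\<forall>u\<in>U. \<forall>w\<in>U. u \<noteq> w \<longrightarrow> inner u w = 0"
    using C(4) by (auto simp: U_def f_def pairwise_def real_inner_class.orthogonal_def)
  ultimately show ?thesis using C by (intro exI[of _ U]) (auto simp: U_def)
qed

definition orthoproj :: "'v::real_inner set \<Rightarrow> 'v \<Rightarrow> 'v" where
  "orthoproj U x = (\<Sum>u\<in>U. inner x u *\<^sub>R u)"

text \<open>A relation rather than a function: it can be recognised both in the characterisation of
  \<open>proj\<close> and in an expansion over an orthonormal system, and uniqueness then identifies
  the two.\<close>

definition is_orthoproj :: "'v::real_inner set \<Rightarrow> 'v \<Rightarrow> 'v \<Rightarrow> bool" where
  "is_orthoproj A x w \<longleftrightarrow> w \<in> span A \<and> (\<forall>z\<in>A. inner z (x - w) = 0)"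

lemma inner_span_zero:
  assumes "\<And>z. z \<in> A \<Longrightarrow> inner z x = 0" "w \<in> span A"
  shows "inner w x = 0"
  using assms(2)
proof (induction rule: span_induct_alt)
  case (step c z y)
  thus ?case using assms(1)[OF step(1)] by (simp add: inner_add_left)
qed simp

lemma is_orthoproj_unique:
  assumes "is_orthoproj A x w" "is_orthoproj A x w'"
  shows "w = w'"
proof -
  have "inner (w - w') (w - w') = inner (w - w') (x - w') - inner (w - w') (x - w)"
    by (simp add: inner_diff_right)
  also have "\<dots> = 0"
  proof -
    have "w - w' \<in> span A" using assms by (auto simp: is_orthoproj_def intro: span_diff)
    hence "inner (w - w') (x - w') = 0" "inner (w - w') (x - w) = 0"
      using assms by (auto simp: is_orthoproj_def intro: inner_span_zero[of A])
    thus ?thesis by simp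
  qed
  finally show ?thesis by simp
qed

lemma orthonormal_orthoproj:
  assumes U: "finite U" "\<And>u. u \<in> U \<Longrightarrow> norm u = 1"
    "\<And>u w. u \<in> U \<Longrightarrow> w \<in> U \<Longrightarrow> u \<noteq> w \<Longrightarrow> inner u w = 0"
    and A: "span U = span A"
  shows "is_orthoproj A x (orthoproj U x)"
    and "(norm (orthoproj U x))\<^sup>2 = (\<Sum>u\<in>U. (inner x u)\<^sup>2)"
proof -
  have *: "inner w (orthoproj U x) = inner x w" if "w \<in> U" for w
  proof -
    have "inner w (orthoproj U x) = (\<Sum>u\<in>U. inner x u * inner w u)"
      by (simp add: orthoproj_def inner_sum_right)
    also have "\<dots> = (\<Sum>u\<in>U. if u = w then inner x w else 0)"
      using U(2,3) that by (intro sum.cong) (auto simp: norm_eq_1)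
    finally show ?thesis using U(1) that by simp
  qed
  have "inner z (x - orthoproj U x) = 0" if "z \<in> A" for z
  proof (rule inner_span_zero[of U])
    show "inner u (x - orthoproj U x) = 0" if "u \<in> U" for u
      using *[OF that] by (simp add: inner_diff_right inner_commute[of u x])
    show "z \<in> span U" unfolding A using that by (rule span_base)
  qed
  moreover have "orthoproj U x \<in> span A"
    unfolding orthoproj_def A[symmetric] by (intro span_sum span_mul span_base)
  ultimately show "is_orthoproj A x (orthoproj U x)" by (simp add: is_orthoproj_def)
  have "(norm (orthoproj U x))\<^sup>2 = (\<Sum>u\<in>U. inner x u * inner u (orthoproj U x))"
    unfolding power2_norm_eq_inner by (subst (1) orthoproj_def) (simp add: inner_sum_left)
  also have "\<dots> = (\<Sum>u\<in>U. (inner x u)\<^sup>2)" using * by (simp add: power2_eq_square)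
  finally show "(norm (orthoproj U x))\<^sup>2 = (\<Sum>u\<in>U. (inner x u)\<^sup>2)" .
qed

lemma is_orthoproj_exists:
  assumes "finite A"
  shows "\<exists>w. is_orthoproj A x w"
proof -
  obtain U where "finite U" "span U = span A" "\<forall>u\<in>U. norm u = 1"
      "\<forall>u\<in>U. \<forall>w\<in>U. u \<noteq> w \<longrightarrow> inner u w = 0"
    using orthonormal_basis_exists[OF assms] by (elim exE conjE) (rule that)
  hence "is_orthoproj A x (orthoproj U x)" by (intro orthonormal_orthoproj(1)) simp_all
  thus ?thesis ..
qed

lemma is_orthoproj_inner:
  assumes "is_orthoproj A x w" "q \<in> span A"
  shows "inner q x = inner q w"
proof -
  have "inner q (x - w) = 0"
    by (rule inner_span_zero[OF _ assms(2)]) (use assms(1) in \<open>simp add: is_orthoproj_def\<close>)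
  thus ?thesis by (simp add: inner_diff_right)
qed

section \<open>Compatibility factor, \<open>\<mu>\<close> and \<open>\<eta>\<^sub>*\<close>\<close>

text \<open>Division by sqrt n absorbs the normalisations: \<open>rms_residual\<close> becomes a
  norm, the entries of \<open>gram\<close> become inner products of scaled columns, and the
  numerator of \<open>z_star\<close> becomes the largest correlation in absolute value.\<close>

definition scaled_vec :: "nat \<Rightarrow> real vec \<Rightarrow> fseq" where
  "scaled_vec n v = (1 / sqrt (real n)) *\<^sub>R fseq_of n (\<lambda>i. v $ i)"

definition scaled_col :: "real mat \<Rightarrow> nat \<Rightarrow> fseq" where
  "scaled_col X j = scaled_vec (dim_row X) (col X j)"

lemma inner_scaled_vec: "inner (scaled_vec n u) (scaled_vec n v) = (\<Sum>i<n. u $ i * v $ i) / real n"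
  by (simp add: scaled_vec_def inner_fseq_of field_simps)

lemma l2norm_nonneg: "0 \<le> l2norm v"
  by (simp add: l2norm_def sum_nonneg)

lemma norm_scaled_vec:
  assumes "dim_vec v = n"
  shows "norm (scaled_vec n v) = l2norm v / sqrt (real n)"
  using assms by (simp add: norm_eq_sqrt_inner inner_scaled_vec l2norm_def real_sqrt_divide power2_eq_square)

lemma scaled_vec_diff:
  assumes "u \<in> carrier_vec n" "v \<in> carrier_vec n"
  shows "scaled_vec n (u - v) = scaled_vec n u - scaled_vec n v"
  using assms unfolding scaled_vec_def scaleR_diff_right[symmetric] fseq_of_diff
  by (auto intro!: arg_cong[where f = "(*\<^sub>R) _"] fseq_of_cong)

lemma scaled_vec_mult:
  assumes X: "X \<in> carrier_mat n p" and u: "u \<in> carrier_vec p"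
  shows "scaled_vec n (X *\<^sub>v u) = lin (scaled_col X) p (\<lambda>j. u $ j)"
proof -
  have "lin (scaled_col X) p (\<lambda>j. u $ j)
      = (\<Sum>j<p. fseq_of n (\<lambda>i. (1 / sqrt (real n)) * (u $ j * col X j $ i)))"
    unfolding lin_def using X by (simp add: scaled_col_def scaled_vec_def fseq_of_scaleR mult_ac)
  also have "\<dots> = fseq_of n (\<lambda>i. (1 / sqrt (real n)) * (X *\<^sub>v u) $ i)"
    unfolding fseq_of_sum
  proof (rule fseq_of_cong)
    fix i assume i: "i < n"
    have "(X *\<^sub>v u) $ i = (\<Sum>j<p. X $$ (i, j) * u $ j)"
      using X u i by (simp add: scalar_prod_def atLeast0LessThan)
    also have "\<dots> = (\<Sum>j<p. u $ j * col X j $ i)"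
      using X i by (intro sum.cong) auto
    finally show "(\<Sum>j<p. (1 / sqrt (real n)) * (u $ j * col X j $ i)) = (1 / sqrt (real n)) * (X *\<^sub>v u) $ i"
      by (simp add: sum_divide_distrib)
  qed
  finally show ?thesis by (simp add: scaled_vec_def fseq_of_scaleR)
qed

lemma scaled_vec_inj:
  assumes "u \<in> carrier_vec n" "v \<in> carrier_vec n" "0 < n" "scaled_vec n u = scaled_vec n v"
  shows "u = v"
proof -
  have "norm (scaled_vec n (u - v)) = 0" using assms by (simp add: scaled_vec_diff)
  hence "(\<Sum>i<n. ((u - v) $ i)\<^sup>2) = 0"
    using assms by (simp add: norm_scaled_vec l2norm_def)
  hence "\<forall>i<n. (u - v) $ i = 0" by (subst (asm) sum_nonneg_eq_0_iff) auto
  thus ?thesis using assms by (intro eq_vecI) auto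
qed

lemma scaled_vec_residual:
  assumes "X \<in> carrier_mat n p" "u \<in> carrier_vec p" "y \<in> carrier_vec n"
  shows "scaled_vec n (y - X *\<^sub>v u) = scaled_vec n y - lin (scaled_col X) p (\<lambda>j. u $ j)"
  using assms by (simp add: scaled_vec_diff[of _ n] scaled_vec_mult[of _ n p])

lemma rms_residual_eq_norm:
  assumes "X \<in> carrier_mat n p" "u \<in> carrier_vec p" "y \<in> carrier_vec n"
  shows "rms_residual X y u = norm (scaled_vec n y - lin (scaled_col X) p (\<lambda>j. u $ j))"
  using assms unfolding rms_residual_def
  by (subst scaled_vec_residual[OF assms, symmetric], subst norm_scaled_vec) auto

lemma l1on_eq: "l1on T u = l1 T (\<lambda>j. u $ j)"
  by (simp add: l1on_def l1_def)

lemma inner_scaled_col_le_linfnorm: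
  assumes X: "X \<in> carrier_mat n p" and v: "v \<in> carrier_vec n" and j: "j < p"
  shows "\<bar>inner (scaled_col X j) (scaled_vec n v)\<bar> \<le> linfnorm ((1 / real n) \<cdot>\<^sub>v (X\<^sup>T *\<^sub>v v))"
proof -
  let ?w = "(1 / real n) \<cdot>\<^sub>v (X\<^sup>T *\<^sub>v v)"
  have "inner (scaled_col X j) (scaled_vec n v) = ?w $ j"
    using assms by (simp add: scaled_col_def inner_scaled_vec scalar_prod_def atLeast0LessThan)
  moreover have "\<bar>?w $ j\<bar> \<le> linfnorm ?w"
    unfolding linfnorm_def using assms by (intro Max_ge) auto
  ultimately show ?thesis by simp
qed

text \<open>Joint minimality is used in one variable at a time. In the scale with \<open>bh\<close>
  fixed, it identifies \<open>sh\<close> with the residual norm; in the coefficients with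
  \<open>sh\<close> fixed, multiplication of the objective by \<open>sh\<close> leaves a lasso
  problem.\<close>

lemma scaled_lasso_lasso_sol:
  assumes sl: "is_scaled_lasso X y lam0 bh sh" and X: "X \<in> carrier_mat n p"
    and y: "y \<in> carrier_vec n" and n: "0 < n"
  shows "bh \<in> carrier_vec p" "0 < sh" "sh = rms_residual X y bh"
    "lasso_sol (scaled_col X) p (scaled_vec n y) (sh * lam0) (\<lambda>j. bh $ j)"
proof -
  define a where "a = scaled_col X"
  define Y where "Y = scaled_vec n y"
  define F where "F w s = (norm (Y - lin a p w))\<^sup>2 / (2 * s) + s / 2 + lam0 * l1 {..<p} w" for w s
  show bh: "bh \<in> carrier_vec p" and sh: "0 < sh"
    using sl X by (auto simp: is_scaled_lasso_def is_arg_min_def)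
  have obj: "scaled_lasso_objective X y lam0 (w, s) = F (\<lambda>j. w $ j) s" if "w \<in> carrier_vec p" for w s
  proof -
    have "norm (Y - lin a p (\<lambda>j. w $ j)) = l2norm (y - X *\<^sub>v w) / sqrt (real n)"
      using rms_residual_eq_norm[OF X that y] X by (simp add: rms_residual_def a_def Y_def)
    thus ?thesis using that X n
      by (simp add: scaled_lasso_objective_def F_def l1norm_def l1on_eq power_divide)
  qed
  have min: "F (\<lambda>j. bh $ j) sh \<le> F w s" if "0 < s" for w s
  proof -
    have "F (\<lambda>j. vec p w $ j) s = F w s"
      by (simp add: F_def lin_def l1_def)
    moreover have "\<not> scaled_lasso_objective X y lam0 (vec p w, s) < scaled_lasso_objective X y lam0 (bh, sh)"
      using sl X that by (auto simp: is_scaled_lasso_def is_arg_min_def)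
    ultimately show ?thesis using obj[OF bh] obj[of "vec p w"] by simp
  qed
  define r where "r = norm (Y - lin a p (\<lambda>j. bh $ j))"
  have r0: "0 \<le> r" by (simp add: r_def)
  have rs: "r\<^sup>2 / (2 * sh) + sh / 2 \<le> r\<^sup>2 / (2 * s) + s / 2" if "0 < s" for s
    using min[OF that, of "\<lambda>j. bh $ j"] by (simp add: F_def r_def)
  \<comment> \<open>With zero residual the objective would still decrease when the scale is halved,
    so no minimum would be attained at a positive scale.\<close>
  have "r \<noteq> 0"
  proof
    assume "r = 0"
    thus False using rs[of "sh / 2"] sh by simp
  qed
  hence rp: "0 < r" using r0 by simp
  \<comment> \<open>Comparison with scale \<open>r\<close>, the equality case of the
    arithmetic-geometric mean inequality; the converse inequality always holds, hence
    \<open>r = sh\<close>.\<close>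
  have "r\<^sup>2 / (2 * sh) + sh / 2 \<le> r" using rs[OF rp] rp by (simp add: power2_eq_square)
  hence "(r - sh)\<^sup>2 \<le> 0" using sh by (simp add: field_simps power2_eq_square)
  hence r: "r = sh" by simp
  thus "sh = rms_residual X y bh"
    using rms_residual_eq_norm[OF X bh y] by (simp add: r_def a_def Y_def)
  show "lasso_sol (scaled_col X) p (scaled_vec n y) (sh * lam0) (\<lambda>j. bh $ j)"
    unfolding lasso_sol_def a_def[symmetric] Y_def[symmetric]
  proof
    fix w
    have "sh * F (\<lambda>j. bh $ j) sh \<le> sh * F w sh" using min[OF sh, of w] sh by (intro mult_left_mono) auto
    thus "(norm (Y - lin a p (\<lambda>j. bh $ j)))\<^sup>2 / 2 + sh * lam0 * l1 {..<p} (\<lambda>j. bh $ j)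
      \<le> (norm (Y - lin a p w))\<^sup>2 / 2 + sh * lam0 * l1 {..<p} w"
      using sh by (simp add: F_def distrib_left mult.assoc)
  qed
qed

text \<open>Shows that the infimum in \<open>kappa\<close> ranges over a nonempty set, which
  greatest lower bounds of reals require.\<close>

lemma unit_vec_in_cone:
  assumes "j \<in> T" "T \<subseteq> {..<p}" "0 \<le> xi"
  shows "unit_vec p j \<in> cone p xi T - {0\<^sub>v p}"
proof -
  have j: "j < p" using assms by auto
  have "l1on ({..<p} - T) (unit_vec p j) = 0"
    using assms by (auto simp: l1on_def unit_vec_def intro!: sum.neutral)
  moreover have "0 \<le> l1on T (unit_vec p j)" by (simp add: l1on_def sum_nonneg)
  moreover have "unit_vec p j \<noteq> (0\<^sub>v p :: real vec)"
  proof
    assume "unit_vec p j = (0\<^sub>v p :: real vec)"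
    hence "(unit_vec p j :: real vec) $ j = 0" using j by simp
    thus False using j by simp
  qed
  ultimately show ?thesis using assms by (auto simp: cone_def)
qed

lemma kappa_compat:
  assumes X: "X \<in> carrier_mat n p" and n: "0 < n" and T: "T \<subseteq> {..<p}" "T \<noteq> {}" and xi: "0 \<le> xi"
  shows "0 \<le> kappa X xi T" "kappa X xi T \<noteq> 0 \<Longrightarrow> compat (scaled_col X) p xi T (kappa X xi T)"
proof -
  let ?f = "\<lambda>u. sqrt (real (card T)) * l2norm (X *\<^sub>v u) / (sqrt (real n) * l1on T u)"
  have nn: "0 \<le> ?f u" for u by (intro divide_nonneg_nonneg mult_nonneg_nonneg l2norm_nonneg) (simp_all add: l1on_eq l1_nonneg)
  have k: "kappa X xi T = (INF u \<in> cone p xi T - {0\<^sub>v p}. ?f u)" using X by (simp add: kappa_def)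
  obtain j where "j \<in> T" using T by blast
  hence ne: "cone p xi T - {0\<^sub>v p} \<noteq> {}" using unit_vec_in_cone[of j T p xi] T xi by blast
  show k0: "0 \<le> kappa X xi T" unfolding k by (rule cINF_greatest[OF ne]) (rule nn)
  assume "kappa X xi T \<noteq> 0"
  hence kp: "0 < kappa X xi T" using k0 by simp
  show "compat (scaled_col X) p xi T (kappa X xi T)"
    unfolding compat_def
  proof (intro conjI allI impI kp)
    fix u assume u: "l1 ({..<p} - T) u \<le> xi * l1 T u"
    let ?v = "vec p u"
    have lT: "l1on T ?v = l1 T u" "l1on ({..<p} - T) ?v = l1 ({..<p} - T) u"
      using T by (auto simp: l1on_def l1_def intro!: sum.cong)
    have lin: "lin (scaled_col X) p (\<lambda>j. ?v $ j) = lin (scaled_col X) p u" by (simp add: lin_def)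
    have nrm: "norm (lin (scaled_col X) p u) = l2norm (X *\<^sub>v ?v) / sqrt (real n)"
      unfolding lin[symmetric]
      by (subst scaled_vec_mult[OF X, symmetric], simp, subst norm_scaled_vec) (use X in auto)
    show "kappa X xi T * l1 T u \<le> sqrt (real (card T)) * norm (lin (scaled_col X) p u)"
    proof (cases "l1 T u = 0")
      case False
      hence pos: "0 < l1 T u" using l1_nonneg[of T u] by simp
      have "?v \<noteq> 0\<^sub>v p"
      proof
        assume "?v = 0\<^sub>v p"
        hence "l1on T ?v = l1on T (0\<^sub>v p)" by simp
        also have "\<dots> = 0" using T by (auto simp: l1on_def intro!: sum.neutral)
        finally show False using pos lT by simp
      qed
      hence "?v \<in> cone p xi T - {0\<^sub>v p}" using u lT by (simp add: cone_def)
      hence "kappa X xi T \<le> ?f ?v" unfolding k by (intro cINF_lower bdd_belowI2[of _ 0]) (auto simp: nn)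
      also have "\<dots> = sqrt (real (card T)) * norm (lin (scaled_col X) p u) / l1 T u"
        unfolding nrm lT by simp
      finally show ?thesis using pos by (simp add: field_simps)
    qed simp
  qed
qed

text \<open>The distinction through which the oracle bounds pass: either the quotient is infinite,
  where a positive penalty level makes the bound trivial, or it is given by a constant
  \<open>k\<close> to which the inequalities above apply. For empty \<open>T\<close> the choice
  \<open>k = 1\<close> serves, since the cardinality is 0.\<close>

lemma card_over_kappa2_cases:
  assumes X: "X \<in> carrier_mat n p" and n: "0 < n" and T: "T \<subseteq> {..<p}" and xi: "0 \<le> xi"
  obtains "card_over_kappa2 X xi T = \<infinity>"
  | k where "compat (scaled_col X) p xi T k" "card_over_kappa2 X xi T = ereal (real (card T) / k\<^sup>2)"
proof (cases "T = {}")
  case True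
  hence "compat (scaled_col X) p xi T 1" "card_over_kappa2 X xi T = ereal (real (card T) / 1\<^sup>2)"
    by (simp_all add: compat_def l1_def card_over_kappa2_def)
  thus ?thesis by (rule that(2))
next
  case False
  have c: "0 < card T" using False T by (meson card_gt_0_iff finite_lessThan finite_subset)
  show ?thesis
  proof (cases "kappa X xi T = 0")
    case True
    thus ?thesis using False c by (intro that(1)) (simp add: card_over_kappa2_def divide_ereal_def)
  next
    case k: False
    show ?thesis using kappa_compat(2)[OF X n T False xi k] False k
      by (intro that(2)[of "kappa X xi T"]) (simp_all add: card_over_kappa2_def)
  qed
qed

lemma card_over_kappa2_nonneg: "0 \<le> card_over_kappa2 X xi T"
  by (auto simp: card_over_kappa2_def divide_ereal_def intro!: ereal_0_le_mult)

section \<open>Finiteness, monotonicity and scaling of \<open>mu\<close> as a function of the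
  penalty level\<close>

definition mu_term :: "real mat \<Rightarrow> real vec \<Rightarrow> real \<Rightarrow> real \<Rightarrow> nat set \<Rightarrow> real \<Rightarrow> ereal" where
  "mu_term X b lam xi T v = max (ereal (l1on ({..<dim_col X} - T) b / v))
     (ereal (lam / (2 * (1 - v))) * card_over_kappa2 X ((xi + v) / (1 - v)) T)"

definition mu_inf :: "real mat \<Rightarrow> real vec \<Rightarrow> real \<Rightarrow> real \<Rightarrow> ereal" where
  "mu_inf X b lam xi = (INF T \<in> Pow {..<dim_col X}. INF v \<in> {0<..<1}. mu_term X b lam xi T v)"

lemma mu_eq: "mu X b lam xi = (xi + 1) * real_of_ereal (mu_inf X b lam xi)"
  by (simp add: mu_def mu_inf_def mu_term_def)

lemma mu_inf_le: "T \<subseteq> {..<dim_col X} \<Longrightarrow> 0 < v \<Longrightarrow> v < 1 \<Longrightarrow> mu_inf X b lam xi \<le> mu_term X b lam xi T v"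
  unfolding mu_inf_def by (rule INF_lower2[of T]) (auto intro: INF_lower)

lemma mu_inf_greatest:
  "(\<And>T v. T \<subseteq> {..<dim_col X} \<Longrightarrow> 0 < v \<Longrightarrow> v < 1 \<Longrightarrow> c \<le> mu_term X b lam xi T v) \<Longrightarrow> c \<le> mu_inf X b lam xi"
  unfolding mu_inf_def by (intro INF_greatest) auto

lemma mu_inf_finite: "0 \<le> mu_inf X b lam xi" "\<bar>mu_inf X b lam xi\<bar> \<noteq> \<infinity>"
proof -
  show 1: "0 \<le> mu_inf X b lam xi"
    by (rule mu_inf_greatest) (simp add: mu_term_def le_max_iff_disj l1on_eq l1_nonneg)
  have "mu_inf X b lam xi \<le> mu_term X b lam xi {} (1/2)" by (rule mu_inf_le) auto
  also have "\<dots> = ereal (max (l1on {..<dim_col X} b / (1/2)) 0)"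
    unfolding ereal_max by (simp add: mu_term_def card_over_kappa2_def zero_ereal_def[symmetric])
  finally show "\<bar>mu_inf X b lam xi\<bar> \<noteq> \<infinity>"
    using 1 by (cases "mu_inf X b lam xi") (simp_all del: ereal_max)
qed

lemma mu_nonneg: "-1 \<le> xi \<Longrightarrow> 0 \<le> mu X b lam xi"
  using mu_inf_finite[of X b lam xi] by (simp add: mu_eq real_of_ereal_pos)

lemma mu_lower:
  assumes "-1 \<le> xi"
    "\<And>T v. T \<subseteq> {..<dim_col X} \<Longrightarrow> 0 < v \<Longrightarrow> v < 1 \<Longrightarrow> ereal c \<le> mu_term X b lam xi T v"
  shows "(xi + 1) * c \<le> mu X b lam xi"
proof -
  have "ereal c \<le> mu_inf X b lam xi" by (rule mu_inf_greatest) (rule assms(2))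
  hence "c \<le> real_of_ereal (mu_inf X b lam xi)"
    using mu_inf_finite[of X b lam xi] by (cases "mu_inf X b lam xi") auto
  thus ?thesis unfolding mu_eq using assms(1) by (intro mult_left_mono) auto
qed

lemma mu_inf_mono:
  assumes "lam \<le> lam'"
  shows "mu_inf X b lam xi \<le> mu_inf X b lam' xi"
proof (rule mu_inf_greatest)
  fix T v assume T: "T \<subseteq> {..<dim_col X}" and v: "0 < v" "v < (1 :: real)"
  have "mu_inf X b lam xi \<le> mu_term X b lam xi T v" by (rule mu_inf_le[OF T v])
  also have "\<dots> \<le> mu_term X b lam' xi T v"
    unfolding mu_term_def using assms v
    by (intro max.mono order.refl ereal_mult_right_mono card_over_kappa2_nonneg)
      (simp add: divide_right_mono)
  finally show "mu_inf X b lam xi \<le> mu_term X b lam' xi T v" .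
qed

lemma mu_mono: "-1 \<le> xi \<Longrightarrow> lam \<le> lam' \<Longrightarrow> mu X b lam xi \<le> mu X b lam' xi"
  unfolding mu_eq using mu_inf_mono[of lam lam' X b xi] mu_inf_finite[of X b lam' xi] mu_inf_finite[of X b lam xi]
  by (intro mult_left_mono real_of_ereal_positive_mono) auto

text \<open>Enlarging the level by \<open>c\<close> multiplies one term of each maximum by
  \<open>c\<close> and leaves the other, which is nonnegative, fixed; so the infimum grows at most
  by the factor \<open>c\<close>. It serves to compare the levels of \<open>shat\<close> and
  \<sigma>^* when \<open>shat\<close> is the larger.\<close>

lemma mu_scale:
  assumes xi: "-1 \<le> xi" and c: "1 \<le> c" and lam: "0 \<le> lam"
  shows "mu X b (c * lam) xi \<le> c * mu X b lam xi"
proof -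
  define m where "m = real_of_ereal (mu_inf X b (c * lam) xi)"
  have m: "mu_inf X b (c * lam) xi = ereal m"
    using mu_inf_finite[of X b "c * lam" xi] by (simp add: m_def ereal_real)
  have "(xi + 1) * (m / c) \<le> mu X b lam xi"
  proof (rule mu_lower[OF xi])
    fix T v assume T: "T \<subseteq> {..<dim_col X}" and v: "0 < v" "v < (1 :: real)"
    let ?K = "card_over_kappa2 X ((xi + v) / (1 - v)) T"
    let ?B = "l1on ({..<dim_col X} - T) b / v"
    have le: "ereal m \<le> mu_term X b (c * lam) xi T v" using mu_inf_le[OF T v, of b "c * lam" xi] m by simp
    have B: "0 \<le> ?B" using v by (simp add: l1on_eq l1_nonneg)
    show "ereal (m / c) \<le> mu_term X b lam xi T v"
    proof (cases "?K")
      case (real k)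
      have "m \<le> max ?B (c * lam / (2 * (1 - v)) * k)"
        using le unfolding mu_term_def real by (simp add: ereal_max[symmetric] del: ereal_max)
      also have "\<dots> \<le> c * max ?B (lam / (2 * (1 - v)) * k)"
      proof (rule max.boundedI)
        have "1 * ?B \<le> c * max ?B (lam / (2 * (1 - v)) * k)" using B c by (intro mult_mono) auto
        thus "?B \<le> c * max ?B (lam / (2 * (1 - v)) * k)" by simp
        have "c * (lam / (2 * (1 - v)) * k) \<le> c * max ?B (lam / (2 * (1 - v)) * k)"
          using c by (intro mult_left_mono) auto
        thus "c * lam / (2 * (1 - v)) * k \<le> c * max ?B (lam / (2 * (1 - v)) * k)" by simp
      qed
      finally have "m / c \<le> max ?B (lam / (2 * (1 - v)) * k)" using c by (simp add: field_simps)
      thus ?thesis unfolding mu_term_def real by (simp add: ereal_max[symmetric] del: ereal_max)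
    next
      case PInf
      show ?thesis
      \<comment> \<open>In \<open>ereal\<close> the product 0 * \<infinity> is 0, so at level 0 the
        term stays finite in spite of the infinite quotient.\<close>
      proof (cases "lam = 0")
        case True
        hence "m \<le> ?B" using le B unfolding mu_term_def by (simp add: zero_ereal_def[symmetric] max_def split: if_splits)
        moreover have "m / c \<le> m \<or> m \<le> 0" using c by (simp add: divide_le_eq) (smt (verit) mult_le_cancel_left1)
        ultimately have "m / c \<le> ?B" using B c by (smt (verit) divide_nonpos_pos)
        thus ?thesis by (simp add: mu_term_def le_max_iff_disj)
      next
        case False
        hence "ereal (lam / (2 * (1 - v))) * \<infinity> = \<infinity>" using lam v by simp
        thus ?thesis unfolding mu_term_def PInf by simp
      qed
    next
      case MInf
      thus ?thesis using card_over_kappa2_nonneg[of X "(xi + v) / (1 - v)" T] by simp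
    qed
  qed
  thus ?thesis using c by (simp add: mu_eq m_def field_simps)
qed

lemma lasso_l1_le_mu:
  assumes sol: "lasso_sol (scaled_col X) p Y lam c" and lam: "0 < lam" and xi: "1 < xi"
    and X: "X \<in> carrier_mat n p" and n: "0 < n"
    and Z: "\<And>j. j < p \<Longrightarrow> \<bar>inner (scaled_col X j) (Y - lin (scaled_col X) p (\<lambda>j. b $ j))\<bar> \<le> Z"
    and noise: "Z \<le> lam * (xi - 1) / (xi + 1)"
  shows "l1 {..<p} (\<lambda>j. c j - b $ j) \<le> mu X b lam xi"
proof -
  define H where "H = l1 {..<p} (\<lambda>j. c j - b $ j)"
  have pX: "dim_col X = p" using X by simp
  have "(xi + 1) * (H / (xi + 1)) \<le> mu X b lam xi"
  proof (rule mu_lower)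
    fix T v assume T: "T \<subseteq> {..<dim_col X}" and v: "0 < v" "v < (1 :: real)"
    have T': "T \<subseteq> {..<p}" using T pX by simp
    have x0: "0 \<le> (xi + v) / (1 - v)" using xi v by simp
    show "ereal (H / (xi + 1)) \<le> mu_term X b lam xi T v"
    proof (cases rule: card_over_kappa2_cases[OF X n T' x0])
      case 1
      have "ereal (lam / (2 * (1 - v))) * \<infinity> = \<infinity>" using lam v by simp
      thus ?thesis by (simp add: mu_term_def 1)
    next
      case (2 k)
      have "H \<le> (xi + 1) * max (l1 ({..<p} - T) (\<lambda>j. b $ j) / v) (lam / (2 * (1 - v)) * (real (card T) / k\<^sup>2))"
        unfolding H_def by (rule lasso_l1_bound[OF sol lam xi Z noise T' v 2(1)])
      hence "H / (xi + 1) \<le> max (l1 ({..<p} - T) (\<lambda>j. b $ j) / v) (lam / (2 * (1 - v)) * (real (card T) / k\<^sup>2))"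
        using xi by (simp add: pos_divide_le_eq mult.commute)
      thus ?thesis unfolding mu_term_def 2 times_ereal.simps ereal_max[symmetric] ereal_less_eq pX l1on_eq .
    qed
  qed (use xi in simp)
  thus ?thesis using xi by (simp add: H_def)
qed

lemma lasso_prediction_le_eta_star:
  assumes sol: "lasso_sol (scaled_col X) p Y lam c" and lam: "0 < lam" and xi: "1 < xi"
    and X: "X \<in> carrier_mat n p" and n: "0 < n" and b: "b \<in> carrier_vec p"
    and Z: "\<And>j. j < p \<Longrightarrow> \<bar>inner (scaled_col X j) (Y - lin (scaled_col X) p (\<lambda>j. b $ j))\<bar> \<le> Z"
    and noise: "Z \<le> lam * (xi - 1) / (xi + 1)"
  shows "(norm (lin (scaled_col X) p c - lin (scaled_col X) p (\<lambda>j. b $ j)))\<^sup>2 \<le> eta_star X b lam xi"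
proof -
  define q where "q = (norm (lin (scaled_col X) p c - lin (scaled_col X) p (\<lambda>j. b $ j)))\<^sup>2"
  define I where "I = (INF (w, T) \<in> carrier_vec p \<times> Pow {..<p}. eta X b lam xi w T)"
  have pX: "dim_col X = p" "dim_row X = n" using X by simp_all
  have "ereal q \<le> eta X b lam xi w T" if w: "w \<in> carrier_vec p" and T: "T \<subseteq> {..<p}" for w T
  proof (cases "w = b \<and> T = {}")
    case True
    have "q \<le> 2 * lam * l1 {..<p} (\<lambda>j. b $ j)"
      unfolding q_def by (rule lasso_prediction_slow[OF sol lam xi Z noise])
    moreover have "l2norm (X *\<^sub>v b - X *\<^sub>v b) = 0" using X b by (simp add: l2norm_def)
    ultimately show ?thesis using True by (simp add: eta_def pX card_over_kappa2_def l1on_eq)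
  next
    case False
    have nn: "norm (lin (scaled_col X) p (\<lambda>j. b $ j) - lin (scaled_col X) p (\<lambda>j. w $ j))
        = l2norm (X *\<^sub>v b - X *\<^sub>v w) / sqrt (real n)"
      using X b w by (simp add: scaled_vec_mult[OF X, symmetric] scaled_vec_diff[of _ n, symmetric] norm_scaled_vec)
    have x0: "0 \<le> xi" using xi by simp
    have cpos: "0 < 4 * xi\<^sup>2 * lam\<^sup>2 / (xi + 1)\<^sup>2" using lam xi by simp
    show ?thesis
    proof (cases rule: card_over_kappa2_cases[OF X n T x0])
      case 1
      have "ereal r * \<infinity> = \<infinity>" if "0 < r" for r using that by simp
      from this[OF cpos] have "ereal (4 * xi\<^sup>2 * lam\<^sup>2 / (xi + 1)\<^sup>2) * \<infinity> = \<infinity>" .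
      thus ?thesis by (simp add: eta_def 1 del: times_ereal.simps)
    next
      case (2 k)
      have "q \<le> (l2norm (X *\<^sub>v b - X *\<^sub>v w))\<^sup>2 / real n + 4 * lam * l1 ({..<p} - T) (\<lambda>j. w $ j)
          + 4 * xi\<^sup>2 * lam\<^sup>2 / (xi + 1)\<^sup>2 * (real (card T) / k\<^sup>2)"
        using lasso_prediction[OF sol lam xi Z noise T 2(1), of "\<lambda>j. w $ j"]
        unfolding q_def nn by (simp add: power_divide)
      thus ?thesis using False by (auto simp: eta_def 2 pX l1on_eq)
    qed
  qed
  hence low: "ereal q \<le> I" unfolding I_def by (intro INF_greatest) auto
  \<comment> \<open>\<open>real_of_ereal\<close> sends \<infinity> to 0, so the infimum must be
    known to be finite before the lower bound can be transferred to \<open>eta_star\<close>.\<close>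
  have "I \<le> eta X b lam xi b {}"
    unfolding I_def using b by (intro INF_lower2[of "(b, {})"]) auto
  also have "\<dots> < \<infinity>" by (simp add: eta_def card_over_kappa2_def)
  finally have "q \<le> real_of_ereal I" using low by (cases I) auto
  thus ?thesis by (simp add: eta_star_def I_def q_def pX)
qed

section \<open>Column submatrices\<close>

text \<open>\<open>pick B k\<close> is the element of \<open>B\<close> with exactly \<open>k\<close>
  predecessors in \<open>B\<close>. Submatrices list their columns in this order, so sums over their
  columns can be reindexed as sums over \<open>B\<close>.\<close>

lemma bij_betw_pick:
  assumes "finite B"
  shows "bij_betw (pick B) {..<card B} B"
proof (rule bij_betw_imageI)
  show "inj_on (pick B) {..<card B}"
    by (rule inj_onI) (metis lessThan_iff linorder_neq_iff order_less_irrefl pick_mono_le)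
  have "j \<in> pick B ` {..<card B}" if "j \<in> B" for j
  proof
    show "j = pick B (card {a\<in>B. a < j})" using pick_card_in_set[OF that] by simp
    have "{a\<in>B. a < j} \<subset> B" using that by auto
    thus "card {a\<in>B. a < j} \<in> {..<card B}" using assms by (simp add: psubset_card_mono)
  qed
  thus "pick B ` {..<card B} = B" by (auto intro: pick_in_set_le)
qed

lemma columns_carrier:
  assumes "X \<in> carrier_mat n p" "B \<subseteq> {..<p}"
  shows "columns X B \<in> carrier_mat n (card B)"
proof -
  have "{j. j < p \<and> j \<in> B} = B" using assms by auto
  thus ?thesis using assms by (intro carrier_matI) (simp_all add: columns_def dim_submatrix)
qed

lemma scaled_col_columns:
  assumes X: "X \<in> carrier_mat n p" and B: "B \<subseteq> {..<p}" and k: "k < card B"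
  shows "scaled_col (columns X B) k = scaled_col X (pick B k)"
proof -
  have eq: "{j. j < p \<and> j \<in> B} = B" using B by auto
  have pk: "pick B k < p" using pick_in_set_le[OF k] B by auto
  have "col (columns X B) k = col X (pick B k)"
  proof (rule eq_vecI)
    show "dim_vec (col (columns X B) k) = dim_vec (col X (pick B k))"
      using columns_carrier[OF X B] X by simp
    fix i assume "i < dim_vec (col X (pick B k))"
    hence i: "i < n" using X by simp
    have "columns X B $$ (i, k) = X $$ (pick UNIV i, pick B k)"
      unfolding columns_def using X i k eq by (intro submatrix_index) auto
    thus "col (columns X B) k $ i = col X (pick B k) $ i"
      using columns_carrier[OF X B] X i k pk by (simp add: pick_UNIV)
  qed
  thus ?thesis using columns_carrier[OF X B] X by (simp add: scaled_col_def)
qed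

lemma lin_columns:
  assumes X: "X \<in> carrier_mat n p" and B: "B \<subseteq> {..<p}"
  shows "lin (scaled_col (columns X B)) (card B) (\<lambda>k. u (pick B k)) = (\<Sum>j\<in>B. u j *\<^sub>R scaled_col X j)"
proof -
  have "finite B" using B finite_subset by blast
  from sum.reindex_bij_betw[OF bij_betw_pick[OF this], of "\<lambda>j. u j *\<^sub>R scaled_col X j"]
  show ?thesis unfolding lin_def by (simp add: scaled_col_columns[OF X B])
qed

lemma lin_supported:
  assumes "B \<subseteq> {..<p}" "\<And>j. j < p \<Longrightarrow> j \<notin> B \<Longrightarrow> u j = 0"
  shows "lin a p u = (\<Sum>j\<in>B. u j *\<^sub>R a j)"
  unfolding lin_def using assms by (intro sum.mono_neutral_right) auto

lemma span_image_finite: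
  fixes a :: "nat \<Rightarrow> 'v::real_vector"
  assumes "finite B" "x \<in> span (a ` B)"
  shows "\<exists>u. x = (\<Sum>j\<in>B. u j *\<^sub>R a j)"
  using assms(2)
proof (induction rule: span_induct_alt)
  case base
  show ?case by (rule exI[of _ "\<lambda>_. 0"]) simp
next
  case (step c z y)
  then obtain u j where u: "y = (\<Sum>j\<in>B. u j *\<^sub>R a j)" and j: "j \<in> B" "z = a j" by auto
  have "(\<Sum>i\<in>B. (u i + (if i = j then c else 0)) *\<^sub>R a i) = y + c *\<^sub>R a j"
    using assms(1) j(1) unfolding u
    by (simp add: scaleR_add_left sum.distrib if_distrib[where f = "\<lambda>c. c *\<^sub>R _"] sum.delta cong: if_cong)
  thus ?case using j by (intro exI[of _ "\<lambda>i. u i + (if i = j then c else 0)"]) (simp add: add.commute)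
qed

text \<open>The description inside \<open>proj\<close> is translated under \<open>scaled_vec\<close>
  into \<open>is_orthoproj\<close>. Uniqueness comes from injectivity of \<open>scaled_vec\<close>;
  for existence, the projection found among sequences is pulled back by writing it as a combination
  of the columns.\<close>

lemma proj_is_orthoproj:
  assumes X: "X \<in> carrier_mat n p" and v: "v \<in> carrier_vec n" and B: "B \<subseteq> {..<p}" and n: "0 < n"
  shows "proj X B v \<in> carrier_vec n"
    "is_orthoproj (scaled_col X ` B) (scaled_vec n v) (scaled_vec n (proj X B v))"
proof -
  let ?C = "columns X B" and ?A = "scaled_col X ` B"
  have fB: "finite B" using B finite_subset by blast
  have C: "?C \<in> carrier_mat n (card B)" by (rule columns_carrier[OF X B])
  have cs: "vec_space.col_space n ?C = {y\<in>carrier_vec n. \<exists>x\<in>carrier_vec (card B). ?C *\<^sub>v x = y}"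
    using vec_space.col_space_eq[OF C] C by simp
  have span: "w \<in> vec_space.col_space n ?C \<longleftrightarrow> scaled_vec n w \<in> span ?A" if w: "w \<in> carrier_vec n" for w
  proof
    assume "w \<in> vec_space.col_space n ?C"
    then obtain x where x: "x \<in> carrier_vec (card B)" "?C *\<^sub>v x = w" unfolding cs by auto
    have "scaled_vec n w = lin (scaled_col ?C) (card B) (\<lambda>j. x $ j)"
      using scaled_vec_mult[OF C x(1)] x(2) by simp
    also have "\<dots> = (\<Sum>k<card B. x $ k *\<^sub>R scaled_col X (pick B k))"
      unfolding lin_def by (simp add: scaled_col_columns[OF X B])
    also have "\<dots> \<in> span ?A"
      by (intro span_sum span_mul span_base imageI) (simp add: pick_in_set_le)
    finally show "scaled_vec n w \<in> span ?A" .
  next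
    assume "scaled_vec n w \<in> span ?A"
    then obtain u where u: "scaled_vec n w = (\<Sum>j\<in>B. u j *\<^sub>R scaled_col X j)"
      using span_image_finite[OF fB] by blast
    define x where "x = vec (card B) (\<lambda>k. u (pick B k))"
    have x: "x \<in> carrier_vec (card B)" by (simp add: x_def)
    have "scaled_vec n (?C *\<^sub>v x) = lin (scaled_col ?C) (card B) (\<lambda>k. u (pick B k))"
      unfolding scaled_vec_mult[OF C x] by (simp add: lin_def x_def)
    also have "\<dots> = scaled_vec n w" unfolding u by (rule lin_columns[OF X B])
    finally have "?C *\<^sub>v x = w" using mult_mat_vec_carrier[OF C x] w n by (intro scaled_vec_inj[of _ n]) auto
    thus "w \<in> vec_space.col_space n ?C" unfolding cs using w x by auto
  qed
  have dot: "col X j \<bullet> (v - w) = 0 \<longleftrightarrow> inner (scaled_col X j) (scaled_vec n v - scaled_vec n w) = 0"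
    if "w \<in> carrier_vec n" for w j
    using X v that n
    by (simp add: scaled_vec_diff[OF v that, symmetric] scaled_col_def inner_scaled_vec scalar_prod_def atLeast0LessThan)
  have P: "w \<in> vec_space.col_space (dim_row X) ?C \<and> (\<forall>j\<in>B. col X j \<bullet> (v - w) = 0)
      \<longleftrightarrow> w \<in> carrier_vec n \<and> is_orthoproj ?A (scaled_vec n v) (scaled_vec n w)" for w
  proof (cases "w \<in> carrier_vec n")
    case True
    thus ?thesis using span[OF True] dot[OF True] X by (auto simp: is_orthoproj_def)
  next
    case False
    thus ?thesis using cs X by auto
  qed
  obtain z where z: "is_orthoproj ?A (scaled_vec n v) z" using is_orthoproj_exists[of ?A] fB by blast
  then obtain u where u: "z = (\<Sum>j\<in>B. u j *\<^sub>R scaled_col X j)"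
    using span_image_finite[OF fB, of z "scaled_col X"] by (auto simp: is_orthoproj_def)
  define x where "x = vec (card B) (\<lambda>k. u (pick B k))"
  have x: "x \<in> carrier_vec (card B)" by (simp add: x_def)
  have "scaled_vec n (?C *\<^sub>v x) = lin (scaled_col ?C) (card B) (\<lambda>k. u (pick B k))"
    unfolding scaled_vec_mult[OF C x] by (simp add: lin_def x_def)
  hence sz: "scaled_vec n (?C *\<^sub>v x) = z" unfolding u using lin_columns[OF X B] by simp
  have Cx: "?C *\<^sub>v x \<in> carrier_vec n" using C by (simp add: carrier_vecI)
  have "\<exists>!w. w \<in> carrier_vec n \<and> is_orthoproj ?A (scaled_vec n v) (scaled_vec n w)"
  proof (rule ex1I[of _ "?C *\<^sub>v x"])
    show "?C *\<^sub>v x \<in> carrier_vec n \<and> is_orthoproj ?A (scaled_vec n v) (scaled_vec n (?C *\<^sub>v x))"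
      using Cx z sz by simp
    fix w assume w: "w \<in> carrier_vec n \<and> is_orthoproj ?A (scaled_vec n v) (scaled_vec n w)"
    hence "scaled_vec n w = scaled_vec n (?C *\<^sub>v x)" using z sz is_orthoproj_unique by blast
    thus "w = ?C *\<^sub>v x" using w Cx n scaled_vec_inj by blast
  qed
  from theI'[OF this] show "proj X B v \<in> carrier_vec n"
    "is_orthoproj ?A (scaled_vec n v) (scaled_vec n (proj X B v))"
    unfolding proj_def P by auto
qed

text \<open>The full spectral theorem is avoided: the minimum of the Rayleigh quotient is an
  eigenvalue, hence at least \<open>lambda_min\<close>, and the same fact for the negated form
  yields the bound by \<open>lambda_max\<close>.\<close>

lemma gram_eigenvalue_bounds:
  assumes C: "C \<in> carrier_mat n d" and d: "0 < d"
  defines "G \<equiv> (1 / real n) \<cdot>\<^sub>m (C\<^sup>T * C)"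
  shows "lambda_min G * (\<Sum>k<d. (u k)\<^sup>2) \<le> (norm (lin (scaled_col C) d u))\<^sup>2"
    "(norm (lin (scaled_col C) d u))\<^sup>2 \<le> lambda_max G * (\<Sum>k<d. (u k)\<^sup>2)"
proof -
  define g where "g k l = inner (scaled_col C k) (scaled_col C l)" for k l
  have G: "G \<in> carrier_mat d d" using C by (simp add: G_def)
  have Gg: "G $$ (k, l) = g k l" if "k < d" "l < d" for k l
    using C that by (simp add: G_def g_def scaled_col_def inner_scaled_vec scalar_prod_def atLeast0LessThan)
  have quad: "(norm (lin (scaled_col C) d u))\<^sup>2 = (\<Sum>k<d. \<Sum>l<d. g k l * u k * u l)"
    by (simp add: power2_norm_eq_inner lin_def g_def inner_sum_left inner_sum_right mult_ac
        sum_distrib_left) (intro sum.cong refl, simp add: inner_commute)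
  have spec: "\<mu> \<in> spectrum G" if v: "\<exists>i<d. v i \<noteq> 0" "\<forall>i<d. (\<Sum>j<d. g i j * v j) = \<mu> * v i" for \<mu> v
  proof -
    have "G *\<^sub>v vec d v = \<mu> \<cdot>\<^sub>v vec d v"
      using G v(2) by (intro eq_vecI) (auto simp: scalar_prod_def atLeast0LessThan Gg)
    moreover have "vec d v \<noteq> 0\<^sub>v d"
    proof
      assume e: "vec d v = 0\<^sub>v d"
      obtain i where i: "i < d" "v i \<noteq> 0" using v(1) by blast
      have "vec d v $ i = (0\<^sub>v d :: real vec) $ i" using e by simp
      thus False using i by simp
    qed
    ultimately show ?thesis using G
      by (auto simp: spectrum_def eigenvalue_def eigenvector_def intro!: exI[of _ "vec d v"])
  qed
  have fin: "finite (spectrum G)" by (rule card_finite_spectrum(1)[OF G])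
  have N: "0 \<le> (\<Sum>k<d. (u k)\<^sup>2)" by (simp add: sum_nonneg)
  have sym: "g i j = g j i" for i j by (simp add: g_def inner_commute)
  obtain \<mu> v where m: "\<exists>i<d. v i \<noteq> 0" "\<forall>i<d. (\<Sum>j<d. g i j * v j) = \<mu> * v i"
      "\<And>u. \<mu> * (\<Sum>i<d. (u i)\<^sup>2) \<le> (\<Sum>i<d. \<Sum>j<d. g i j * u i * u j)"
    using symmetric_rayleigh_min[of d g] sym d by blast
  have "lambda_min G \<le> \<mu>" unfolding lambda_min_def using spec[OF m(1,2)] fin by simp
  hence "lambda_min G * (\<Sum>k<d. (u k)\<^sup>2) \<le> \<mu> * (\<Sum>k<d. (u k)\<^sup>2)" using N by (intro mult_right_mono)
  also have "\<dots> \<le> (norm (lin (scaled_col C) d u))\<^sup>2" unfolding quad by (rule m(3))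
  finally show "lambda_min G * (\<Sum>k<d. (u k)\<^sup>2) \<le> (norm (lin (scaled_col C) d u))\<^sup>2" .
  obtain \<nu> v where m: "\<exists>i<d. v i \<noteq> 0" "\<forall>i<d. (\<Sum>j<d. - g i j * v j) = \<nu> * v i"
      "\<And>u. \<nu> * (\<Sum>i<d. (u i)\<^sup>2) \<le> (\<Sum>i<d. \<Sum>j<d. - g i j * u i * u j)"
    using symmetric_rayleigh_min[of d "\<lambda>i j. - g i j"] sym d by auto
  have "(\<Sum>j<d. g i j * v j) = (- \<nu>) * v i" if "i < d" for i
    using m(2) that by (simp add: sum_negf) (metis minus_minus)
  hence "- \<nu> \<in> spectrum G" using m(1) by (intro spec) auto
  hence "- \<nu> \<le> lambda_max G" unfolding lambda_max_def using fin by simp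
  hence "- \<nu> * (\<Sum>k<d. (u k)\<^sup>2) \<le> lambda_max G * (\<Sum>k<d. (u k)\<^sup>2)" using N by (intro mult_right_mono)
  moreover have "(norm (lin (scaled_col C) d u))\<^sup>2 \<le> - \<nu> * (\<Sum>k<d. (u k)\<^sup>2)"
    unfolding quad using m(3)[of u] by (simp add: sum_negf)
  ultimately show "(norm (lin (scaled_col C) d u))\<^sup>2 \<le> lambda_max G * (\<Sum>k<d. (u k)\<^sup>2)" by linarith
qed

lemma gram_columns_bounds:
  assumes X: "X \<in> carrier_mat n p" and B: "B \<subseteq> {..<p}" "B \<noteq> {}"
  shows "lambda_min (gram X B) * (\<Sum>j\<in>B. (u j)\<^sup>2) \<le> (norm (\<Sum>j\<in>B. u j *\<^sub>R scaled_col X j))\<^sup>2"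
    "(norm (\<Sum>j\<in>B. u j *\<^sub>R scaled_col X j))\<^sup>2 \<le> lambda_max (gram X B) * (\<Sum>j\<in>B. (u j)\<^sup>2)"
proof -
  have fB: "finite B" using B(1) finite_subset by blast
  have d: "0 < card B" using fB B(2) by (simp add: card_gt_0_iff)
  have s: "(\<Sum>k<card B. (u (pick B k))\<^sup>2) = (\<Sum>j\<in>B. (u j)\<^sup>2)"
    by (rule sum.reindex_bij_betw[OF bij_betw_pick[OF fB]])
  have G: "gram X B = (1 / real n) \<cdot>\<^sub>m ((columns X B)\<^sup>T * columns X B)"
    using X by (simp add: gram_def)
  show "lambda_min (gram X B) * (\<Sum>j\<in>B. (u j)\<^sup>2) \<le> (norm (\<Sum>j\<in>B. u j *\<^sub>R scaled_col X j))\<^sup>2"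
    "(norm (\<Sum>j\<in>B. u j *\<^sub>R scaled_col X j))\<^sup>2 \<le> lambda_max (gram X B) * (\<Sum>j\<in>B. (u j)\<^sup>2)"
    using gram_eigenvalue_bounds[OF columns_carrier[OF X B(1)] d, of "\<lambda>k. u (pick B k)"]
    unfolding s lin_columns[OF X B(1)] G by blast+
qed

section \<open>Extremal quantities over models: sparse eigenvalues and \<sigma>^*_m\<close>

lemma kappa_plus_nonneg: "0 \<le> kappa_plus X m T"
proof -
  have "{lambda_max (gram X B) | B. B \<subseteq> {..<dim_col X} \<and> B \<inter> T = {} \<and> card B \<le> m \<and> B \<noteq> {}}
      \<subseteq> (\<lambda>B. lambda_max (gram X B)) ` Pow {..<dim_col X}" by auto
  hence "finite {lambda_max (gram X B) | B. B \<subseteq> {..<dim_col X} \<and> B \<inter> T = {} \<and> card B \<le> m \<and> B \<noteq> {}}"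
    by (rule finite_subset) simp
  thus ?thesis unfolding kappa_plus_def by (intro Max_ge) auto
qed

lemma kappa_plus_bound:
  assumes X: "X \<in> carrier_mat n p" and A: "A \<subseteq> {..<p}" "A \<inter> T = {}" "card A \<le> m"
  shows "(norm (\<Sum>j\<in>A. u j *\<^sub>R scaled_col X j))\<^sup>2 \<le> kappa_plus X m T * (\<Sum>j\<in>A. (u j)\<^sup>2)"
proof (cases "A = {}")
  case False
  let ?L = "{lambda_max (gram X B) | B. B \<subseteq> {..<dim_col X} \<and> B \<inter> T = {} \<and> card B \<le> m \<and> B \<noteq> {}}"
  have "?L \<subseteq> (\<lambda>B. lambda_max (gram X B)) ` Pow {..<dim_col X}" by auto
  hence "finite ?L" by (rule finite_subset) simp
  moreover have "lambda_max (gram X A) \<in> ?L" using A X False by auto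
  ultimately have "lambda_max (gram X A) \<le> kappa_plus X m T"
    unfolding kappa_plus_def by (intro Max_ge) auto
  thus ?thesis using gram_columns_bounds(2)[OF X A(1) False, of u]
      mult_right_mono[of "lambda_max (gram X A)" "kappa_plus X m T" "\<Sum>j\<in>A. (u j)\<^sup>2"]
    by (simp add: sum_nonneg)
qed simp

lemma kappa_minus_bound:
  assumes X: "X \<in> carrier_mat n p" and B: "T \<subseteq> B" "B \<subseteq> {..<p}" "card (B - T) \<le> m"
  shows "kappa_minus X m T * (\<Sum>j\<in>B. (u j)\<^sup>2) \<le> (norm (\<Sum>j\<in>B. u j *\<^sub>R scaled_col X j))\<^sup>2"
proof (cases "B = {}")
  case False
  let ?L = "{lambda_min (gram X B) | B. T \<subseteq> B \<and> B \<subseteq> {..<dim_col X} \<and> card (B - T) \<le> m \<and> B \<noteq> {}}"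
  have "?L \<subseteq> (\<lambda>B. lambda_min (gram X B)) ` Pow {..<dim_col X}" by auto
  hence "finite ?L" by (rule finite_subset) simp
  moreover have "lambda_min (gram X B) \<in> ?L" using B X False by auto
  ultimately have "kappa_minus X m T \<le> lambda_min (gram X B)"
    unfolding kappa_minus_def by (intro Min_le) auto
  thus ?thesis using gram_columns_bounds(1)[OF X B(2) False, of u]
      mult_right_mono[of "kappa_minus X m T" "lambda_min (gram X B)" "\<Sum>j\<in>B. (u j)\<^sup>2"]
    by (simp add: sum_nonneg)
qed simp

lemma sigma_star_m_ge:
  assumes X: "X \<in> carrier_mat n p" and b: "b \<in> carrier_vec p" and y: "y \<in> carrier_vec n" and n: "0 < n"
    and B: "S \<subseteq> B" "B \<subseteq> {..<p}" "card (B - S) = min m (p - card S)"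
    and w: "is_orthoproj (scaled_col X ` B) (scaled_vec n (y - X *\<^sub>v b)) w"
  shows "norm w \<le> sigma_star_m X y b m S"
proof -
  let ?L = "{l2norm (proj X B (y - X *\<^sub>v b)) / sqrt (real (dim_row X)) | B.
       S \<subseteq> B \<and> B \<subseteq> {..<dim_col X} \<and> card (B - S) = min m (dim_col X - card S)}"
  have v: "y - X *\<^sub>v b \<in> carrier_vec n" using X b y by auto
  have "w = scaled_vec n (proj X B (y - X *\<^sub>v b))"
    using is_orthoproj_unique[OF w proj_is_orthoproj(2)[OF X v B(2) n]] .
  hence "norm w = l2norm (proj X B (y - X *\<^sub>v b)) / sqrt (real n)"
    using proj_is_orthoproj(1)[OF X v B(2) n] by (simp add: norm_scaled_vec)
  hence "norm w \<in> ?L" using B X by auto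
  moreover have "?L \<subseteq> (\<lambda>B. l2norm (proj X B (y - X *\<^sub>v b)) / sqrt (real (dim_row X))) ` Pow {..<dim_col X}" by auto
  hence "finite ?L" by (rule finite_subset) simp
  ultimately show ?thesis unfolding sigma_star_m_def by (intro Max_ge)
qed

section \<open>Deterministic bounds\<close>

text \<open>Half of the Karush-Kuhn-Tucker condition: setting an active coordinate to 0 saves lam
  \<bar>c_j\<bar> of penalty, and minimality demands that the loss of fit along \<open>a j\<close>
  outweigh it.\<close>

lemma lasso_support_correlation:
  assumes sol: "lasso_sol a p y lam c" and lam: "0 \<le> lam" and j: "j < p" "c j \<noteq> 0"
  shows "lam \<le> \<bar>inner (a j) (y - lin a p c)\<bar>"
proof -
  define w where "w = c(j := 0)"
  have "lin a p w - lin a p c = lin a p (\<lambda>i. w i - c i)" by (simp add: lin_diff)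
  also have "\<dots> = (\<Sum>i\<in>{j}. (w i - c i) *\<^sub>R a i)"
    using j by (intro lin_supported) (auto simp: w_def)
  finally have d: "lin a p w - lin a p c = (- c j) *\<^sub>R a j" by (simp add: w_def)
  have "l1 {..<p} w - l1 {..<p} c = (\<Sum>i<p. \<bar>w i\<bar> - \<bar>c i\<bar>)" by (simp add: l1_def sum_subtractf)
  also have "\<dots> = (\<Sum>i\<in>{j}. \<bar>w i\<bar> - \<bar>c i\<bar>)"
    using j by (intro sum.mono_neutral_right) (auto simp: w_def)
  finally have "l1 {..<p} w - l1 {..<p} c = - \<bar>c j\<bar>" by (simp add: w_def)
  hence "- c j * inner (a j) (y - lin a p c) \<le> - lam * \<bar>c j\<bar>"
    using lasso_sol_variational[OF sol lam, of w] unfolding d by (simp add: inner_commute)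
  hence "lam * \<bar>c j\<bar> \<le> \<bar>c j\<bar> * \<bar>inner (a j) (y - lin a p c)\<bar>"
    unfolding abs_mult[symmetric] by linarith
  thus ?thesis using j(2) by (simp add: mult.commute)
qed

text \<open>At an active coordinate the residual correlation is at least \<open>lam\<close>, of
  which the noise supplies at most lam (xi - 1) / (xi + 1). So at least 2 lam / (xi + 1) comes from
  the prediction error \<open>d\<close>. The squares of these correlations sum to \<open>N\<close>,
  and duality with the sparse eigenvalue gives N^2 \<le> K N \<bar>d\<bar>^2.\<close>

lemma lasso_false_positives:
  assumes sol: "lasso_sol a p y lam c" and lam: "0 < lam" and xi: "1 < xi"
    and Z: "\<And>j. j < p \<Longrightarrow> \<bar>inner (a j) (y - lin a p b)\<bar> \<le> Z"
    and noise: "Z \<le> lam * (xi - 1) / (xi + 1)"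
    and A: "A \<subseteq> {..<p}" "\<And>j. j \<in> A \<Longrightarrow> c j \<noteq> 0"
    and K: "\<And>u. (norm (\<Sum>j\<in>A. u j *\<^sub>R a j))\<^sup>2 \<le> K * (\<Sum>j\<in>A. (u j)\<^sup>2)" "0 \<le> K"
  shows "real (card A) * (2 * lam / (xi + 1))\<^sup>2 \<le> K * (norm (lin a p c - lin a p b))\<^sup>2"
proof -
  define d where "d = lin a p c - lin a p b"
  define u where "u j = inner (a j) d" for j
  have low: "2 * lam / (xi + 1) \<le> \<bar>u j\<bar>" if "j \<in> A" for j
  proof -
    have j: "j < p" using that A by auto
    have "lam \<le> \<bar>inner (a j) (y - lin a p c)\<bar>"
      using lasso_support_correlation[OF sol _ j A(2)[OF that]] lam by simp
    also have "y - lin a p c = (y - lin a p b) - d" by (simp add: d_def)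
    also have "\<bar>inner (a j) ((y - lin a p b) - d)\<bar> \<le> Z + \<bar>u j\<bar>"
      using Z[OF j] by (simp add: inner_diff_right u_def)
    finally have "lam - lam * (xi - 1) / (xi + 1) \<le> \<bar>u j\<bar>" using noise by linarith
    moreover have "lam - lam * (xi - 1) / (xi + 1) = 2 * lam / (xi + 1)" using xi by (simp add: field_simps)
    ultimately show ?thesis by simp
  qed
  define N where "N = (\<Sum>j\<in>A. (u j)\<^sup>2)"
  have N0: "0 \<le> N" by (simp add: N_def sum_nonneg)
  have "real (card A) * (2 * lam / (xi + 1))\<^sup>2 = (\<Sum>j\<in>A. (2 * lam / (xi + 1))\<^sup>2)" by simp
  also have "\<dots> \<le> (\<Sum>j\<in>A. \<bar>u j\<bar>\<^sup>2)"
    using low lam xi by (intro sum_mono power_mono) auto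
  finally have 1: "real (card A) * (2 * lam / (xi + 1))\<^sup>2 \<le> N" by (simp add: N_def)
  have "N = inner (\<Sum>j\<in>A. u j *\<^sub>R a j) d"
    by (simp add: N_def inner_sum_left u_def power2_eq_square)
  also have "\<dots> \<le> norm (\<Sum>j\<in>A. u j *\<^sub>R a j) * norm d" by (rule norm_cauchy_schwarz)
  finally have "N\<^sup>2 \<le> (norm (\<Sum>j\<in>A. u j *\<^sub>R a j) * norm d)\<^sup>2" using N0 by (intro power_mono)
  also have "\<dots> = (norm (\<Sum>j\<in>A. u j *\<^sub>R a j))\<^sup>2 * (norm d)\<^sup>2" by (rule power_mult_distrib)
  also have "\<dots> \<le> K * N * (norm d)\<^sup>2" using K(1)[of u] unfolding N_def[symmetric] by (intro mult_right_mono) auto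
  finally have "N * N \<le> N * (K * (norm d)\<^sup>2)" by (simp add: power2_eq_square mult_ac)
  hence "N \<le> K * (norm d)\<^sup>2" using N0 K(2) by (cases "N = 0") auto
  thus ?thesis using 1 by (simp add: d_def)
qed

lemma least_squares_normal_equations:
  assumes ls: "is_least_squares X y A bb" and X: "X \<in> carrier_mat n p" and y: "y \<in> carrier_vec n"
    and n: "0 < n" and A: "A \<subseteq> {..<p}"
  shows "bb \<in> carrier_vec p" "supp bb \<subseteq> A"
    "\<And>w. w \<in> carrier_vec p \<Longrightarrow> supp w \<subseteq> A \<Longrightarrow> rms_residual X y bb \<le> rms_residual X y w"
    "\<And>j. j \<in> A \<Longrightarrow> inner (scaled_col X j) (scaled_vec n y - lin (scaled_col X) p (\<lambda>j. bb $ j)) = 0"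
proof -
  show bb: "bb \<in> carrier_vec p" and sb: "supp bb \<subseteq> A"
    using ls X by (auto simp: is_least_squares_def is_arg_min_def)
  show min: "rms_residual X y bb \<le> rms_residual X y w" if "w \<in> carrier_vec p" "supp w \<subseteq> A" for w
  proof -
    have "\<not> (l2norm (y - X *\<^sub>v w))\<^sup>2 < (l2norm (y - X *\<^sub>v bb))\<^sup>2"
      using ls X that by (auto simp: is_least_squares_def is_arg_min_def)
    hence "l2norm (y - X *\<^sub>v bb) \<le> l2norm (y - X *\<^sub>v w)"
      using l2norm_nonneg by (meson not_less power2_less_imp_less power_strict_mono zero_less_numeral)
    thus ?thesis by (simp add: rms_residual_def divide_right_mono)
  qed
  fix j assume j: "j \<in> A"
  hence jp: "j < p" using A by auto
  define a where "a = scaled_col X"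
  define r where "r = scaled_vec n y - lin a p (\<lambda>j. bb $ j)"
  have "0 \<le> 2 * t * (- inner r (a j)) + t\<^sup>2 * (norm (a j))\<^sup>2" for t
  proof -
    define w where "w = vec p (\<lambda>i. bb $ i + (if i = j then t else 0))"
    have w: "w \<in> carrier_vec p" by (simp add: w_def)
    have "supp w \<subseteq> A" using sb bb j by (auto simp: w_def supp_def split: if_splits)
    have "lin a p (\<lambda>i. w $ i) = lin a p (\<lambda>i. bb $ i + (if i = j then t else 0))"
      by (simp add: lin_def w_def)
    also have "\<dots> = lin a p (\<lambda>i. bb $ i) + t *\<^sub>R a j"
      unfolding lin_add using jp by (simp add: lin_def if_distrib[where f = "\<lambda>c. c *\<^sub>R _"] sum.delta cong: if_cong)
    finally have l: "scaled_vec n y - lin a p (\<lambda>i. w $ i) = r - t *\<^sub>R a j" by (simp add: r_def)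
    have "rms_residual X y bb \<le> rms_residual X y w" by (rule min) fact+
    hence "norm r \<le> norm (scaled_vec n y - lin a p (\<lambda>i. w $ i))"
      using rms_residual_eq_norm[OF X bb y] rms_residual_eq_norm[OF X w y] by (simp add: r_def a_def)
    hence "norm r \<le> norm (r - t *\<^sub>R a j)" unfolding l .
    hence "(norm r)\<^sup>2 \<le> (norm (r - t *\<^sub>R a j))\<^sup>2" by (intro power_mono) auto
    thus ?thesis unfolding power2_norm_eq_inner
      by (simp add: inner_diff_left inner_diff_right inner_commute[of "a j" r] power2_eq_square algebra_simps)
  qed
  hence "- inner r (a j) = 0" by (rule quadratic_nonneg_imp_linear_zero)
  thus "inner (scaled_col X j) (scaled_vec n y - lin (scaled_col X) p (\<lambda>j. bb $ j)) = 0"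
    by (simp add: r_def a_def inner_commute)
qed

text \<open>The order is essential: the lower bound on \<open>shat\<close> carries the noise
  condition to the random level, and only then may \<open>mu\<close> at that level be used to bound
  \<open>shat\<close> from above.\<close>

lemma scaled_lasso_noise_event_consequences:
  assumes n: "0 < n" and p: "0 < p" and X: "X \<in> carrier_mat n p" and y: "y \<in> carrier_vec n"
    and b: "b \<in> carrier_vec p" and xi: "1 < xi" and lam0: "0 < lam0" and sig: "0 < rms_residual X y b"
    and sl: "is_scaled_lasso X y lam0 bhat shat"
    and z: "z_star X y b \<le> (1 - (tau_star X y b lam0 xi)\<^sup>2) * lam0 * (xi - 1) / (xi + 1)"
  defines "Z \<equiv> z_star X y b * rms_residual X y b"
  shows "j < p \<Longrightarrow> \<bar>inner (scaled_col X j) (scaled_vec n y - lin (scaled_col X) p (\<lambda>j. b $ j))\<bar> \<le> Z"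
    and "Z \<le> (shat * lam0) * (xi - 1) / (xi + 1)"
    and "tau_star X y b lam0 xi < 1 \<Longrightarrow>
      shat * lam0 \<le> rms_residual X y b * lam0 / (1 - (tau_star X y b lam0 xi)\<^sup>2)"
proof -
  define a where "a = scaled_col X"
  define Y where "Y = scaled_vec n y"
  define s where "s = rms_residual X y b"
  define t where "t = (tau_star X y b lam0 xi)\<^sup>2"
  define m where "m = mu X b (s * lam0) xi"
  define c where "c = (\<lambda>j. bhat $ j)"
  define bf where "bf = (\<lambda>j. b $ j)"
  note slf = scaled_lasso_lasso_sol[OF sl X y n]
  have sol: "lasso_sol a p Y (shat * lam0) c" using slf(4) by (simp add: a_def Y_def c_def)
  have shat: "shat = norm (Y - lin a p c)"
    using slf(3) rms_residual_eq_norm[OF X slf(1) y] by (simp add: a_def Y_def c_def)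
  have s: "norm (Y - lin a p bf) = s" "0 < s"
    using sig rms_residual_eq_norm[OF X b y] by (simp_all add: a_def Y_def bf_def s_def)
  have Zn: "Z = linfnorm ((1 / real n) \<cdot>\<^sub>v (X\<^sup>T *\<^sub>v (y - X *\<^sub>v b)))"
    using s X by (simp add: Z_def z_star_def s_def)
  have v: "y - X *\<^sub>v b \<in> carrier_vec n" using X b y by auto
  have Z: "\<bar>inner (a j) (Y - lin a p bf)\<bar> \<le> Z" if "j < p" for j
    using inner_scaled_col_le_linfnorm[OF X v that] scaled_vec_residual[OF X b y]
    by (simp add: Zn a_def Y_def bf_def)
  thus "j < p \<Longrightarrow> \<bar>inner (scaled_col X j) (scaled_vec n y - lin (scaled_col X) p (\<lambda>j. b $ j))\<bar> \<le> Z"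
    by (simp add: a_def Y_def bf_def)
  have Z0: "0 \<le> Z" using Z[OF p] by linarith
  have m0: "0 \<le> m" using xi by (simp add: m_def mu_nonneg)
  have t: "t = lam0 * m / s" using m0 lam0 s by (simp add: t_def tau_star_def s_def[symmetric] m_def)
  have zs: "z_star X y b = Z / s" using s by (simp add: Z_def s_def)
  have "Z / s \<le> (1 - t) * lam0 * (xi - 1) / (xi + 1)" using z unfolding zs t_def .
  hence "Z \<le> (1 - t) * lam0 * (xi - 1) / (xi + 1) * s" using s by (simp add: pos_divide_le_eq)
  hence noise: "Z \<le> (1 - t) * s * lam0 * (xi - 1) / (xi + 1)" by (simp add: mult_ac)
  \<comment> \<open>Forced by the noise condition itself, whose left side is nonnegative. At
    \<open>t = 1\<close> the lower bound on \<open>shat\<close> is trivial, which leaves the strict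
    case.\<close>
  have t1: "t \<le> 1"
  proof (rule ccontr)
    assume "\<not> t \<le> 1"
    hence "(1 - t) * s * lam0 * (xi - 1) / (xi + 1) < 0"
      using s lam0 xi by (intro divide_neg_pos mult_neg_pos) auto
    thus False using noise Z0 by linarith
  qed
  have t0: "0 \<le> t" by (simp add: t_def)
  have mu_bound: "l1 {..<p} (\<lambda>j. d j - bf j) \<le> mu X b lam xi"
    if "lasso_sol a p Y lam d" "0 < lam" "Z \<le> lam * (xi - 1) / (xi + 1)" for lam d
    using lasso_l1_le_mu[of X p Y lam d xi n b Z] that xi X n Z by (simp add: a_def Y_def bf_def)
  have st: "s * t = lam0 * m" using s t by simp
  have lower: "(1 - t) * s \<le> shat"
  proof (cases "t < 1")
    case True
    have "(1 - t) * s \<le> norm (Y - lin a p c)"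
    proof (rule scaled_lasso_lower[OF _ lam0 _ s xi Z Z0 st True m0 noise])
      show "lasso_sol a p Y (norm (Y - lin a p c) * lam0) c" "0 < norm (Y - lin a p c)"
        using sol slf(2) unfolding shat[symmetric] by simp_all
      fix lam d assume "lasso_sol a p Y lam d" "0 < lam" "lam \<le> s * lam0" "Z \<le> lam * (xi - 1) / (xi + 1)"
      thus "l1 {..<p} (\<lambda>j. d j - bf j) \<le> m"
        using mu_bound[of lam d] mu_mono[of xi lam "s * lam0" X b] xi by (simp add: m_def)
    qed
    thus ?thesis unfolding shat .
  next
    case False
    thus ?thesis using t1 slf(2) by simp
  qed
  show noise_hat: "Z \<le> (shat * lam0) * (xi - 1) / (xi + 1)"
  proof -
    have "(1 - t) * s * lam0 * (xi - 1) / (xi + 1) \<le> (shat * lam0) * (xi - 1) / (xi + 1)"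
      using lower lam0 xi by (intro divide_right_mono mult_right_mono) auto
    thus ?thesis using noise by linarith
  qed
  assume "tau_star X y b lam0 xi < 1"
  hence t_lt: "t < 1"
    using m0 lam0 s by (simp add: t_def power_less_one_iff abs_square_less_1 tau_star_def s_def[symmetric] m_def[symmetric])
  have "(1 - t) * shat \<le> s"
  proof (cases "shat \<le> s")
    case True
    have "(1 - t) * shat \<le> 1 * shat" using slf(2) t0 by (intro mult_right_mono) auto
    thus ?thesis using True by simp
  next
    case False
    have "shat \<le> s + lam0 * (l1 {..<p} bf - l1 {..<p} c)"
      using scaled_lasso_residual_le[of a p Y c lam0 bf] sol lam0 slf(2) s unfolding shat[symmetric] by simp
    also have "l1 {..<p} bf - l1 {..<p} c \<le> l1 {..<p} (\<lambda>j. c j - bf j)"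
      using l1_decrease_le[of "{..<p}" p bf c] by (simp add: l1_def)
    also have "\<dots> \<le> mu X b (shat * lam0) xi" using slf(2) lam0 by (intro mu_bound sol noise_hat) simp
    \<comment> \<open>Subadditive growth of \<open>mu\<close> turns the bound at the random level
      into shat / s times the bound at \<sigma>^* lam0. The resulting inequality is linear in
      \<open>shat\<close> and can be solved.\<close>
    also have "shat * lam0 = (shat / s) * (s * lam0)" using s by simp
    also have "mu X b \<dots> xi \<le> (shat / s) * m"
      unfolding m_def using False s xi lam0 by (intro mu_scale) auto
    finally have "shat \<le> s + lam0 * ((shat / s) * m)" using lam0 by simp
    also have "lam0 * ((shat / s) * m) = shat * t" by (simp add: t)
    finally show ?thesis by (simp add: algebra_simps)
  qed
  hence "shat \<le> s / (1 - t)" using t_lt by (simp add: field_simps)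
  hence "lam0 * shat \<le> lam0 * (s / (1 - t))" using lam0 by (intro mult_left_mono) auto
  thus "shat * lam0 \<le> rms_residual X y b * lam0 / (1 - (tau_star X y b lam0 xi)\<^sup>2)"
    by (simp add: t_def s_def mult_ac)
qed

lemma scaled_lasso_least_squares:
  assumes n: "0 < n" and p: "0 < p" and X: "X \<in> carrier_mat n p" and y: "y \<in> carrier_vec n"
    and b: "b \<in> carrier_vec p" and xi: "1 < xi" and lam0: "0 < lam0" and sig: "0 < rms_residual X y b"
    and sl: "is_scaled_lasso X y lam0 bhat shat"
    and ls: "is_least_squares X y (supp bhat) bbar"
    and m: "ereal (xi\<^sup>2) * card_over_kappa2 X xi (supp b) < ereal (real m) / ereal (kappa_plus X m (supp b))"
    and z: "z_star X y b \<le> (1 - (tau_star X y b lam0 xi)\<^sup>2) * lam0 * (xi - 1) / (xi + 1)"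
  defines "S \<equiv> supp b" and "et \<equiv> eta_star X b (shat * lam0) xi"
    and "sm \<equiv> sigma_star_m X y b (m - 1) (supp b)"
  shows "card (supp bhat - S) < m"
    and "shat\<^sup>2 - (sm + sqrt et)\<^sup>2 \<le> (rms_residual X y bbar)\<^sup>2"
    and "(rms_residual X y bbar)\<^sup>2 \<le> shat\<^sup>2"
    and "kappa_minus X (m - 1) S * (l2norm (bbar - b))\<^sup>2 \<le> (l2norm (X *\<^sub>v bbar - X *\<^sub>v b))\<^sup>2 / real n"
    and "(l2norm (X *\<^sub>v bbar - X *\<^sub>v b))\<^sup>2 / real n \<le> (sm + 2 * sqrt et)\<^sup>2"
proof -
  define a where "a = scaled_col X"
  define Y where "Y = scaled_vec n y"
  define lam where "lam = shat * lam0"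
  define c where "c = (\<lambda>j. bhat $ j)"
  define cb where "cb = (\<lambda>j. bbar $ j)"
  define bf where "bf = (\<lambda>j. b $ j)"
  define Z where "Z = z_star X y b * rms_residual X y b"
  note slf = scaled_lasso_lasso_sol[OF sl X y n]
  have sol: "lasso_sol a p Y lam c" using slf(4) by (simp add: a_def Y_def c_def lam_def)
  have lam: "0 < lam" using slf(2) lam0 by (simp add: lam_def)
  have shat: "shat = norm (Y - lin a p c)"
    using slf(3) rms_residual_eq_norm[OF X slf(1) y] by (simp add: a_def Y_def c_def)
  note cons = scaled_lasso_noise_event_consequences[OF n p X y b xi lam0 sig sl z]
  have Z: "\<bar>inner (a j) (Y - lin a p bf)\<bar> \<le> Z" if "j < p" for j
    using cons(1)[OF that] by (simp add: a_def Y_def bf_def Z_def)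
  have noise: "Z \<le> lam * (xi - 1) / (xi + 1)" using cons(2) by (simp add: Z_def lam_def)
  have pred: "(norm (lin a p c - lin a p bf))\<^sup>2 \<le> et"
    using lasso_prediction_le_eta_star[of X p Y lam c xi n b Z] sol lam xi X n b Z noise
    by (simp add: a_def bf_def et_def lam_def)
  have pred': "norm (lin a p c - lin a p bf) \<le> sqrt et" using pred by (rule real_le_rsqrt)
  have Sp: "S \<subseteq> {..<p}" using b by (auto simp: S_def supp_def)
  have Hp: "supp bhat \<subseteq> {..<p}" using slf(1) by (auto simp: supp_def)
  have x0: "0 \<le> xi" using xi by simp
  show few: "card (supp bhat - S) < m"
  proof (rule ccontr)
    assume "\<not> card (supp bhat - S) < m"
    then obtain A where A: "A \<subseteq> supp bhat - S" "card A = m"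
      by (metis not_less obtain_subset_with_card_n)
    define K where "K = kappa_plus X m S"
    have K0: "0 \<le> K" by (simp add: K_def kappa_plus_nonneg)
    have Ap: "A \<subseteq> {..<p}" using A Hp by auto
    have Kb: "(norm (\<Sum>j\<in>A. u j *\<^sub>R a j))\<^sup>2 \<le> K * (\<Sum>j\<in>A. (u j)\<^sup>2)" for u
      unfolding K_def a_def using A by (intro kappa_plus_bound[OF X Ap]) auto
    have "real (card A) * (2 * lam / (xi + 1))\<^sup>2 \<le> K * (norm (lin a p c - lin a p bf))\<^sup>2"
      using A by (intro lasso_false_positives[OF sol lam xi Z noise Ap _ Kb K0]) (auto simp: c_def supp_def)
    hence fp: "real m * (2 * lam / (xi + 1))\<^sup>2 \<le> K * (norm (lin a p c - lin a p bf))\<^sup>2" using A by simp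
    show False
    proof (cases rule: card_over_kappa2_cases[OF X n Sp x0])
      case 1
      thus False using m xi by (simp add: S_def)
    next
      case (2 k)
      define r where "r = real (card S) / k\<^sup>2"
      have "l1 ({..<p} - S) bf = 0" using b by (auto simp: l1_def bf_def S_def supp_def intro!: sum.neutral)
      hence "(norm (lin a p c - lin a p bf))\<^sup>2 \<le> 4 * xi\<^sup>2 * lam\<^sup>2 / (xi + 1)\<^sup>2 * r"
        using lasso_prediction[OF sol lam xi Z noise Sp, of k bf] 2(1) by (simp add: a_def r_def)
      hence "real m * (2 * lam / (xi + 1))\<^sup>2 \<le> K * (4 * xi\<^sup>2 * lam\<^sup>2 / (xi + 1)\<^sup>2 * r)"
        using fp mult_left_mono[OF _ K0] order.trans by blast
      also have "\<dots> = K * (xi\<^sup>2 * r) * (2 * lam / (xi + 1))\<^sup>2" by (simp add: power_mult_distrib power_divide)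
      finally have mK: "real m \<le> K * (xi\<^sup>2 * r)" using lam xi by simp
      have r0: "0 \<le> r" by (simp add: r_def)
      have lt: "ereal (xi\<^sup>2 * r) < ereal (real m) / ereal K" using m 2(2) by (simp add: S_def K_def r_def)
      show False
      \<comment> \<open>Here \<open>m\<close> must be 0, and since 0 / 0 is 0 in
        \<open>ereal\<close>, the hypothesis would put a nonnegative number strictly below
        0.\<close>
      proof (cases "K = 0")
        case True
        hence "m = 0" using mK by simp
        moreover have "0 \<le> xi\<^sup>2 * r" using r0 by simp
        ultimately show False using lt True by (simp add: divide_ereal_def)
      next
        case False
        hence "xi\<^sup>2 * r < real m / K" using lt by simp
        thus False using mK False K0 by (simp add: field_simps)
      qed
    qed
  qed
  note lsf = least_squares_normal_equations[OF ls X y n Hp]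
  have sbar: "rms_residual X y bbar = norm (Y - lin a p cb)"
    using rms_residual_eq_norm[OF X lsf(1) y] by (simp add: a_def Y_def cb_def)
  have "rms_residual X y bbar \<le> shat" using lsf(3)[OF slf(1)] slf(3) by simp
  moreover have "0 \<le> rms_residual X y bbar" unfolding sbar by simp
  ultimately show "(rms_residual X y bbar)\<^sup>2 \<le> shat\<^sup>2" by (intro power_mono)
  define d where "d = lin a p c - lin a p bf"
  define e where "e = Y - lin a p bf"
  define q where "q = lin a p cb - lin a p c"
  define rb where "rb = Y - lin a p cb"
  have fin: "finite (supp bhat)" "finite S" using Hp Sp finite_subset by blast+
  have "q = lin a p (\<lambda>j. cb j - c j)" by (simp add: q_def lin_diff)
  also have "\<dots> = (\<Sum>j\<in>supp bhat. (cb j - c j) *\<^sub>R a j)"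
    using Hp lsf(1,2) slf(1) by (intro lin_supported) (auto simp: cb_def c_def supp_def)
  finally have q: "q = (\<Sum>j\<in>supp bhat. (cb j - c j) *\<^sub>R a j)" .
  have qs: "q \<in> span (a ` supp bhat)" unfolding q by (intro span_sum span_mul span_base imageI)
  have orth: "inner q rb = 0"
    by (rule inner_span_zero[OF _ qs]) (use lsf(4) in \<open>auto simp: a_def rb_def Y_def cb_def\<close>)
  have rq: "Y - lin a p c = rb + q" by (simp add: rb_def q_def)
  have pyth: "shat\<^sup>2 = (rms_residual X y bbar)\<^sup>2 + (norm q)\<^sup>2"
    unfolding shat sbar rb_def[symmetric] rq using orth
    by (simp add: power2_norm_eq_inner inner_add_left inner_add_right inner_commute)
  define B0 where "B0 = supp bhat \<union> S"
  have m1: "card (supp bhat - S) \<le> min (m - 1) (p - card S)"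
  proof -
    have "card (supp bhat - S) \<le> card ({..<p} - S)" using Hp by (intro card_mono) auto
    also have "\<dots> = p - card S" using Sp fin by (simp add: card_Diff_subset)
    finally show ?thesis using few by simp
  qed
  \<comment> \<open>\<open>sigma_star_m\<close> is a maximum over sets of one exact size, so the
    false positives, at most \<open>m - 1\<close> in number, are padded to that size.\<close>
  obtain R where R: "supp bhat - S \<subseteq> R" "R \<subseteq> {..<p} - S" "card R = min (m - 1) (p - card S)"
  proof -
    have "min (m - 1) (p - card S) \<le> card ({..<p} - S)" using Sp fin by (simp add: card_Diff_subset)
    thus thesis using exists_subset_between[OF m1, of "{..<p} - S"] Hp that by (auto simp: Diff_mono)
  qed
  define B where "B = S \<union> R"
  have B: "S \<subseteq> B" "B \<subseteq> {..<p}" "B - S = R" "supp bhat \<subseteq> B" using R Sp by (auto simp: B_def)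
  obtain w where w: "is_orthoproj (a ` B) e w"
    using is_orthoproj_exists[of "a ` B"] B(2) finite_subset by blast
  have esc: "e = scaled_vec n (y - X *\<^sub>v b)"
    using scaled_vec_residual[OF X b y] by (simp add: e_def Y_def a_def bf_def)
  have wsm: "norm w \<le> sm"
    unfolding sm_def using B R w
    by (intro sigma_star_m_ge[OF X b y n, of _ B]) (auto simp: S_def esc[symmetric] a_def)
  have "q \<in> span (a ` B)" using qs B(4) span_mono[of "a ` supp bhat" "a ` B"] by blast
  hence qe: "inner q e = inner q w" by (rule is_orthoproj_inner[OF w])
  \<comment> \<open>Both sides are the lasso residual. Paired with \<open>q\<close>, which is
    orthogonal to \<open>rb\<close> and sees the noise \<open>e\<close> only through its projection
    \<open>w\<close>, they give \<bar>q\<bar>^2 = inner q (w - d).\<close>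
  have "rb + q = e - d" by (simp add: rb_def q_def e_def d_def)
  hence "inner q (rb + q) = inner q (e - d)" by simp
  hence "(norm q)\<^sup>2 = inner q w - inner q d"
    using orth qe by (simp add: inner_add_right inner_diff_right power2_norm_eq_inner)
  also have "\<dots> = inner q (w - d)" by (simp add: inner_diff_right)
  also have "\<dots> \<le> norm q * norm (w - d)" by (rule norm_cauchy_schwarz)
  finally have "norm q \<le> norm (w - d)" by (cases "norm q = 0") (auto simp: power2_eq_square)
  also have "\<dots> \<le> norm w + norm d" by (rule norm_triangle_ineq4)
  also have "\<dots> \<le> sm + sqrt et" using wsm pred' by (simp add: d_def)
  finally have nq: "norm q \<le> sm + sqrt et" .
  hence "(norm q)\<^sup>2 \<le> (sm + sqrt et)\<^sup>2" by (intro power_mono) auto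
  thus "shat\<^sup>2 - (sm + sqrt et)\<^sup>2 \<le> (rms_residual X y bbar)\<^sup>2" using pyth by simp
  have Xb: "scaled_vec n (X *\<^sub>v bbar - X *\<^sub>v b) = lin a p cb - lin a p bf"
    using X lsf(1) b by (simp add: scaled_vec_diff[of _ n] scaled_vec_mult[of _ n p] a_def cb_def bf_def)
  have nX: "(l2norm (X *\<^sub>v bbar - X *\<^sub>v b))\<^sup>2 / real n = (norm (lin a p cb - lin a p bf))\<^sup>2"
    unfolding Xb[symmetric] using X n by (subst norm_scaled_vec) (auto simp: power_divide)
  have "norm (lin a p cb - lin a p bf) = norm (q + d)" by (simp add: q_def d_def)
  also have "\<dots> \<le> norm q + norm d" by (rule norm_triangle_ineq)
  also have "\<dots> \<le> sm + 2 * sqrt et" using nq pred' by (simp add: d_def)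
  finally show "(l2norm (X *\<^sub>v bbar - X *\<^sub>v b))\<^sup>2 / real n \<le> (sm + 2 * sqrt et)\<^sup>2"
    unfolding nX by (intro power_mono) auto
  define u where "u = (\<lambda>j. cb j - bf j)"
  have u0: "u j = 0" if "j < p" "j \<notin> B" for j
  proof -
    have "cb j = 0"
      using that B(4) lsf(1,2) by (auto simp: cb_def supp_def[of bbar])
    moreover have "bf j = 0" using that B(1) b by (auto simp: bf_def supp_def S_def)
    ultimately show ?thesis by (simp add: u_def)
  qed
  have "(l2norm (bbar - b))\<^sup>2 = (\<Sum>j<p. (u j)\<^sup>2)"
    using lsf(1) b by (simp add: l2norm_def sum_nonneg u_def cb_def bf_def)
  also have "\<dots> = (\<Sum>j\<in>B. (u j)\<^sup>2)" using B(2) u0 by (intro sum.mono_neutral_right) auto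
  finally have l2: "(l2norm (bbar - b))\<^sup>2 = (\<Sum>j\<in>B. (u j)\<^sup>2)" .
  have "lin a p cb - lin a p bf = lin a p u" by (simp add: u_def lin_diff)
  also have "\<dots> = (\<Sum>j\<in>B. u j *\<^sub>R a j)" by (rule lin_supported[OF B(2) u0])
  finally have lu: "lin a p cb - lin a p bf = (\<Sum>j\<in>B. u j *\<^sub>R a j)" .
  show "kappa_minus X (m - 1) S * (l2norm (bbar - b))\<^sup>2 \<le> (l2norm (X *\<^sub>v bbar - X *\<^sub>v b))\<^sup>2 / real n"
    unfolding nX l2 lu unfolding a_def using B R(3) by (intro kappa_minus_bound[OF X]) auto
qed

section \<open>Rotation invariance of the Gaussian measure\<close>

definition stdN :: "real measure" where
  "stdN = density lborel (\<lambda>x. ennreal (std_normal_density x))"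

abbreviation stdN_pow :: "nat set \<Rightarrow> (nat \<Rightarrow> real) measure" where
  "stdN_pow J \<equiv> \<Pi>\<^sub>M i\<in>J. stdN"

lemma sets_stdN[simp, measurable_cong]: "sets stdN = sets borel" by (simp add: stdN_def)
lemma space_stdN[simp]: "space stdN = UNIV" by (simp add: stdN_def)

interpretation stdN: prob_space stdN
  unfolding stdN_def by (rule prob_space_normal_density) simp

interpretation stdN_prod: product_sigma_finite "\<lambda>_ :: nat. stdN"
  by unfold_locales

lemma nn_integral_stdN:
  "f \<in> borel_measurable borel \<Longrightarrow>
    (\<integral>\<^sup>+x. f x \<partial>stdN) = (\<integral>\<^sup>+x. ennreal (std_normal_density x) * f x \<partial>lborel)"
  unfolding stdN_def by (subst nn_integral_density) auto

lemma nn_integral_normal_density: "0 < \<sigma> \<Longrightarrow> (\<integral>\<^sup>+x. ennreal (normal_density \<mu> \<sigma> x) \<partial>lborel) = 1"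
  by (subst nn_integral_eq_integral) (auto simp: normal_density_nonneg)

text \<open>Completing the square leaves a constant times another normal density. One formula thus
  covers the moment generating function (\<open>l = 0\<close>), the Laplace transform of a square
  (\<open>b = 0\<close>) and the mixed case met in the induction over an orthonormal family.\<close>

lemma nn_integral_stdN_exp_quadratic:
  assumes l: "l < 1"
  shows "(\<integral>\<^sup>+x. ennreal (exp (b * x + l * x\<^sup>2 / 2)) \<partial>stdN)
    = ennreal ((1 - l) powr (-1/2) * exp (b\<^sup>2 / (2 * (1 - l))))"
proof -
  define s where "s = 1 / sqrt (1 - l)"
  define m where "m = b / (1 - l)"
  define K where "K = (1 - l) powr (-1/2) * exp (b\<^sup>2 / (2 * (1 - l)))"
  have s: "0 < s" "s\<^sup>2 = 1 / (1 - l)" using l by (simp_all add: s_def power_divide)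
  have pw: "(1 - l) powr (-1/2) = s"
    using l by (simp add: s_def powr_minus_divide powr_half_sqrt)
  have eq: "std_normal_density x * exp (b * x + l * x\<^sup>2 / 2) = K * normal_density m s x" for x
  proof -
    have e: "- x\<^sup>2 / 2 + (b * x + l * x\<^sup>2 / 2) = b\<^sup>2 / (2 * (1 - l)) + - (x - m)\<^sup>2 / (2 * s\<^sup>2)"
    proof -
      have "- (x - m)\<^sup>2 / (2 * s\<^sup>2) = - ((1 - l) * (x\<^sup>2 - 2 * m * x + m\<^sup>2)) / 2"
        unfolding s(2) by (simp add: power2_diff algebra_simps)
      also have "\<dots> = - ((1 - l) * x\<^sup>2) / 2 + ((1 - l) * m) * x - ((1 - l) * m) * m / 2"
        by (simp add: field_simps power2_eq_square)
      also have "(1 - l) * m = b" using l by (simp add: m_def)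
      also have "b * m = b\<^sup>2 / (1 - l)" by (simp add: m_def power2_eq_square)
      finally show ?thesis by (simp add: field_simps)
    qed
    have sq: "sqrt (2 * pi * s\<^sup>2) = sqrt (2 * pi) * s" using s(1) by (simp add: real_sqrt_mult)
    have "std_normal_density x * exp (b * x + l * x\<^sup>2 / 2)
        = 1 / sqrt (2 * pi) * exp (- x\<^sup>2 / 2 + (b * x + l * x\<^sup>2 / 2))"
      unfolding std_normal_density_def exp_add[of "- x\<^sup>2 / 2"] by simp
    also have "\<dots> = 1 / sqrt (2 * pi) * (exp (b\<^sup>2 / (2 * (1 - l))) * exp (- (x - m)\<^sup>2 / (2 * s\<^sup>2)))"
      unfolding e exp_add ..
    also have "\<dots> = K * normal_density m s x"
      unfolding K_def pw normal_density_def sq using s(1) by simp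
    finally show ?thesis .
  qed
  have K0: "0 \<le> K" by (simp add: K_def)
  have "(\<integral>\<^sup>+x. ennreal (exp (b * x + l * x\<^sup>2 / 2)) \<partial>stdN)
      = (\<integral>\<^sup>+x. ennreal (std_normal_density x * exp (b * x + l * x\<^sup>2 / 2)) \<partial>lborel)"
    by (subst nn_integral_stdN) (auto simp: ennreal_mult)
  also have "\<dots> = (\<integral>\<^sup>+x. ennreal K * ennreal (normal_density m s x) \<partial>lborel)"
    unfolding eq using K0 by (simp add: ennreal_mult)
  also have "\<dots> = ennreal K"
    using nn_integral_normal_density[OF s(1), of m] by (subst nn_integral_cmult) auto
  finally show ?thesis by (simp add: K_def)
qed

lemma nn_integral_stdN_reflect:
  assumes f[measurable]: "f \<in> borel_measurable borel"
  shows "(\<integral>\<^sup>+x. f (- x) \<partial>stdN) = (\<integral>\<^sup>+x. f x \<partial>stdN)"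
proof -
  have "(\<integral>\<^sup>+x. f x \<partial>stdN) = (\<integral>\<^sup>+x. ennreal (std_normal_density x) * f x \<partial>lborel)"
    by (rule nn_integral_stdN) fact
  also have "\<dots> = (\<integral>\<^sup>+x. ennreal (std_normal_density (- x)) * f (- x) \<partial>lborel)"
    by (subst nn_integral_real_affine[of _ "-1" 0]) auto
  also have "\<dots> = (\<integral>\<^sup>+x. f (- x) \<partial>stdN)"
    by (subst nn_integral_stdN) (auto simp: std_normal_density_def)
  finally show ?thesis ..
qed

text \<open>Rotation invariance in the plane, by two successive one-dimensional affine substitutions.\<close>

lemma nn_integral_stdN_rotate_unit:
  assumes G[measurable]: "(\<lambda>(u, v). G u v) \<in> borel_measurable (borel \<Otimes>\<^sub>M borel)" and ab: "a\<^sup>2 + b\<^sup>2 = (1 :: real)"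
  shows "(\<integral>\<^sup>+w. \<integral>\<^sup>+z. G (a * w + b * z) (w\<^sup>2 + z\<^sup>2) \<partial>stdN \<partial>stdN) = (\<integral>\<^sup>+w. \<integral>\<^sup>+z. G z (w\<^sup>2 + z\<^sup>2) \<partial>stdN \<partial>stdN)"
proof (cases "b = 0")
  \<comment> \<open>The affine substitution in \<open>z\<close> needs b \<noteq> 0. For b = 0 the
    rotation degenerates to a sign change, undone by reflection, followed by an exchange of the two
    variables.\<close>
  case True
  interpret P: pair_sigma_finite stdN stdN by unfold_locales
  have "a = 1 \<or> a = -1" using ab True by (simp add: power2_eq_1_iff)
  have "(\<integral>\<^sup>+w. \<integral>\<^sup>+z. G (a * w) (w\<^sup>2 + z\<^sup>2) \<partial>stdN \<partial>stdN) = (\<integral>\<^sup>+w. \<integral>\<^sup>+z. G w (w\<^sup>2 + z\<^sup>2) \<partial>stdN \<partial>stdN)"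
    using \<open>a = 1 \<or> a = -1\<close>
  proof
    assume a: "a = -1"
    have "(\<integral>\<^sup>+w. \<integral>\<^sup>+z. G (- w) ((- w)\<^sup>2 + z\<^sup>2) \<partial>stdN \<partial>stdN) = (\<integral>\<^sup>+w. \<integral>\<^sup>+z. G w (w\<^sup>2 + z\<^sup>2) \<partial>stdN \<partial>stdN)"
      by (rule nn_integral_stdN_reflect[where f = "\<lambda>w. \<integral>\<^sup>+z. G w (w\<^sup>2 + z\<^sup>2) \<partial>stdN"]) measurable
    thus ?thesis using a by simp
  qed simp
  also have "\<dots> = (\<integral>\<^sup>+z. \<integral>\<^sup>+w. G w (w\<^sup>2 + z\<^sup>2) \<partial>stdN \<partial>stdN)"
    by (rule P.Fubini'[symmetric]) measurable
  finally show ?thesis using True by (simp add: add.commute)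
next
  case b: False
  define h where "h v = ennreal (exp (- v / 2) / (2 * pi))" for v :: real
  have h[measurable]: "h \<in> borel_measurable borel" unfolding h_def by measurable
  have dens: "ennreal (std_normal_density w) * ennreal (std_normal_density z) = h (w\<^sup>2 + z\<^sup>2)" for w z
    unfolding h_def
    by (subst ennreal_mult[symmetric])
      (auto simp: std_normal_density_def exp_add[symmetric] power2_eq_square[of "sqrt _", symmetric]
        add_divide_distrib real_sqrt_mult[symmetric] field_simps)
  define K where "K u v = h v * G u v" for u v
  have K[measurable]: "(\<lambda>(u, v). K u v) \<in> borel_measurable (borel \<Otimes>\<^sub>M borel)" unfolding K_def by measurable
  have dbl: "(\<integral>\<^sup>+w. \<integral>\<^sup>+z. F w z \<partial>stdN \<partial>stdN) = (\<integral>\<^sup>+w. \<integral>\<^sup>+z. h (w\<^sup>2 + z\<^sup>2) * F w z \<partial>lborel \<partial>lborel)"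
    if [measurable]: "(\<lambda>(w, z). F w z) \<in> borel_measurable (borel \<Otimes>\<^sub>M borel)" for F
  proof -
    have "(\<integral>\<^sup>+w. \<integral>\<^sup>+z. F w z \<partial>stdN \<partial>stdN)
        = (\<integral>\<^sup>+w. ennreal (std_normal_density w) * (\<integral>\<^sup>+z. F w z \<partial>stdN) \<partial>lborel)"
      by (rule nn_integral_stdN) measurable
    also have "\<dots> = (\<integral>\<^sup>+w. ennreal (std_normal_density w) *
        (\<integral>\<^sup>+z. ennreal (std_normal_density z) * F w z \<partial>lborel) \<partial>lborel)"
      by (subst nn_integral_stdN) measurable
    also have "\<dots> = (\<integral>\<^sup>+w. \<integral>\<^sup>+z. h (w\<^sup>2 + z\<^sup>2) * F w z \<partial>lborel \<partial>lborel)"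
      unfolding dens[symmetric] mult.assoc by (subst nn_integral_cmult) measurable
    finally show ?thesis .
  qed
  \<comment> \<open>With u = a w + b z as new variable, (w - a u) / b is, up to sign, the other
    rotated coordinate. The identity is invariance of the squared norm and prepares the second
    substitution w = a u + b v.\<close>
  have id1: "w\<^sup>2 + ((u - a * w) / b)\<^sup>2 = ((w - a * u) / b)\<^sup>2 + u\<^sup>2" for u w
  proof -
    have "(w\<^sup>2 + ((u - a * w) / b)\<^sup>2) * b\<^sup>2 = (a\<^sup>2 + b\<^sup>2) * w\<^sup>2 + u\<^sup>2 - 2 * a * u * w"
      using b by (simp add: field_simps power2_eq_square)
    moreover have "(((w - a * u) / b)\<^sup>2 + u\<^sup>2) * b\<^sup>2 = w\<^sup>2 + (a\<^sup>2 + b\<^sup>2) * u\<^sup>2 - 2 * a * u * w"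
      using b by (simp add: field_simps power2_eq_square)
    ultimately show ?thesis using b ab by (metis add.commute mult_1 mult_right_cancel power_not_zero)
  qed
  have "(\<integral>\<^sup>+w. \<integral>\<^sup>+z. G (a * w + b * z) (w\<^sup>2 + z\<^sup>2) \<partial>stdN \<partial>stdN)
      = (\<integral>\<^sup>+w. \<integral>\<^sup>+z. K (a * w + b * z) (w\<^sup>2 + z\<^sup>2) \<partial>lborel \<partial>lborel)"
    unfolding K_def by (rule dbl) measurable
  also have "\<dots> = (\<integral>\<^sup>+w. \<integral>\<^sup>+u. ennreal \<bar>1 / b\<bar> * K u (((w - a * u) / b)\<^sup>2 + u\<^sup>2) \<partial>lborel \<partial>lborel)"
  proof (rule nn_integral_cong)
    fix w :: real
    have "(\<integral>\<^sup>+z. K (a * w + b * z) (w\<^sup>2 + z\<^sup>2) \<partial>lborel)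
        = ennreal \<bar>1 / b\<bar> * (\<integral>\<^sup>+u. K (a * w + b * (- a * w / b + 1 / b * u)) (w\<^sup>2 + (- a * w / b + 1 / b * u)\<^sup>2) \<partial>lborel)"
      using b by (intro nn_integral_real_affine) auto
    also have "(\<lambda>u. K (a * w + b * (- a * w / b + 1 / b * u)) (w\<^sup>2 + (- a * w / b + 1 / b * u)\<^sup>2))
        = (\<lambda>u. K u (((w - a * u) / b)\<^sup>2 + u\<^sup>2))"
    proof
      fix u
      have "a * w + b * (- a * w / b + 1 / b * u) = u" using b by (simp add: field_simps)
      moreover have "- a * w / b + 1 / b * u = (u - a * w) / b" using b by (simp add: field_simps)
      ultimately show "K (a * w + b * (- a * w / b + 1 / b * u)) (w\<^sup>2 + (- a * w / b + 1 / b * u)\<^sup>2)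
          = K u (((w - a * u) / b)\<^sup>2 + u\<^sup>2)" using id1 by simp
    qed
    finally show "(\<integral>\<^sup>+z. K (a * w + b * z) (w\<^sup>2 + z\<^sup>2) \<partial>lborel)
        = (\<integral>\<^sup>+u. ennreal \<bar>1 / b\<bar> * K u (((w - a * u) / b)\<^sup>2 + u\<^sup>2) \<partial>lborel)"
      by (subst nn_integral_cmult) auto
  qed
  also have "\<dots> = (\<integral>\<^sup>+u. \<integral>\<^sup>+w. ennreal \<bar>1 / b\<bar> * K u (((w - a * u) / b)\<^sup>2 + u\<^sup>2) \<partial>lborel \<partial>lborel)"
    by (rule lborel_pair.Fubini'[symmetric]) measurable
  also have "\<dots> = (\<integral>\<^sup>+u. \<integral>\<^sup>+v. K u (v\<^sup>2 + u\<^sup>2) \<partial>lborel \<partial>lborel)"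
  proof (rule nn_integral_cong)
    fix u :: real
    have "(\<integral>\<^sup>+w. ennreal \<bar>1 / b\<bar> * K u (((w - a * u) / b)\<^sup>2 + u\<^sup>2) \<partial>lborel)
        = ennreal \<bar>b\<bar> * (\<integral>\<^sup>+v. ennreal \<bar>1 / b\<bar> * K u (((a * u + b * v - a * u) / b)\<^sup>2 + u\<^sup>2) \<partial>lborel)"
      using b by (intro nn_integral_real_affine) auto
    also have "\<dots> = (\<integral>\<^sup>+v. (ennreal \<bar>b\<bar> * ennreal \<bar>1 / b\<bar>) * K u (v\<^sup>2 + u\<^sup>2) \<partial>lborel)"
      using b by (subst nn_integral_cmult[symmetric]) (auto simp: mult.assoc)
    also have "ennreal \<bar>b\<bar> * ennreal \<bar>1 / b\<bar> = 1" using b by (subst ennreal_mult[symmetric]) auto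
    finally show "(\<integral>\<^sup>+w. ennreal \<bar>1 / b\<bar> * K u (((w - a * u) / b)\<^sup>2 + u\<^sup>2) \<partial>lborel)
        = (\<integral>\<^sup>+v. K u (v\<^sup>2 + u\<^sup>2) \<partial>lborel)" by simp
  qed
  also have "\<dots> = (\<integral>\<^sup>+v. \<integral>\<^sup>+u. K u (v\<^sup>2 + u\<^sup>2) \<partial>lborel \<partial>lborel)"
    by (rule lborel_pair.Fubini') measurable
  also have "\<dots> = (\<integral>\<^sup>+w. \<integral>\<^sup>+z. G z (w\<^sup>2 + z\<^sup>2) \<partial>stdN \<partial>stdN)"
    unfolding K_def by (rule dbl[symmetric]) measurable
  finally show ?thesis .
qed

lemma nn_integral_stdN_rotate:
  assumes G[measurable]: "(\<lambda>(u, v). G u v) \<in> borel_measurable (borel \<Otimes>\<^sub>M borel)"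
  shows "(\<integral>\<^sup>+w. \<integral>\<^sup>+z. G (a * w + b * z) (w\<^sup>2 + z\<^sup>2) \<partial>stdN \<partial>stdN)
    = (\<integral>\<^sup>+w. \<integral>\<^sup>+z. G (sqrt (a\<^sup>2 + b\<^sup>2) * z) (w\<^sup>2 + z\<^sup>2) \<partial>stdN \<partial>stdN)"
proof (cases "a = 0 \<and> b = 0")
  case False
  define r where "r = sqrt (a\<^sup>2 + b\<^sup>2)"
  have pos: "0 < a\<^sup>2 + b\<^sup>2" using False by (simp add: sum_power2_gt_zero_iff)
  hence r: "0 < r" "r\<^sup>2 = a\<^sup>2 + b\<^sup>2" by (simp_all add: r_def)
  have "(a / r)\<^sup>2 + (b / r)\<^sup>2 = 1" using r pos False by (auto simp: power_divide add_divide_distrib[symmetric])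
  from nn_integral_stdN_rotate_unit[OF _ this, of "\<lambda>u v. G (r * u) v"]
  have "(\<integral>\<^sup>+w. \<integral>\<^sup>+z. G (r * (a / r * w + b / r * z)) (w\<^sup>2 + z\<^sup>2) \<partial>stdN \<partial>stdN)
      = (\<integral>\<^sup>+w. \<integral>\<^sup>+z. G (r * z) (w\<^sup>2 + z\<^sup>2) \<partial>stdN \<partial>stdN)" by measurable
  thus ?thesis using r(1) by (simp add: distrib_left r_def[symmetric])
qed simp

text \<open>The function \<open>G\<close> sees a linear form and the squared norm jointly.
  Coordinates are merged one at a time: a planar rotation collects the linear form in a single
  normal variable, and its rotated partner, absent from the form, joins the remaining
  squares.\<close>

lemma nn_integral_stdN_PiM_rotate:
  fixes J :: "nat set" and c :: "nat \<Rightarrow> real"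
  assumes J: "finite J" "j \<notin> J"
    and G[measurable]: "(\<lambda>(u, v). G u v) \<in> borel_measurable (borel \<Otimes>\<^sub>M borel)"
  shows "(\<integral>\<^sup>+x. G (\<Sum>i\<in>insert j J. c i * x i) (\<Sum>i\<in>insert j J. (x i)\<^sup>2) \<partial>(stdN_pow (insert j J)))
    = (\<integral>\<^sup>+y. \<integral>\<^sup>+z. G (sqrt (\<Sum>i\<in>insert j J. (c i)\<^sup>2) * z) (z\<^sup>2 + (\<Sum>i\<in>J. (y i)\<^sup>2)) \<partial>stdN \<partial>(stdN_pow J))"
  using J G
proof (induction J arbitrary: G rule: finite_induct)
  case empty
  note [measurable] = empty.prems(2)
  have "(\<integral>\<^sup>+x. G (\<Sum>i\<in>{j}. c i * x i) (\<Sum>i\<in>{j}. (x i)\<^sup>2) \<partial>(\<Pi>\<^sub>M i\<in>{j}. stdN))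
      = (\<integral>\<^sup>+x. \<integral>\<^sup>+z. G (c j * z) (z\<^sup>2) \<partial>stdN \<partial>(\<Pi>\<^sub>M i\<in>({} :: nat set). stdN))"
    by (subst stdN_prod.product_nn_integral_insert) auto
  also have "(\<integral>\<^sup>+z. G (c j * z) (z\<^sup>2) \<partial>stdN) = (\<integral>\<^sup>+z. G (\<bar>c j\<bar> * z) (z\<^sup>2) \<partial>stdN)"
  proof (cases "c j < 0")
    case True
    have "(\<integral>\<^sup>+z. G (c j * (- z)) ((- z)\<^sup>2) \<partial>stdN) = (\<integral>\<^sup>+z. G (c j * z) (z\<^sup>2) \<partial>stdN)"
      by (rule nn_integral_stdN_reflect[where f = "\<lambda>z. G (c j * z) (z\<^sup>2)"]) measurable
    thus ?thesis using True by simp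
  qed simp
  finally show ?case by simp
next
  case (insert i J)
  note [measurable] = insert.prems(2)
  have ij: "i \<notin> insert j J" "j \<notin> J" "finite (insert j J)" using insert.hyps insert.prems by auto
  interpret PJ: sigma_finite_measure "stdN_pow J" using stdN_prod.sigma_finite[OF insert.hyps(1)] .
  interpret Q: pair_sigma_finite stdN "stdN_pow J" by unfold_locales
  define s where "s = sqrt (\<Sum>k\<in>insert j J. (c k)\<^sup>2)"
  have sw: "insert j (insert i J) = insert i (insert j J)" by auto
  have s2: "sqrt ((c i)\<^sup>2 + s\<^sup>2) = sqrt (\<Sum>k\<in>insert j (insert i J). (c k)\<^sup>2)"
    unfolding sw s_def using ij by (simp add: sum_nonneg)
  have upd: "(\<Sum>k\<in>insert j J. f k ((x(i := w)) k)) = (\<Sum>k\<in>insert j J. f k (x k))"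
    for f :: "nat \<Rightarrow> real \<Rightarrow> real" and x w
    using ij(1) by (intro sum.cong) auto
  have "(\<integral>\<^sup>+x. G (\<Sum>k\<in>insert j (insert i J). c k * x k) (\<Sum>k\<in>insert j (insert i J). (x k)\<^sup>2)
        \<partial>(stdN_pow (insert j (insert i J))))
      = (\<integral>\<^sup>+w. \<integral>\<^sup>+x. G (\<Sum>k\<in>insert i (insert j J). c k * (x(i := w)) k)
          (\<Sum>k\<in>insert i (insert j J). ((x(i := w)) k)\<^sup>2) \<partial>(stdN_pow (insert j J)) \<partial>stdN)"
    unfolding sw by (subst stdN_prod.product_nn_integral_insert_rev[OF ij(3,1)]) auto
  also have "\<dots> = (\<integral>\<^sup>+w. \<integral>\<^sup>+x. G (c i * w + (\<Sum>k\<in>insert j J. c k * x k))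
          (w\<^sup>2 + (\<Sum>k\<in>insert j J. (x k)\<^sup>2)) \<partial>(stdN_pow (insert j J)) \<partial>stdN)"
    unfolding sum.insert[OF ij(3,1)]
    using upd[of "\<lambda>k v. c k * v"] upd[of "\<lambda>k v. v\<^sup>2"] by (simp only: fun_upd_same)
  also have "\<dots> = (\<integral>\<^sup>+w. \<integral>\<^sup>+y. \<integral>\<^sup>+z. G (c i * w + s * z) (w\<^sup>2 + (z\<^sup>2 + (\<Sum>k\<in>J. (y k)\<^sup>2))) \<partial>stdN
      \<partial>(stdN_pow J) \<partial>stdN)"
    unfolding s_def
    by (rule nn_integral_cong, rule insert.IH[OF ij(2)]) measurable
  also have "\<dots> = (\<integral>\<^sup>+y. \<integral>\<^sup>+w. \<integral>\<^sup>+z. G (c i * w + s * z) (w\<^sup>2 + (z\<^sup>2 + (\<Sum>k\<in>J. (y k)\<^sup>2))) \<partial>stdN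
      \<partial>stdN \<partial>(stdN_pow J))"
    by (rule Q.Fubini'[symmetric]) measurable
  also have "\<dots> = (\<integral>\<^sup>+y. \<integral>\<^sup>+w. \<integral>\<^sup>+z. G (sqrt ((c i)\<^sup>2 + s\<^sup>2) * z) (w\<^sup>2 + z\<^sup>2 + (\<Sum>k\<in>J. (y k)\<^sup>2)) \<partial>stdN
      \<partial>stdN \<partial>(stdN_pow J))"
  proof (rule nn_integral_cong)
    fix y :: "nat \<Rightarrow> real"
    let ?R = "\<Sum>k\<in>J. (y k)\<^sup>2"
    show "(\<integral>\<^sup>+w. \<integral>\<^sup>+z. G (c i * w + s * z) (w\<^sup>2 + (z\<^sup>2 + ?R)) \<partial>stdN \<partial>stdN)
      = (\<integral>\<^sup>+w. \<integral>\<^sup>+z. G (sqrt ((c i)\<^sup>2 + s\<^sup>2) * z) (w\<^sup>2 + z\<^sup>2 + ?R) \<partial>stdN \<partial>stdN)"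
      using nn_integral_stdN_rotate[of "\<lambda>u v. G u (v + ?R)" "c i" s] by (simp add: add.assoc)
  qed
  also have "\<dots> = (\<integral>\<^sup>+y. \<integral>\<^sup>+z. G (sqrt ((c i)\<^sup>2 + s\<^sup>2) * z) (z\<^sup>2 + (\<Sum>k\<in>insert i J. (y k)\<^sup>2)) \<partial>stdN
      \<partial>(stdN_pow (insert i J)))"
  proof -
    have upd': "(\<Sum>k\<in>J. ((y(i := w)) k)\<^sup>2) = (\<Sum>k\<in>J. (y k)\<^sup>2)" for y :: "nat \<Rightarrow> real" and w
      using insert.hyps by (intro sum.cong) auto
    have "(\<integral>\<^sup>+y. \<integral>\<^sup>+z. G (sqrt ((c i)\<^sup>2 + s\<^sup>2) * z) (z\<^sup>2 + (\<Sum>k\<in>insert i J. (y k)\<^sup>2)) \<partial>stdN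
        \<partial>(stdN_pow (insert i J)))
      = (\<integral>\<^sup>+y. \<integral>\<^sup>+w. \<integral>\<^sup>+z. G (sqrt ((c i)\<^sup>2 + s\<^sup>2) * z)
          (z\<^sup>2 + (\<Sum>k\<in>insert i J. ((y(i := w)) k)\<^sup>2)) \<partial>stdN \<partial>stdN \<partial>(stdN_pow J))"
      by (rule stdN_prod.product_nn_integral_insert[OF insert.hyps]) measurable
    thus ?thesis
      unfolding sum.insert[OF insert.hyps] upd' by (simp only: fun_upd_same add_ac)
  qed
  finally show ?case unfolding s2 .
qed

section \<open>Spherical caps\<close>

text \<open>The Mills ratio bound: beyond \<open>A\<close> the factor z / A is at least 1, and z
  times the density has minus the density as antiderivative.\<close>

lemma nn_integral_stdN_tail:
  assumes A: "0 < A"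
  shows "(\<integral>\<^sup>+z. indicator {z. A < \<bar>z\<bar>} z \<partial>stdN) \<le> ennreal (sqrt (2 / pi) * exp (- A\<^sup>2 / 2) / A)"
proof -
  define d where "d = std_normal_density"
  have d0: "0 \<le> d z" for z by (simp add: d_def)
  have [measurable]: "d \<in> borel_measurable borel" unfolding d_def by measurable
  have "((\<lambda>z :: real. exp (- z\<^sup>2 / 2)) \<longlongrightarrow> 0) at_top" by real_asymp
  hence "((\<lambda>z. - (1 / sqrt (2 * pi) * exp (- z\<^sup>2 / 2)) / A) \<longlongrightarrow> - (1 / sqrt (2 * pi) * 0) / A) at_top"
    using A by (intro tendsto_intros) auto
  hence lim: "((\<lambda>z. - d z / A) \<longlongrightarrow> - 0 / A) at_top"
    by (simp add: d_def std_normal_density_def)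
  have "(\<integral>\<^sup>+z. indicator {A<..} z \<partial>stdN) = (\<integral>\<^sup>+z. ennreal (d z) * indicator {A<..} z \<partial>lborel)"
    unfolding d_def by (rule nn_integral_stdN) measurable
  also have "\<dots> \<le> (\<integral>\<^sup>+z. ennreal (d z * z / A) * indicator {A..} z \<partial>lborel)"
  proof (rule nn_integral_mono)
    fix z :: real
    have "d z * 1 \<le> d z * (z / A)" if "A < z" using A that d0 by (intro mult_left_mono) auto
    thus "ennreal (d z) * indicator {A<..} z \<le> ennreal (d z * z / A) * indicator {A..} z"
      by (auto simp: indicator_def intro!: ennreal_leI)
  qed
  also have "\<dots> = ennreal (- 0 / A - (- d A / A))"
  proof (rule nn_integral_FTC_atLeast[OF _ _ _ lim])
    fix z assume z: "A \<le> z"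
    show "0 \<le> d z * z / A" using z A d0 by simp
    show "((\<lambda>z. - d z / A) has_real_derivative d z * z / A) (at z)"
      unfolding d_def std_normal_density_def using A by (auto intro!: derivative_eq_intros simp: field_simps)
  qed measurable
  finally have half: "(\<integral>\<^sup>+z. indicator {A<..} z \<partial>stdN) \<le> ennreal (d A / A)" by simp
  have refl: "(\<integral>\<^sup>+z. indicator {A<..} (- z) \<partial>stdN) = (\<integral>\<^sup>+z. indicator {A<..} z \<partial>stdN)"
    by (rule nn_integral_stdN_reflect) measurable
  have "(\<integral>\<^sup>+z. indicator {z. A < \<bar>z\<bar>} z \<partial>stdN)
      = (\<integral>\<^sup>+z. indicator {A<..} z + indicator {A<..} (- z) \<partial>stdN)"
    using A by (intro nn_integral_cong) (auto simp: indicator_def)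
  also have "\<dots> = (\<integral>\<^sup>+z. indicator {A<..} z \<partial>stdN) + (\<integral>\<^sup>+z. indicator {A<..} (- z) \<partial>stdN)"
    by (rule nn_integral_add) measurable
  also have "\<dots> \<le> ennreal (d A / A) + ennreal (d A / A)"
    unfolding refl by (rule add_mono[OF half half])
  also have "\<dots> = ennreal (2 * d A / A)" using A d0 by (simp add: ennreal_plus[symmetric] del: ennreal_plus)
  also have "2 * d A / A = sqrt (2 / pi) * exp (- A\<^sup>2 / 2) / A"
  proof -
    have "2 / sqrt (2 * pi) = sqrt (2 / pi)"
      by (simp add: real_sqrt_mult real_sqrt_divide real_div_sqrt field_simps)
    moreover have "2 * d A / A = 2 / sqrt (2 * pi) * exp (- A\<^sup>2 / 2) / A"
      by (simp add: d_def std_normal_density_def)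
    ultimately show ?thesis by simp
  qed
  finally show ?thesis .
qed

text \<open>Including \<open>R = 0\<close>, with value \<infinity>, allows integration over the
  chi-square variable without first removing the null set where it vanishes.\<close>

lemma nn_integral_exp_tail:
  assumes "0 \<le> R"
  shows "(\<integral>\<^sup>+s. ennreal (exp (- s * R)) * indicator {A..} s \<partial>lborel)
    = (if R = 0 then \<infinity> else ennreal (exp (- A * R) / R))"
proof (cases "R = 0")
  case True
  have "of_nat N \<le> emeasure lborel {A..}" for N
  proof -
    have "of_nat N = emeasure lborel {A..A + real N}" by (simp add: ennreal_of_nat_eq_real_of_nat)
    also have "\<dots> \<le> emeasure lborel {A..}" by (rule emeasure_mono) auto
    finally show ?thesis .
  qed
  hence "emeasure lborel {A..} = \<infinity>"
    using ennreal_Ex_less_of_nat[of "emeasure lborel {A..}"] by (metis infinity_ennreal_def leD top.not_eq_extremum)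
  thus ?thesis using True by simp
next
  case False
  hence R: "0 < R" using assms by simp
  have "((\<lambda>s. exp (- s * R)) \<longlongrightarrow> 0) at_top" using R by real_asymp
  hence lim: "((\<lambda>s. - exp (- s * R) / R) \<longlongrightarrow> - 0 / R) at_top" using R by (intro tendsto_intros) auto
  have "(\<integral>\<^sup>+s. ennreal (exp (- s * R)) * indicator {A..} s \<partial>lborel) = ennreal (- 0 / R - (- exp (- A * R) / R))"
    by (rule nn_integral_FTC_atLeast[OF _ _ _ lim]) (use R in \<open>auto intro!: derivative_eq_intros\<close>)
  thus ?thesis using R by simp
qed

lemma ennreal_weighted_sum:
  assumes "0 \<le> C" "0 \<le> w" "0 \<le> v" "0 \<le> a" "0 \<le> b"
  shows "ennreal C * (ennreal w * ennreal a + ennreal v * ennreal b) = ennreal (C * (w * a + v * b))"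
  using assms by (simp add: ennreal_mult ennreal_plus)

text \<open>The Mills ratio contributes a factor \<open>1 / sqrt R\<close>; it is split by the AM-GM inequality with
  weight \<open>w\<close>, and \<open>1 / R\<close> is written as an exponential integral, so that only the Laplace transform
  of \<open>R\<close> is needed below.\<close>

lemma nn_integral_stdN_ratio_tail:
  assumes R: "0 \<le> R" and t: "0 < t" and w: "0 < w"
  shows "(\<integral>\<^sup>+z. indicator {z. t\<^sup>2 * R < z\<^sup>2} z \<partial>stdN) \<le> ennreal (sqrt (2 / pi) / (2 * t)) *
    (ennreal w * (\<integral>\<^sup>+s. ennreal (exp (- s * R)) * indicator {t\<^sup>2 / 2..} s \<partial>lborel)
      + ennreal (1 / w) * ennreal (exp (- (t\<^sup>2 / 2) * R)))"
proof (cases "R = 0")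
  case True
  define C where "C = sqrt (2 / pi) / (2 * t)"
  have "0 < C" unfolding C_def by (intro divide_pos_pos) (use t in auto)
  hence "ennreal C * (ennreal w * \<infinity> + x) = \<infinity>" for x using w by (simp add: ennreal_mult_top)
  thus ?thesis unfolding nn_integral_exp_tail[OF R] C_def[symmetric] using True by simp
next
  case False
  hence R0: "0 < R" using R by simp
  define C where "C = sqrt (2 / pi) / (2 * t)"
  define e where "e = exp (- (t\<^sup>2 / 2) * R)"
  have C0: "0 \<le> C" using t by (simp add: C_def)
  have e0: "0 < e" by (simp add: e_def)
  have A: "0 < t * sqrt R" using t R0 by simp
  have A2: "(t * sqrt R)\<^sup>2 = t\<^sup>2 * R" using R0 by (simp add: power_mult_distrib)
  have set: "{z. t\<^sup>2 * R < z\<^sup>2} = {z. t * sqrt R < \<bar>z\<bar>}"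
  proof -
    have "(t * sqrt R)\<^sup>2 < z\<^sup>2 \<longleftrightarrow> t * sqrt R < \<bar>z\<bar>" for z
      using A abs_le_square_iff[of z "t * sqrt R"] by auto
    thus ?thesis unfolding A2 by auto
  qed
  have "(\<integral>\<^sup>+z. indicator {z. t\<^sup>2 * R < z\<^sup>2} z \<partial>stdN)
      \<le> ennreal (sqrt (2 / pi) * exp (- (t * sqrt R)\<^sup>2 / 2) / (t * sqrt R))"
    unfolding set by (rule nn_integral_stdN_tail[OF A])
  also have "sqrt (2 / pi) * exp (- (t * sqrt R)\<^sup>2 / 2) / (t * sqrt R) = C * e * (2 / sqrt R)"
    unfolding A2 by (simp add: C_def e_def)
  also have "ennreal \<dots> \<le> ennreal (C * e * (w / R + 1 / w))"
  proof (intro ennreal_leI mult_left_mono)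
    have s: "0 < sqrt R" "sqrt R * sqrt R = R" using R0 by simp_all
    have "0 \<le> w * w - 2 * w * q + q * q" for q
      using zero_le_power2[of "w - q"] by (simp add: power2_eq_square algebra_simps)
    from this[of "sqrt R"] have "2 * w * sqrt R \<le> w * w + R" unfolding s(2) by linarith
    hence "2 * w * sqrt R / (w * R) \<le> (w * w + R) / (w * R)" using w R0 by (intro divide_right_mono) auto
    moreover have "2 * w * sqrt R / (w * R) = 2 / sqrt R" using w s R0
      by (simp add: field_simps)
    moreover have "(w * w + R) / (w * R) = w / R + 1 / w" using w R0 by (simp add: field_simps)
    ultimately show "2 / sqrt R \<le> w / R + 1 / w" by simp
  qed (use C0 e0 in auto)
  also have "C * e * (w / R + 1 / w) = C * (w * (e / R) + 1 / w * e)" by (simp add: algebra_simps)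
  also have "ennreal \<dots> = ennreal C * (ennreal w * ennreal (e / R) + ennreal (1 / w) * ennreal e)"
    using C0 e0 w R0 by (intro ennreal_weighted_sum[symmetric]) auto
  finally show ?thesis
    unfolding nn_integral_exp_tail[OF R] using False by (simp add: C_def e_def)
qed

lemma nn_integral_stdN_PiM_laplace:
  fixes J :: "nat set"
  assumes J: "finite J" and s: "0 \<le> s"
  shows "(\<integral>\<^sup>+y. ennreal (exp (- s * (\<Sum>i\<in>J. (y i)\<^sup>2))) \<partial>(stdN_pow J))
    = ennreal ((1 + 2 * s) powr (- real (card J) / 2))"
proof -
  have "(\<integral>\<^sup>+y. ennreal (exp (- s * (\<Sum>i\<in>J. (y i)\<^sup>2))) \<partial>(stdN_pow J))
      = (\<integral>\<^sup>+y. (\<Prod>i\<in>J. ennreal (exp (0 * y i + (- 2 * s) * (y i)\<^sup>2 / 2))) \<partial>(stdN_pow J))"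
    using J by (simp add: prod_ennreal exp_sum[symmetric] sum_distrib_left)
  also have "\<dots> = (\<Prod>i\<in>J. \<integral>\<^sup>+y. ennreal (exp (0 * y + (- 2 * s) * y\<^sup>2 / 2)) \<partial>stdN)"
    using J by (intro stdN_prod.product_nn_integral_prod) measurable
  also have "\<dots> = (\<Prod>i\<in>J. ennreal ((1 + 2 * s) powr (- 1 / 2)))"
    using nn_integral_stdN_exp_quadratic[of "- 2 * s" 0] s by simp
  also have "\<dots> = ennreal ((1 + 2 * s) powr (- real (card J) / 2))"
    using s by (simp add: ennreal_power powr_power)
  finally show ?thesis .
qed

lemma nn_integral_powr_tail:
  assumes k: "2 < k" and A: "0 \<le> A"
  shows "(\<integral>\<^sup>+s. ennreal ((1 + 2 * s) powr (- k / 2)) * indicator {A..} s \<partial>lborel)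
    = ennreal ((1 + 2 * A) powr (1 - k / 2) / (k - 2))"
proof -
  have "LIM s at_top. (1 + 2 * s :: real) :> at_top" by real_asymp
  hence "((\<lambda>s. (1 + 2 * s) powr (1 - k / 2)) \<longlongrightarrow> 0) at_top" using k by (intro tendsto_neg_powr) auto
  hence lim: "((\<lambda>s. - ((1 + 2 * s) powr (1 - k / 2)) / (k - 2)) \<longlongrightarrow> - 0 / (k - 2)) at_top"
    using k by (intro tendsto_intros) auto
  have "(\<integral>\<^sup>+s. ennreal ((1 + 2 * s) powr (- k / 2)) * indicator {A..} s \<partial>lborel)
      = ennreal (- 0 / (k - 2) - (- ((1 + 2 * A) powr (1 - k / 2)) / (k - 2)))"
  proof (rule nn_integral_FTC_atLeast[OF _ _ _ lim])
    fix s assume s: "A \<le> s"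
    have "((\<lambda>s. (1 + 2 * s) powr (1 - k / 2)) has_real_derivative
        (1 - k / 2) * (1 + 2 * s) powr (1 - k / 2 - 1) * 2) (at s)"
      using s A by (auto intro!: derivative_eq_intros)
    hence "((\<lambda>s. - ((1 + 2 * s) powr (1 - k / 2)) / (k - 2)) has_real_derivative
        - ((1 - k / 2) * (1 + 2 * s) powr (1 - k / 2 - 1) * 2) / (k - 2)) (at s)"
      by (intro DERIV_cdivide DERIV_minus)
    moreover have "- ((1 - k / 2) * (1 + 2 * s) powr (1 - k / 2 - 1) * 2) / (k - 2) = (1 + 2 * s) powr (- k / 2)"
    proof -
      have "1 - k / 2 - 1 = - k / 2" by simp
      moreover have "- ((1 - k / 2) * (1 + 2 * s) powr (- k / 2) * 2) = (k - 2) * (1 + 2 * s) powr (- k / 2)"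
        by (simp add: algebra_simps)
      ultimately show ?thesis using k by simp
    qed
    ultimately show "((\<lambda>s. - ((1 + 2 * s) powr (1 - k / 2)) / (k - 2)) has_real_derivative
        (1 + 2 * s) powr (- k / 2)) (at s)" by simp
  qed auto
  thus ?thesis by simp
qed

text \<open>After rotation the cap is x^2 (z^2 + r) < z^2, that is t^2 r < z^2 with t^2 = x^2 / (1 -
  x^2), for a standard normal \<open>z\<close> and an independent chi-square \<open>r\<close> with n
  - 1 degrees of freedom.\<close>

lemma spherical_cap_tail:
  fixes c :: "nat \<Rightarrow> real"
  assumes n: "3 < n" and c: "(\<Sum>i<n. (c i)\<^sup>2) = 1" and x: "0 < x" "x < 1"
  shows "emeasure (stdN_pow {..<n})
      {y \<in> space (stdN_pow {..<n}). x\<^sup>2 * (\<Sum>i<n. (y i)\<^sup>2) < (\<Sum>i<n. c i * y i)\<^sup>2}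
    \<le> ennreal (sqrt (2 / pi) / x * (1 - x\<^sup>2) powr ((real n - 1) / 2) / sqrt (real n - 3))"
proof -
  define G :: "real \<Rightarrow> real \<Rightarrow> ennreal" where "G u v = (if x\<^sup>2 * v < u\<^sup>2 then 1 else 0)" for u v
  have G[measurable]: "(\<lambda>(u, v). G u v) \<in> borel_measurable (borel \<Otimes>\<^sub>M borel)" unfolding G_def by measurable
  define J where "J = {1..<n}"
  have J: "finite J" "0 \<notin> J" and nJ: "{..<n} = insert 0 J" and cJ: "real (card J) = real n - 1"
    using n by (auto simp: J_def)
  define k where "k = real n - 1"
  \<comment> \<open>The reciprocal of a chi-square with \<open>k\<close> degrees of freedom is
    integrable only for k > 2, hence n > 3.\<close>
  have k: "2 < k" "k - 2 = real n - 3" using n by (simp_all add: k_def)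
  have x2: "0 < 1 - x\<^sup>2" "0 < x\<^sup>2" using x by (simp_all add: power_less_one_iff)
  define t where "t = x / sqrt (1 - x\<^sup>2)"
  have t: "0 < t" using x x2 by (simp add: t_def)
  have t2: "t\<^sup>2 = x\<^sup>2 / (1 - x\<^sup>2)" using x2 by (simp add: t_def power_divide)
  have t21: "1 + t\<^sup>2 = 1 / (1 - x\<^sup>2)" using x2 by (simp add: t2 field_simps)
  define P where "P = (stdN_pow J)"
  interpret P: sigma_finite_measure P unfolding P_def by (rule stdN_prod.sigma_finite[OF J(1)])
  interpret Q: pair_sigma_finite lborel P by unfold_locales
  have [measurable]: "(\<lambda>y. \<Sum>i\<in>J. (y i)\<^sup>2) \<in> borel_measurable P" unfolding P_def by measurable
  define r where "r y = (\<Sum>i\<in>J. (y i)\<^sup>2)" for y :: "nat \<Rightarrow> real"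
  have [measurable]: "r \<in> borel_measurable P" unfolding r_def by measurable
  have r0: "0 \<le> r y" for y by (simp add: r_def sum_nonneg)
  \<comment> \<open>This weight makes the two terms of the arithmetic-geometric mean split integrate
    to the same value, which minimises their sum.\<close>
  define w where "w = sqrt ((k - 2) / (1 + t\<^sup>2))"
  have w: "0 < w" using k by (simp add: w_def add_pos_nonneg)
  define C where "C = sqrt (2 / pi) / (2 * t)"
  have C: "0 \<le> C" using t by (simp add: C_def)
  have "emeasure (stdN_pow {..<n})
      {y \<in> space (stdN_pow {..<n}). x\<^sup>2 * (\<Sum>i<n. (y i)\<^sup>2) < (\<Sum>i<n. c i * y i)\<^sup>2}
      = (\<integral>\<^sup>+y. G (\<Sum>i<n. c i * y i) (\<Sum>i<n. (y i)\<^sup>2) \<partial>(stdN_pow {..<n}))"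
  proof -
    have "{y \<in> space (stdN_pow {..<n}). x\<^sup>2 * (\<Sum>i<n. (y i)\<^sup>2) < (\<Sum>i<n. c i * y i)\<^sup>2}
        \<in> sets (stdN_pow {..<n})" by measurable
    from nn_integral_indicator[OF this, symmetric] show ?thesis
      by (rule trans) (auto simp: G_def indicator_def intro!: nn_integral_cong)
  qed
  also have "\<dots> = (\<integral>\<^sup>+y. \<integral>\<^sup>+z. G z (z\<^sup>2 + r y) \<partial>stdN \<partial>P)"
    using nn_integral_stdN_PiM_rotate[OF J G, of c] c unfolding nJ P_def r_def by simp
  also have "\<dots> = (\<integral>\<^sup>+y. \<integral>\<^sup>+z. indicator {z. t\<^sup>2 * r y < z\<^sup>2} z \<partial>stdN \<partial>P)"
  proof (intro nn_integral_cong)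
    fix y :: "nat \<Rightarrow> real" and z :: real
    have "x\<^sup>2 * (z\<^sup>2 + r y) < z\<^sup>2 \<longleftrightarrow> t\<^sup>2 * r y < z\<^sup>2" unfolding t2 using x2 by (simp add: field_simps)
    thus "G z (z\<^sup>2 + r y) = indicator {z. t\<^sup>2 * r y < z\<^sup>2} z" by (simp add: G_def indicator_def)
  qed
  also have "\<dots> \<le> (\<integral>\<^sup>+y. ennreal C * (ennreal w *
      (\<integral>\<^sup>+s. ennreal (exp (- s * r y)) * indicator {t\<^sup>2 / 2..} s \<partial>lborel)
      + ennreal (1 / w) * ennreal (exp (- (t\<^sup>2 / 2) * r y))) \<partial>P)"
    unfolding C_def by (intro nn_integral_mono nn_integral_stdN_ratio_tail r0 t w)
  also have "\<dots> = ennreal C * (ennreal w *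
      (\<integral>\<^sup>+y. \<integral>\<^sup>+s. ennreal (exp (- s * r y)) * indicator {t\<^sup>2 / 2..} s \<partial>lborel \<partial>P)
      + ennreal (1 / w) * (\<integral>\<^sup>+y. ennreal (exp (- (t\<^sup>2 / 2) * r y)) \<partial>P))"
    by (simp add: nn_integral_cmult nn_integral_add)
  also have "(\<integral>\<^sup>+y. \<integral>\<^sup>+s. ennreal (exp (- s * r y)) * indicator {t\<^sup>2 / 2..} s \<partial>lborel \<partial>P)
      = (\<integral>\<^sup>+s. \<integral>\<^sup>+y. ennreal (exp (- s * r y)) * indicator {t\<^sup>2 / 2..} s \<partial>P \<partial>lborel)"
    by (rule Q.Fubini') measurable
  also have "\<dots> = (\<integral>\<^sup>+s. ennreal ((1 + 2 * s) powr (- k / 2)) * indicator {t\<^sup>2 / 2..} s \<partial>lborel)"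
  proof (rule nn_integral_cong)
    fix s :: real
    show "(\<integral>\<^sup>+y. ennreal (exp (- s * r y)) * indicator {t\<^sup>2 / 2..} s \<partial>P)
      = ennreal ((1 + 2 * s) powr (- k / 2)) * indicator {t\<^sup>2 / 2..} s"
    proof (cases "t\<^sup>2 / 2 \<le> s")
      case True
      moreover have "0 \<le> t\<^sup>2 / 2" by simp
      ultimately have "0 \<le> s" by linarith
      thus ?thesis using nn_integral_stdN_PiM_laplace[OF J(1), of s] True
        unfolding P_def r_def cJ k_def by simp
    qed simp
  qed
  also have "\<dots> = ennreal ((1 + 2 * (t\<^sup>2 / 2)) powr (1 - k / 2) / (k - 2))"
    by (rule nn_integral_powr_tail[OF k(1)]) simp
  also have "(\<integral>\<^sup>+y. ennreal (exp (- (t\<^sup>2 / 2) * r y)) \<partial>P) = ennreal ((1 + 2 * (t\<^sup>2 / 2)) powr (- k / 2))"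
    using nn_integral_stdN_PiM_laplace[OF J(1), of "t\<^sup>2 / 2"] unfolding P_def r_def cJ k_def by simp
  also have "ennreal C * (ennreal w * ennreal ((1 + 2 * (t\<^sup>2 / 2)) powr (1 - k / 2) / (k - 2))
      + ennreal (1 / w) * ennreal ((1 + 2 * (t\<^sup>2 / 2)) powr (- k / 2)))
      = ennreal (C * (w * ((1 + t\<^sup>2) powr (1 - k / 2) / (k - 2)) + 1 / w * (1 + t\<^sup>2) powr (- k / 2)))"
    using C w k unfolding mult_2_right[symmetric] by (subst ennreal_weighted_sum) auto
  also have "C * (w * ((1 + t\<^sup>2) powr (1 - k / 2) / (k - 2)) + 1 / w * (1 + t\<^sup>2) powr (- k / 2))
      = sqrt (2 / pi) / x * (1 - x\<^sup>2) powr ((real n - 1) / 2) / sqrt (real n - 3)"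
  proof -
    define T where "T = 1 + t\<^sup>2"
    define E where "E = T powr (- k / 2)"
    have T: "0 < T" by (simp add: T_def add_pos_nonneg)
    have T1: "T powr (1 - k / 2) = T * E"
      using T by (simp add: E_def powr_diff powr_minus_divide)
    have sT: "sqrt T = 1 / sqrt (1 - x\<^sup>2)" unfolding T_def t21 by (simp add: real_sqrt_divide)
    have w2: "w = sqrt (k - 2) / sqrt T" by (simp add: w_def T_def real_sqrt_divide)
    have E: "E = (1 - x\<^sup>2) powr (k / 2)"
      unfolding E_def T_def t21 using x2 by (simp add: powr_divide powr_minus_divide)
    have sk: "0 < sqrt (k - 2)" "sqrt (k - 2) * sqrt (k - 2) = k - 2" using k by simp_all
    have sTp: "0 < sqrt T" "sqrt T * sqrt T = T" using T by simp_all
    have 1: "w * (T * E / (k - 2)) = sqrt T * E / sqrt (k - 2)"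
    proof -
      have "w * (T * E / (k - 2)) = sqrt (k - 2) / sqrt T * (sqrt T * sqrt T * E / (sqrt (k - 2) * sqrt (k - 2)))"
        using sk sTp w2 by simp
      also have "\<dots> = sqrt T * E / sqrt (k - 2)" using sk(1) sTp(1) by (simp add: field_simps)
      finally show ?thesis .
    qed
    have 2: "1 / w * E = sqrt T * E / sqrt (k - 2)" unfolding w2 by simp
    have "C * (w * (T * E / (k - 2)) + 1 / w * E) = 2 * C * sqrt T * E / sqrt (k - 2)"
      unfolding 1 2 by simp
    also have "2 * C * sqrt T = sqrt (2 / pi) / x" unfolding C_def t_def sT using x2 by simp
    finally show ?thesis unfolding T_def[symmetric] T1 E_def[symmetric] by (simp add: E k_def)
  qed
  finally show ?thesis .
qed

text \<open>The first-order bound on the logarithm only gives - L + L / n. The second-order term -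
  y^2 / 2 pays for the missing half power once L \<ge> 2.\<close>

lemma one_minus_powr_le_exp:
  assumes n: "(3 :: real) < n" and L: "2 \<le> L" "2 * L < n"
  shows "(1 - 2 * L / n) powr ((n - 1) / 2) \<le> exp (- L)"
proof -
  define y where "y = 2 * L / n"
  have y: "0 \<le> y" "y < 1" using n L by (auto simp: y_def)
  have "ln (1 - y) \<le> - y - y\<^sup>2 / 2"
  proof -
    define f where "f u = - u - u\<^sup>2 / 2 - ln (1 - u)" for u :: real
    have "f 0 \<le> f y"
    proof (rule DERIV_nonneg_imp_nondecreasing[OF y(1)])
      fix u assume u: "0 \<le> u" "u \<le> y"
      have "(f has_real_derivative (- 1 - u + 1 / (1 - u))) (at u)"
        unfolding f_def using u y by (auto intro!: derivative_eq_intros simp: field_simps)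
      moreover have "0 \<le> - 1 - u + 1 / (1 - u)"
      proof -
        have "- 1 - u + 1 / (1 - u) = u\<^sup>2 / (1 - u)" using u y by (simp add: field_simps power2_eq_square)
        thus ?thesis using u y by simp
      qed
      ultimately show "\<exists>d. (f has_real_derivative d) (at u) \<and> 0 \<le> d" by blast
    qed
    thus ?thesis by (simp add: f_def)
  qed
  hence "(n - 1) / 2 * ln (1 - y) \<le> (n - 1) / 2 * (- y - y\<^sup>2 / 2)" using n by (intro mult_left_mono) auto
  also have "\<dots> = - L - L * ((n - 1) * L - n) / n\<^sup>2"
    using n by (simp add: y_def field_simps power2_eq_square)
  also have "\<dots> \<le> - L"
  proof -
    have "(n - 1) * 2 \<le> (n - 1) * L" using n L by (intro mult_left_mono) auto
    moreover have "n \<le> (n - 1) * 2" using n by simp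
    ultimately have "0 \<le> (n - 1) * L - n" by simp
    hence "0 \<le> L * ((n - 1) * L - n) / n\<^sup>2" using L by (intro divide_nonneg_nonneg mult_nonneg_nonneg) auto
    thus ?thesis by linarith
  qed
  finally show ?thesis using y unfolding y_def[symmetric] powr_def by simp
qed

lemma spherical_cap_tail_exp:
  fixes c :: "nat \<Rightarrow> real"
  assumes n: "3 < n" and c: "(\<Sum>i<n. (c i)\<^sup>2) = 1" and L: "2 \<le> L"
  shows "emeasure (stdN_pow {..<n})
      {y \<in> space (stdN_pow {..<n}). 2 * L / real n * (\<Sum>i<n. (y i)\<^sup>2) < (\<Sum>i<n. c i * y i)\<^sup>2}
    \<le> ennreal (sqrt (real n / (real n - 3)) * (exp (- L) / sqrt (pi * L)))"
proof (cases "2 * L < real n")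
  case True
  define x where "x = sqrt (2 * L / real n)"
  have x2: "x\<^sup>2 = 2 * L / real n" using L by (simp add: x_def)
  have x: "0 < x" "x < 1" using True L n by (auto simp: x_def)
  have "sqrt (2 / pi) / x * (1 - x\<^sup>2) powr ((real n - 1) / 2) / sqrt (real n - 3)
      \<le> sqrt (2 / pi) / x * exp (- L) / sqrt (real n - 3)"
    unfolding x2 using one_minus_powr_le_exp[of "real n" L] True L n x
    by (intro divide_right_mono mult_left_mono) auto
  also have "\<dots> = sqrt (real n / (real n - 3)) * (exp (- L) / sqrt (pi * L))"
  proof -
    have "sqrt (2 / pi) / x = sqrt (2 / pi / (2 * L / real n))" unfolding x_def by (rule real_sqrt_divide[symmetric])
    also have "2 / pi / (2 * L / real n) = real n / (pi * L)" using L by (simp add: field_simps)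
    finally show ?thesis by (simp add: real_sqrt_divide)
  qed
  finally show ?thesis
    using spherical_cap_tail[OF n c x] unfolding x2[symmetric] by (meson ennreal_leI order.trans)
next
  case False
  \<comment> \<open>For 2 L \<ge> n the cap is empty by Cauchy-Schwarz.\<close>
  have "(\<Sum>i<n. c i * y i)\<^sup>2 \<le> 2 * L / real n * (\<Sum>i<n. (y i)\<^sup>2)" for y
  proof -
    have "(\<Sum>i<n. c i * y i)\<^sup>2 \<le> (\<Sum>i<n. (c i)\<^sup>2) * (\<Sum>i<n. (y i)\<^sup>2)" by (rule Cauchy_Schwarz_ineq_sum)
    also have "\<dots> \<le> 2 * L / real n * (\<Sum>i<n. (y i)\<^sup>2)"
      unfolding c using False n by (intro mult_right_mono sum_nonneg) auto
    finally show ?thesis .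
  qed
  hence eq: "{y \<in> space (stdN_pow {..<n}). 2 * L / real n * (\<Sum>i<n. (y i)\<^sup>2) < (\<Sum>i<n. c i * y i)\<^sup>2} = {}"
    by (auto simp: not_less[symmetric])
  show ?thesis unfolding eq by simp
qed

section \<open>Chi tails\<close>

lemma measurable_inner_fseq_of [measurable]:
  "(\<lambda>x. inner (fseq_of n x) u) \<in> borel_measurable (stdN_pow {..<n})"
  unfolding inner_fseq_of_left by measurable

lemma nn_integral_exp_linear:
  assumes c: "fseq_of n (coord c) = c"
  shows "(\<integral>\<^sup>+x. ennreal (exp (inner (fseq_of n x) c)) \<partial>(stdN_pow {..<n}))
    = ennreal (exp ((norm c)\<^sup>2 / 2))"
proof -
  have "inner c c = (\<Sum>i<n. coord c i * coord c i)"
    by (subst (1) c[symmetric]) (rule inner_fseq_of_left)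
  hence nc: "(norm c)\<^sup>2 / 2 = (\<Sum>i<n. (coord c i)\<^sup>2 / 2)"
    unfolding power2_norm_eq_inner by (simp add: power2_eq_square sum_divide_distrib)
  have "(\<integral>\<^sup>+x. ennreal (exp (inner (fseq_of n x) c)) \<partial>(stdN_pow {..<n}))
      = (\<integral>\<^sup>+x. (\<Prod>i<n. ennreal (exp (coord c i * x i + 0 * (x i)\<^sup>2 / 2))) \<partial>(stdN_pow {..<n}))"
    by (simp add: inner_fseq_of_left prod_ennreal exp_sum mult.commute)
  also have "\<dots> = (\<Prod>i<n. \<integral>\<^sup>+y. ennreal (exp (coord c i * y + 0 * y\<^sup>2 / 2)) \<partial>stdN)"
    by (intro stdN_prod.product_nn_integral_prod) auto
  also have "\<dots> = (\<Prod>i<n. ennreal (exp ((coord c i)\<^sup>2 / 2)))"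
    using nn_integral_stdN_exp_quadratic[of 0] by simp
  also have "\<dots> = ennreal (exp ((norm c)\<^sup>2 / 2))" unfolding nc by (simp add: prod_ennreal exp_sum)
  finally show ?thesis .
qed

text \<open>Each square is linearised by \<open>exp (l z^2 / 2) = E exp (sqrt l g z)\<close> with an independent
  standard normal \<open>g\<close>; carrying the linear term \<open>c\<close> along makes the induction over the
  orthonormal family go through.\<close>

lemma nn_integral_exp_orthonormal:
  assumes U: "finite U" "\<And>u. u \<in> U \<Longrightarrow> norm u = 1" "\<And>u. u \<in> U \<Longrightarrow> fseq_of n (coord u) = u"
    "\<And>u w. u \<in> U \<Longrightarrow> w \<in> U \<Longrightarrow> u \<noteq> w \<Longrightarrow> inner u w = 0"
    and l: "0 \<le> l" "l < 1" and c: "fseq_of n (coord c) = c"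
  shows "(\<integral>\<^sup>+x. ennreal (exp (inner (fseq_of n x) c + l / 2 * (\<Sum>u\<in>U. (inner (fseq_of n x) u)\<^sup>2)))
      \<partial>(stdN_pow {..<n}))
    = ennreal ((1 - l) powr (- real (card U) / 2)
      * exp ((norm c)\<^sup>2 / 2 + l / (2 * (1 - l)) * (\<Sum>u\<in>U. (inner c u)\<^sup>2)))"
  using U c
proof (induction U arbitrary: c rule: finite_induct)
  case empty
  thus ?case using nn_integral_exp_linear[of n c] l by simp
next
  case (insert u U)
  define P where "P = (stdN_pow {..<n})"
  interpret P: sigma_finite_measure P unfolding P_def by (rule stdN_prod.sigma_finite) simp
  interpret Q: pair_sigma_finite stdN P by unfold_locales
  have [measurable]: "(\<lambda>x. inner (fseq_of n x) v) \<in> borel_measurable P" for v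
    unfolding P_def by measurable
  define q where "q x = (\<Sum>w\<in>U. (inner (fseq_of n x) w)\<^sup>2)" for x
  have [measurable]: "q \<in> borel_measurable P" unfolding q_def by measurable
  define K where "K = (1 - l) powr (- real (card U) / 2)
      * exp ((norm c)\<^sup>2 / 2 + l / (2 * (1 - l)) * (\<Sum>w\<in>U. (inner c w)\<^sup>2))"
  have K0: "0 \<le> K" by (simp add: K_def)
  define r where "r = sqrt l"
  have r: "r\<^sup>2 = l" "r * r = l" using l by (simp_all add: r_def)
  have uU: "inner u w = 0" if "w \<in> U" for w using insert.prems(3)[of u w] insert.hyps that by auto
  have u1: "inner u u = 1" using insert.prems(1)[of u] by (simp add: norm_eq_1)
  have lin: "exp (inner (fseq_of n x) c + l / 2 * (\<Sum>w\<in>insert u U. (inner (fseq_of n x) w)\<^sup>2))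
      = exp (inner (fseq_of n x) c + l / 2 * q x) * exp ((r * inner (fseq_of n x) u)\<^sup>2 / 2)" for x
    using insert.hyps by (simp add: exp_add[symmetric] q_def power_mult_distrib r algebra_simps)
  have mix: "ennreal (exp (z\<^sup>2 / 2)) = (\<integral>\<^sup>+g. ennreal (exp (z * g)) \<partial>stdN)" for z
    using nn_integral_stdN_exp_quadratic[of 0 z] by simp
  have cu: "fseq_of n (coord (c + (r * g) *\<^sub>R u)) = c + (r * g) *\<^sub>R u" for g
  proof -
    have "fseq_of n (coord (c + (r * g) *\<^sub>R u)) = fseq_of n (coord c) + (r * g) *\<^sub>R fseq_of n (coord u)"
      by (simp add: fseq_of_add fseq_of_scaleR plus_fseq.rep_eq scaleR_fseq.rep_eq)
    thus ?thesis using insert.prems(2)[of u] insert.prems(4) by simp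
  qed
  have IH: "(\<integral>\<^sup>+x. ennreal (exp (inner (fseq_of n x) (c + (r * g) *\<^sub>R u) + l / 2 * q x)) \<partial>P)
      = ennreal K * ennreal (exp (r * inner c u * g + l * g\<^sup>2 / 2))" for g
  proof -
    have "(\<Sum>w\<in>U. (inner (c + (r * g) *\<^sub>R u) w)\<^sup>2) = (\<Sum>w\<in>U. (inner c w)\<^sup>2)"
      using uU by (intro sum.cong) (auto simp: inner_add_left)
    moreover have "(norm (c + (r * g) *\<^sub>R u))\<^sup>2 / 2 = (norm c)\<^sup>2 / 2 + (r * inner c u * g + l * g\<^sup>2 / 2)"
    proof -
      have "inner (c + (r * g) *\<^sub>R u) (c + (r * g) *\<^sub>R u)
          = inner c c + 2 * (r * g) * inner c u + (r * g)\<^sup>2 * inner u u"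
        by (simp add: inner_add_left inner_add_right inner_commute power2_eq_square algebra_simps)
      thus ?thesis by (simp add: power2_norm_eq_inner u1 power_mult_distrib r)
    qed
    ultimately have "(\<integral>\<^sup>+x. ennreal (exp (inner (fseq_of n x) (c + (r * g) *\<^sub>R u) + l / 2 * q x)) \<partial>P)
        = ennreal ((1 - l) powr (- real (card U) / 2) * exp ((norm c)\<^sup>2 / 2 + (r * inner c u * g + l * g\<^sup>2 / 2)
            + l / (2 * (1 - l)) * (\<Sum>w\<in>U. (inner c w)\<^sup>2)))"
      using insert.IH[OF _ _ _ cu] insert.prems(1-3) unfolding P_def q_def by simp
    also have "(1 - l) powr (- real (card U) / 2) * exp ((norm c)\<^sup>2 / 2 + (r * inner c u * g + l * g\<^sup>2 / 2)
            + l / (2 * (1 - l)) * (\<Sum>w\<in>U. (inner c w)\<^sup>2)) = K * exp (r * inner c u * g + l * g\<^sup>2 / 2)"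
      by (simp add: K_def exp_add)
    finally show ?thesis using K0 by (simp add: ennreal_mult)
  qed
  have "(\<integral>\<^sup>+x. ennreal (exp (inner (fseq_of n x) c + l / 2 * (\<Sum>w\<in>insert u U. (inner (fseq_of n x) w)\<^sup>2))) \<partial>P)
      = (\<integral>\<^sup>+x. \<integral>\<^sup>+g. ennreal (exp (inner (fseq_of n x) (c + (r * g) *\<^sub>R u) + l / 2 * q x)) \<partial>stdN \<partial>P)"
  proof (rule nn_integral_cong)
    fix x
    let ?A = "inner (fseq_of n x) c + l / 2 * q x" and ?z = "r * inner (fseq_of n x) u"
    have "ennreal (exp (inner (fseq_of n x) c + l / 2 * (\<Sum>w\<in>insert u U. (inner (fseq_of n x) w)\<^sup>2)))
        = ennreal (exp ?A) * (\<integral>\<^sup>+g. ennreal (exp (?z * g)) \<partial>stdN)"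
      unfolding lin mix[symmetric] by (rule ennreal_mult) simp_all
    also have "\<dots> = (\<integral>\<^sup>+g. ennreal (exp ?A) * ennreal (exp (?z * g)) \<partial>stdN)"
      by (rule nn_integral_cmult[symmetric]) simp
    also have "(\<lambda>g. ennreal (exp ?A) * ennreal (exp (?z * g)))
        = (\<lambda>g. ennreal (exp (inner (fseq_of n x) (c + (r * g) *\<^sub>R u) + l / 2 * q x)))"
      by (simp add: ennreal_mult[symmetric] exp_add[symmetric] inner_add_right algebra_simps)
    finally show "ennreal (exp (inner (fseq_of n x) c + l / 2 * (\<Sum>w\<in>insert u U. (inner (fseq_of n x) w)\<^sup>2)))
        = (\<integral>\<^sup>+g. ennreal (exp (inner (fseq_of n x) (c + (r * g) *\<^sub>R u) + l / 2 * q x)) \<partial>stdN)" .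
  qed
  also have "\<dots> = (\<integral>\<^sup>+g. \<integral>\<^sup>+x. ennreal (exp (inner (fseq_of n x) (c + (r * g) *\<^sub>R u) + l / 2 * q x)) \<partial>P \<partial>stdN)"
    unfolding inner_add_right inner_scaleR_right by (rule Q.Fubini') measurable
  also have "\<dots> = (\<integral>\<^sup>+g. ennreal K * ennreal (exp (r * inner c u * g + l * g\<^sup>2 / 2)) \<partial>stdN)"
    unfolding IH ..
  also have "\<dots> = ennreal K * ennreal ((1 - l) powr (- 1 / 2) * exp ((r * inner c u)\<^sup>2 / (2 * (1 - l))))"
    using nn_integral_stdN_exp_quadratic[OF l(2), of "r * inner c u"] by (subst nn_integral_cmult) simp_all
  also have "\<dots> = ennreal (K * ((1 - l) powr (- 1 / 2) * exp ((r * inner c u)\<^sup>2 / (2 * (1 - l)))))"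
    using K0 by (simp add: ennreal_mult)
  also have "K * ((1 - l) powr (- 1 / 2) * exp ((r * inner c u)\<^sup>2 / (2 * (1 - l))))
      = (1 - l) powr (- real (card (insert u U)) / 2)
        * exp ((norm c)\<^sup>2 / 2 + l / (2 * (1 - l)) * (\<Sum>w\<in>insert u U. (inner c w)\<^sup>2))"
  proof -
    have "- real (card (insert u U)) / 2 = - real (card U) / 2 + - 1 / 2"
      using insert.hyps by (simp add: field_simps)
    hence "(1 - l) powr (- real (card (insert u U)) / 2) = (1 - l) powr (- real (card U) / 2) * (1 - l) powr (- 1 / 2)"
      by (simp only: powr_add)
    moreover have "(\<Sum>w\<in>insert u U. (inner c w)\<^sup>2) = (inner c u)\<^sup>2 + (\<Sum>w\<in>U. (inner c w)\<^sup>2)"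
      using insert.hyps by simp
    moreover have "(r * inner c u)\<^sup>2 / (2 * (1 - l)) = l / (2 * (1 - l)) * (inner c u)\<^sup>2"
      by (simp add: power_mult_distrib r)
    ultimately show ?thesis unfolding K_def by (simp add: exp_add distrib_left)
  qed
  finally show ?case unfolding P_def .
qed

text \<open>Chernoff's method. Only an upper bound \<open>D\<close> on the number of directions is
  needed, because (1 - l) powr (- k / 2) increases with k. The exponent splits exactly into - t^2 /
  2 and a gain term, which later pays for the union bound.\<close>

lemma chi_tail:
  assumes U: "finite U" "\<And>u. u \<in> U \<Longrightarrow> norm u = 1" "\<And>u. u \<in> U \<Longrightarrow> fseq_of n (coord u) = u"
    "\<And>u w. u \<in> U \<Longrightarrow> w \<in> U \<Longrightarrow> u \<noteq> w \<Longrightarrow> inner u w = 0"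
    and D: "0 < D" "real (card U) \<le> D" and t: "0 \<le> t"
  shows "emeasure (stdN_pow {..<n}) {x \<in> space (stdN_pow {..<n}).
      (sqrt D + t)\<^sup>2 \<le> (\<Sum>u\<in>U. (inner (fseq_of n x) u)\<^sup>2)}
    \<le> ennreal (exp (- t\<^sup>2 / 2 - D * (t / sqrt D - ln (1 + t / sqrt D))))"
proof -
  define P where "P = (stdN_pow {..<n})"
  define q where "q x = (\<Sum>u\<in>U. (inner (fseq_of n x) u)\<^sup>2)" for x
  have [measurable]: "q \<in> borel_measurable P" unfolding q_def P_def by measurable
  define X where "X = (sqrt D + t)\<^sup>2"
  \<comment> \<open>The optimal parameter for the threshold \<open>X\<close> with \<open>D\<close>
    degrees of freedom: it minimises exp (- l X / 2) (1 - l) powr (- D / 2).\<close>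
  define l where "l = 1 - D / X"
  have sD: "0 < sqrt D" "sqrt D * sqrt D = D" using D by simp_all
  have X: "D \<le> X" "X = D + 2 * sqrt D * t + t\<^sup>2"
    using D t by (simp_all add: X_def power2_sum)
  have X0: "0 < X" using X D by linarith
  have l: "0 \<le> l" "l < 1" "1 - l = D / X" using X D X0 by (simp_all add: l_def)
  have z: "fseq_of n (coord 0) = 0" by (simp add: zero_fseq.rep_eq fseq_of_zero)
  have "{x \<in> space P. X \<le> q x} = {x \<in> space P. 1 \<le> ennreal (exp (- l * X / 2)) * ennreal (exp (l / 2 * q x))} \<or> l = 0"
  proof (cases "l = 0")
    case False
    hence "0 < l" using l by simp
    hence "X \<le> q x \<longleftrightarrow> 0 \<le> - l * X / 2 + l / 2 * q x" for x by (simp add: field_simps)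
    thus ?thesis by (simp add: ennreal_mult[symmetric] exp_add[symmetric])
  qed simp
  hence "{x \<in> space P. X \<le> q x} \<subseteq> {x \<in> space P. 1 \<le> ennreal (exp (- l * X / 2)) * ennreal (exp (l / 2 * q x))}"
    by auto
  hence "emeasure P {x \<in> space P. X \<le> q x}
      \<le> emeasure P {x \<in> space P. 1 \<le> ennreal (exp (- l * X / 2)) * ennreal (exp (l / 2 * q x))}"
    by (rule emeasure_mono) measurable
  also have "\<dots> \<le> ennreal (exp (- l * X / 2)) * (\<integral>\<^sup>+x. ennreal (exp (l / 2 * q x)) * indicator (space P) x \<partial>P)"
    by (rule nn_integral_Markov_inequality) measurable
  also have "(\<integral>\<^sup>+x. ennreal (exp (l / 2 * q x)) * indicator (space P) x \<partial>P) = (\<integral>\<^sup>+x. ennreal (exp (l / 2 * q x)) \<partial>P)"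
    by (intro nn_integral_cong) simp
  also have "\<dots> = ennreal ((1 - l) powr (- real (card U) / 2))"
    using nn_integral_exp_orthonormal[OF U l(1,2) z] unfolding P_def q_def by simp
  also have "ennreal (exp (- l * X / 2)) * ennreal ((1 - l) powr (- real (card U) / 2))
      \<le> ennreal (exp (- l * X / 2) * (1 - l) powr (- D / 2))"
    unfolding ennreal_mult[OF exp_ge_zero powr_ge_zero, symmetric]
    using l D by (intro ennreal_leI mult_left_mono powr_mono') auto
  also have "exp (- l * X / 2) * (1 - l) powr (- D / 2) = exp (- t\<^sup>2 / 2 - D * (t / sqrt D - ln (1 + t / sqrt D)))"
  proof -
    have 1: "- l * X / 2 = - (sqrt D * t) - t\<^sup>2 / 2" using X X0 by (simp add: l_def field_simps)
    have XD: "X / D = (1 + t / sqrt D)\<^sup>2"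
    proof -
      have "(1 + t / sqrt D)\<^sup>2 = ((sqrt D + t) / sqrt D)\<^sup>2" using sD by (simp add: add_divide_distrib)
      also have "\<dots> = X / D" using D by (simp add: X_def power_divide)
      finally show ?thesis ..
    qed
    have pos: "0 < 1 + t / sqrt D" using t sD by (simp add: add_pos_nonneg)
    have "(1 - l) powr (- D / 2) = exp (- D / 2 * ln (D / X))"
      unfolding l(3) using D X0 by (simp add: powr_def)
    also have "- D / 2 * ln (D / X) = D / 2 * ln (X / D)" using D X0 by (simp add: ln_div right_diff_distrib)
    also have "\<dots> = D * ln (1 + t / sqrt D)" unfolding XD using pos by (simp add: ln_realpow)
    finally have 2: "(1 - l) powr (- D / 2) = exp (D * ln (1 + t / sqrt D))" .
    have "sqrt D * t = D * (t / sqrt D)" using sD by (simp add: field_simps)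
    thus ?thesis unfolding 1 2 exp_add[symmetric] by (simp add: algebra_simps)
  qed
  finally show ?thesis unfolding P_def q_def X_def .
qed

text \<open>A rational minorant agreeing with a - ln (1 + a) through third order: both begin with
  a^2 / 2 - a^3 / 3. It is accurate for small \<open>a\<close> and increasing, as the numerical
  estimates require.\<close>

lemma ln_add_one_le_pade:
  fixes a :: real
  assumes "0 \<le> a"
  shows "3 * a\<^sup>2 / (6 + 4 * a) \<le> a - ln (1 + a)"
proof -
  define f where "f u = u - ln (1 + u) - 3 * u\<^sup>2 / (6 + 4 * u)" for u :: real
  have "f 0 \<le> f a"
  proof (rule DERIV_nonneg_imp_nondecreasing[OF assms])
    fix u :: real assume u: "0 \<le> u" "u \<le> a"
    have "(f has_real_derivative 1 - 1 / (1 + u) - (6 * u * (6 + 4 * u) - 3 * u\<^sup>2 * 4) / (6 + 4 * u)\<^sup>2) (at u)"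
      unfolding f_def using u by (auto intro!: derivative_eq_intros simp: power2_eq_square)
    moreover have "1 - 1 / (1 + u) - (6 * u * (6 + 4 * u) - 3 * u\<^sup>2 * 4) / (6 + 4 * u)\<^sup>2
        = 4 * u ^ 3 / ((1 + u) * (6 + 4 * u)\<^sup>2)"
    proof -
      have "1 + u \<noteq> 0" "6 + 4 * u \<noteq> 0" using u by linarith+
      thus ?thesis by (simp add: divide_simps power2_eq_square power3_eq_cube) (simp add: algebra_simps)
    qed
    moreover have "0 \<le> 4 * u ^ 3 / ((1 + u) * (6 + 4 * u)\<^sup>2)" using u by simp
    ultimately show "\<exists>y. (f has_real_derivative y) (at u) \<and> 0 \<le> y" by metis
  qed
  thus ?thesis by (simp add: f_def)
qed

text \<open>For fixed \<open>t\<close> the rational minorant of the gain, 3 t^2 / (6 + 4 t / sqrt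
  D), increases with \<open>D\<close>; replacing \<open>D\<close> by \<open>m\<close> removes the
  size of the support from the estimate.\<close>

lemma chi_tail_gain:
  assumes m: "0 < m" "m \<le> D" and t: "0 \<le> t"
  shows "m * (3 * (t / sqrt m)\<^sup>2 / (6 + 4 * (t / sqrt m))) \<le> D * (t / sqrt D - ln (1 + t / sqrt D))"
proof -
  have s: "0 < sqrt m" "sqrt m \<le> sqrt D" "0 < sqrt D" "(sqrt m)\<^sup>2 = m" "(sqrt D)\<^sup>2 = D" using m by simp_all
  have "m * (3 * (t / sqrt m)\<^sup>2 / (6 + 4 * (t / sqrt m))) = 3 * t\<^sup>2 / (6 + 4 * (t / sqrt m))"
    using s(1) m by (simp add: power_divide)
  also have "\<dots> \<le> 3 * t\<^sup>2 / (6 + 4 * (t / sqrt D))"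
  proof (rule divide_left_mono)
    have "t / sqrt D \<le> t / sqrt m" using s t by (intro divide_left_mono) auto
    thus "6 + 4 * (t / sqrt D) \<le> 6 + 4 * (t / sqrt m)" by simp
    have "0 \<le> t / sqrt m" "0 \<le> t / sqrt D" using s t by simp_all
    thus "0 < (6 + 4 * (t / sqrt m)) * (6 + 4 * (t / sqrt D))" by (intro mult_pos_pos) linarith+
  qed simp
  also have "\<dots> = D * (3 * (t / sqrt D)\<^sup>2 / (6 + 4 * (t / sqrt D)))"
    using s m by (simp add: power_divide)
  also have "\<dots> \<le> D * (t / sqrt D - ln (1 + t / sqrt D))"
    using m s t by (intro mult_left_mono ln_add_one_le_pade) auto
  finally show ?thesis .
qed

section \<open>Numerical bounds\<close>

text \<open>From ln (1 + x) = 2 artanh z with z = x / (2 + x): the series is kept to first order and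
  its tail bounded by the geometric series (2/3) z^3 / (1 - z^2). At x = 1 / k the bound telescopes
  in Stirling's formula.\<close>

lemma ln_add_one_le:
  fixes x :: real
  assumes "0 \<le> x"
  shows "ln (1 + x) \<le> 2 * x / (2 + x) + x ^ 3 / (6 * ((1 + x) * (2 + x)))"
proof -
  define f where "f u = 2 * u / (2 + u) + u ^ 3 / (6 * ((1 + u) * (2 + u))) - ln (1 + u)" for u :: real
  have "f 0 \<le> f x"
  proof (rule DERIV_nonneg_imp_nondecreasing[OF assms])
    fix u :: real assume u: "0 \<le> u" "u \<le> x"
    have nz: "1 + u \<noteq> 0" "2 + u \<noteq> 0" using u by linarith+
    have "(f has_real_derivative (2 * (2 + u) - 2 * u) / (2 + u)\<^sup>2
        + (3 * u\<^sup>2 * (6 * ((1 + u) * (2 + u))) - u ^ 3 * (6 * ((2 + u) + (1 + u)))) / (6 * ((1 + u) * (2 + u)))\<^sup>2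
        - 1 / (1 + u)) (at u)"
      unfolding f_def using u by (auto intro!: derivative_eq_intros simp: power2_eq_square)
    moreover have "(2 * (2 + u) - 2 * u) / (2 + u)\<^sup>2
        + (3 * u\<^sup>2 * (6 * ((1 + u) * (2 + u))) - u ^ 3 * (6 * ((2 + u) + (1 + u)))) / (6 * ((1 + u) * (2 + u)))\<^sup>2
        - 1 / (1 + u) = u ^ 4 / (6 * ((1 + u)\<^sup>2 * (2 + u)\<^sup>2))"
      using nz by (simp add: divide_simps power2_eq_square power3_eq_cube power4_eq_xxxx)
        (simp add: algebra_simps)
    moreover have "0 \<le> u ^ 4 / (6 * ((1 + u)\<^sup>2 * (2 + u)\<^sup>2))" using u by simp
    ultimately show "\<exists>y. (f has_real_derivative y) (at u) \<and> 0 \<le> y" by metis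
  qed
  thus ?thesis by (simp add: f_def)
qed

lemma sqrt_2pi_bounds: "sqrt (2 * pi) \<le> 2.507" "2.5 \<le> sqrt (2 * pi)"
proof -
  show "sqrt (2 * pi) \<le> 2.507"
    by (rule real_le_lsqrt) (use pi_approx in \<open>simp_all add: power2_eq_square\<close>)
  show "2.5 \<le> sqrt (2 * pi)"
    by (rule real_le_rsqrt) (use pi_approx in \<open>simp add: power2_eq_square\<close>)
qed

lemma e_bounds: "2.718 \<le> exp (1 :: real)" "exp (1 :: real) \<le> 2.719"
proof -
  have "exp 1 - 5837465777 / 2147483648 \<le> (inverse (2 ^ 32) :: real)"
    "- (exp 1 - 5837465777 / 2147483648) \<le> (inverse (2 ^ 32) :: real)"
    using e_approx_32 by (simp_all only: abs_le_iff)
  moreover have "inverse (2 ^ 32) \<le> (1 / 1000000 :: real)" by simp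
  ultimately have "2718 / 1000 \<le> exp (1 :: real)" "exp (1 :: real) \<le> 2719 / 1000" by linarith+
  thus "2.718 \<le> exp (1 :: real)" "exp (1 :: real) \<le> 2.719" by simp_all
qed

lemma ln_le_of_le_exp: "0 < x \<Longrightarrow> x \<le> exp y \<Longrightarrow> ln x \<le> (y :: real)"
  using ln_mono[of x "exp y"] by simp

text \<open>Stirling's lower bound with the constant \<open>exp (11/12)\<close> in place of \<open>sqrt (2 pi)\<close>: the sequence
  \<open>ln k! - (k + 1/2) ln k + k - 1/(12 k)\<close> is increasing and starts at \<open>11/12\<close>.\<close>

lemma fact_lower_bound:
  assumes "1 \<le> m"
  shows "12 / 5 * sqrt (real m) * (real m / exp 1) ^ m \<le> fact m"
proof -
  have main: "11 / 12 + (real m + 1 / 2) * ln (real m) - real m + 1 / (12 * real m) \<le> ln (fact m)"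
    using assms
  proof (induction m rule: nat_induct_at_least)
    case base
    thus ?case by simp
  next
    case (Suc k)
    define x where "x = 1 / real k"
    have k: "0 < real k" using Suc.hyps by simp
    have x: "0 < x" using k by (simp add: x_def)
    have xk: "1 + x = (real k + 1) / real k" using k by (simp add: x_def field_simps)
    have "(real k + 1 / 2) * ln (1 + x)
        \<le> (real k + 1 / 2) * (2 * x / (2 + x) + x ^ 3 / (6 * ((1 + x) * (2 + x))))"
      using k x by (intro mult_left_mono ln_add_one_le) auto
    also have "\<dots> = 1 + (1 / (12 * real k) - 1 / (12 * (real k + 1)))"
      using k by (simp add: x_def divide_simps power3_eq_cube) (simp add: algebra_simps)
    finally have "(real k + 1 / 2) * (ln (real k + 1) - ln (real k))
        \<le> 1 + (1 / (12 * real k) - 1 / (12 * (real k + 1)))"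
      unfolding xk using k by (simp add: ln_div)
    moreover have "ln (fact (Suc k)) = ln (real k + 1) + ln (fact k)"
      using k by (simp add: ln_mult add.commute)
    moreover have "(real k + 1 / 2) * (ln (real k + 1) - ln (real k))
        = (real k + 1 + 1 / 2) * ln (real k + 1) - ln (real k + 1) - (real k + 1 / 2) * ln (real k)"
      by (simp add: algebra_simps)
    ultimately show ?case using Suc.IH by (simp add: add.commute)
  qed
  have m: "0 < real m" using assms by simp
  have "12 / 5 * sqrt (real m) * (real m / exp 1) ^ m
      \<le> exp (11 / 12) * (sqrt (real m) * (real m / exp 1) ^ m)"
  proof -
    have "exp (11 / 12 :: real) = exp 1 * exp (- 1 / 12)" by (simp add: exp_add[symmetric])
    moreover have "1 + (- 1 / 12) \<le> exp (- 1 / 12 :: real)" by (rule exp_ge_add_one_self)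
    ultimately have "2.718 * (11 / 12) \<le> exp (11 / 12 :: real)"
      using e_bounds(1) mult_mono[of "2.718" "exp 1" "11 / 12" "exp (- 1 / 12) :: real"] by simp
    hence "12 / 5 \<le> exp (11 / 12 :: real)" by simp
    hence "12 / 5 * (sqrt (real m) * (real m / exp 1) ^ m) \<le> exp (11 / 12) * (sqrt (real m) * (real m / exp 1) ^ m)"
      using m by (intro mult_right_mono) auto
    thus ?thesis by (simp add: mult.assoc)
  qed
  also have "\<dots> = exp (11 / 12 + (real m + 1 / 2) * ln (real m) - real m)"
  proof -
    have "sqrt (real m) = exp (1 / 2 * ln (real m))" using m by (simp add: powr_half_sqrt[symmetric] powr_def)
    moreover have "(real m / exp 1) ^ m = exp (real m * ln (real m) - real m)"
      using m by (simp add: power_divide exp_diff exp_of_nat_mult[symmetric] powr_realpow[symmetric] powr_def)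
    ultimately show ?thesis by (simp add: exp_add[symmetric] algebra_simps)
  qed
  also have "\<dots> \<le> exp (ln (fact m))" using main m by (subst exp_le_cancel_iff) (smt (verit) divide_nonneg_nonneg)
  finally show ?thesis by simp
qed

lemma pade_mono:
  fixes a c :: real
  assumes "0 \<le> c" "c \<le> a"
  shows "3 * c\<^sup>2 / (6 + 4 * c) \<le> 3 * a\<^sup>2 / (6 + 4 * a)"
proof -
  have "c\<^sup>2 \<le> a\<^sup>2" using assms by (intro power_mono) auto
  moreover have "c\<^sup>2 * a \<le> a\<^sup>2 * c"
    using assms mult_left_mono[of c a "c * a"] by (simp add: power2_eq_square mult_ac)
  ultimately have "3 * c\<^sup>2 * (6 + 4 * a) \<le> 3 * a\<^sup>2 * (6 + 4 * c)" by (simp add: algebra_simps)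
  thus ?thesis using assms by (simp add: divide_simps mult.commute)
qed

text \<open>For fixed \<open>m\<close> the crude tail \<open>exp (- T / 2)\<close> loses a factor of order \<open>sqrt m\<close>; it is
  recovered from the second term of the exponent.\<close>

lemma chi_union_bound:
  fixes m p :: nat
  assumes m: "1 \<le> m" "m \<le> p" and eps: "0 < eps" "eps < real m * sqrt (2 * pi)"
  defines "T \<equiv> 2 * real m * ln (exp 1 * real p / real m) + 2 * ln (1 / eps)"
  defines "a \<equiv> sqrt T / sqrt (real m)"
  shows "0 \<le> T"
    and "real (p choose m) * exp (- T / 2 - real m * (3 * a\<^sup>2 / (6 + 4 * a))) \<le> eps / real m / sqrt (2 * pi)"
proof -
  define s where "s = sqrt (2 * pi)"
  have s: "s \<le> 2.507" "2.5 \<le> s" using sqrt_2pi_bounds by (simp_all add: s_def)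
  have e: "2.718 \<le> exp (1 :: real)" "exp (1 :: real) \<le> 2.719" by (rule e_bounds)+
  have rm: "0 < real m" "1 \<le> real m" "real m \<le> real p" "0 < real p" using m by simp_all
  have lnep: "ln (exp 1 * real p / real m) = 1 + ln (real p / real m)"
    using rm by (simp add: ln_mult ln_div)
  have lnp: "0 \<le> ln (real p / real m)" using rm by simp
  have lneps: "ln (1 / eps) \<ge> - ln (real m * s)"
    using eps rm s by (simp add: ln_div s_def)
  have Tm: "2 + 2 * ln (real p / real m) - 2 * (ln (real m * s) / real m) \<le> T / real m"
  proof -
    have "- (ln (real m * s) / real m) \<le> ln (1 / eps) / real m"
      using lneps rm divide_right_mono[of "- ln (real m * s)" "ln (1 / eps)" "real m"] by simp
    moreover have "T / real m = 2 + 2 * ln (real p / real m) + 2 * (ln (1 / eps) / real m)"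
      using rm by (simp add: T_def lnep add_divide_distrib)
    ultimately show ?thesis by linarith
  qed
  have "real m * s \<le> exp (real m)"
  proof -
    have "1 + (real m - 1) \<le> exp (real m - 1)" by (rule exp_ge_add_one_self)
    hence "real m * s \<le> exp (real m - 1) * exp 1" using s e rm by (intro mult_mono) auto
    thus ?thesis by (simp add: exp_add[symmetric])
  qed
  hence "ln (real m * s) \<le> real m" using rm s by (intro ln_le_of_le_exp) simp_all
  hence "ln (real m * s) / real m \<le> 1" using rm by simp
  hence Tm0: "0 \<le> T / real m" using Tm lnp by linarith
  thus T0: "0 \<le> T" using rm by (simp add: zero_le_divide_iff)
  have a0: "0 \<le> a" using T0 by (simp add: a_def)
  have a2: "a\<^sup>2 = T / real m" using T0 by (simp add: a_def power_divide)
  define g where "g = real m * (3 * a\<^sup>2 / (6 + 4 * a))"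
  have g0: "0 \<le> g" using a0 by (simp add: g_def)
  \<comment> \<open>The number of models relative to (e p / m)^m, which exp (- T / 2) cancels.
    Stirling bounds it by 1 / (2.4 sqrt m), so \<open>c * (real m * s)\<close> may still grow like
    sqrt m and the gain \<open>g\<close> has to beat it.\<close>
  define c where "c = real (p choose m) * (real m / (exp 1 * real p)) ^ m"
  have c0: "0 \<le> c" by (simp add: c_def)
  have "exp (- T / 2) = (real m / (exp 1 * real p)) ^ m * eps"
  proof -
    have "- T / 2 = real m * ln (real m / (exp 1 * real p)) + ln eps"
    proof -
      have "ln (real m / (exp 1 * real p)) = - ln (exp 1 * real p / real m)" "ln (1 / eps) = - ln eps"
        using rm eps by (simp_all add: ln_div ln_mult)
      thus ?thesis by (simp add: T_def)
    qed
    thus ?thesis using rm eps by (simp add: exp_add exp_of_nat_mult)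
  qed
  hence E: "real (p choose m) * exp (- T / 2 - g) = c * exp (- g) * eps"
    using exp_add[of "- T / 2" "- g"] by (simp add: c_def)
  have choose: "c \<le> (real m / exp 1) ^ m / fact m"
  proof -
    have "real ((p choose m) * fact m) \<le> real (p ^ m)" using binomial_fact_pow by (simp only: of_nat_le_iff)
    hence "real (p choose m) \<le> real p ^ m / fact m" by (simp add: pos_le_divide_eq)
    hence "c \<le> real p ^ m / fact m * (real m / (exp 1 * real p)) ^ m" unfolding c_def by (intro mult_right_mono) auto
    also have "\<dots> = (real m / exp 1) ^ m / fact m" using rm by (simp add: power_divide power_mult_distrib)
    finally show ?thesis .
  qed
  have e2: "7.38 \<le> (exp 1 :: real)\<^sup>2"
    using mult_mono[OF e(1) e(1)] by (simp add: power2_eq_square)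
  have key: "c * (real m * s) * exp (- g) \<le> 1"
  proof -
    \<comment> \<open>For m = 1 and for m = 2 with p \<le> 3 the prefactor alone suffices, in the
      latter case with the exact binomial. For m = 2 and p \<ge> 4, ln (p / 2) \<ge> ln 2 yields a
      \<ge> 1. From m = 3 on, bounds uniform in \<open>p\<close> are enough.\<close>
    consider "m = 1" | "m = 2" "p = 2" | "m = 2" "p = 3" | "m = 2" "4 \<le> p" | "3 \<le> m" using m by linarith
    thus ?thesis
    proof cases
      case 1
      have "c \<le> 1 / exp 1" using choose 1 by simp
      hence "c * (real m * s) \<le> 1 / exp 1 * exp 1" using 1 s e by (intro mult_mono) auto
      hence "c * (real m * s) \<le> 1" by simp
      moreover have "exp (- g) \<le> 1" using g0 by simp
      moreover have "0 \<le> c * (real m * s)" using c0 s rm by simp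
      ultimately show ?thesis by (meson mult_le_one exp_ge_zero)
    next
      case 2
      hence "c = 1 / (exp 1)\<^sup>2" by (simp add: c_def power_divide power_mult_distrib)
      hence "c * (real m * s) = 2 * s / (exp 1)\<^sup>2" using 2 by simp
      also have "\<dots> \<le> 1" using s e2 by (simp add: divide_le_eq_1)
      finally have "c * (real m * s) \<le> 1" .
      moreover have "exp (- g) \<le> 1" using g0 by simp
      ultimately show ?thesis by (meson mult_le_one exp_ge_zero)
    next
      case 3
      have "(3 choose 2 :: nat) = 3" by (simp add: numeral_eq_Suc)
      hence "c = 4 / 3 / (exp 1)\<^sup>2" using 3 by (simp add: c_def power_divide power_mult_distrib)
      hence "c * (real m * s) = (8 / 3 * s) / (exp 1)\<^sup>2" using 3 by simp
      also have "\<dots> \<le> 1"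
      proof -
        have "8 / 3 * s \<le> (exp 1)\<^sup>2" using s e2 by simp
        thus ?thesis by (subst divide_le_eq_1) simp
      qed
      finally have "c * (real m * s) \<le> 1" .
      moreover have "exp (- g) \<le> 1" using g0 by simp
      ultimately show ?thesis by (meson mult_le_one exp_ge_zero)
    next
      case 4
      have "2 * s \<le> 4 * exp 1" using s e by linarith
      hence "ln (2 * s) \<le> ln (4 * exp 1)" using s by simp
      also have "\<dots> = 2 * ln 2 + 1" using ln_realpow[of 2 2] by (simp add: ln_mult)
      finally have l1: "ln (2 * s) \<le> 2 * ln 2 + 1" .
      have l2: "ln 2 \<le> ln (real p / 2)" using 4 by simp
      have "2 + 2 * ln (real p / 2) - 2 * (ln (2 * s) / 2) \<le> T / real m" using Tm 4 by simp
      hence "1 \<le> T / real m" using l1 l2 by linarith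
      hence "1 \<le> a" using a0 a2 by (metis abs_of_nonneg one_power2 power2_le_imp_le)
      hence "3 * 1\<^sup>2 / (6 + 4 * 1) \<le> 3 * a\<^sup>2 / (6 + 4 * a)" by (intro pade_mono) auto
      hence g: "0.6 \<le> g" using 4 by (simp add: g_def)
      have "1 + 0.6 \<le> exp (0.6 :: real)" by (rule exp_ge_add_one_self)
      also have "\<dots> \<le> exp g" using g by simp
      finally have g': "1.6 \<le> exp g" by simp
      have "c \<le> 2 / (exp 1)\<^sup>2" using choose 4 by (simp add: power_divide)
      hence "c * (real m * s) \<le> 2 / (exp 1)\<^sup>2 * (2 * 2.507)" using 4 s by (intro mult_mono) auto
      also have "\<dots> \<le> 1.6" using e2 by (simp add: field_simps)
      also have "\<dots> \<le> exp g" by (rule g')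
      finally show ?thesis by (simp add: exp_minus field_simps)
    next
      case 5
      have r3: "3 \<le> real m" using 5 by simp
      \<comment> \<open>The rate 0.68 leaves T / m \<ge> 2 - 1.36 = 0.8^2, hence a \<ge> 0.8 and a
        gain of at least 0.208 for each unit of \<open>m\<close>.\<close>
      have "real m * 2.507 \<le> exp (0.68 * real m)"
        using 5
      proof (induction m rule: nat_induct_at_least)
        case base
        have "1 + 0.04 \<le> exp (0.04 :: real)" by (rule exp_ge_add_one_self)
        hence "7.38 * 1.04 \<le> (exp 1)\<^sup>2 * exp (0.04 :: real)" using e2 by (intro mult_mono) auto
        also have "\<dots> = exp (0.68 * real 3)" by (simp add: exp_double[symmetric] exp_add[symmetric])
        finally show ?case by simp
      next
        case (Suc k)
        have "1 + 0.68 \<le> exp (0.68 :: real)" by (rule exp_ge_add_one_self)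
        hence "real k * 2.507 * 1.68 \<le> exp (0.68 * real k) * exp 0.68"
          using Suc.IH by (intro mult_mono) auto
        also have "\<dots> = exp (0.68 * real (Suc k))" by (simp add: exp_add[symmetric] algebra_simps)
        finally show ?case using Suc.hyps by simp
      qed
      hence "real m * s \<le> exp (0.68 * real m)" using s rm by (smt (verit) mult_left_mono)
      hence "ln (real m * s) \<le> 0.68 * real m" using rm s by (intro ln_le_of_le_exp) simp_all
      hence "ln (real m * s) / real m \<le> 0.68" using rm by (simp add: field_simps)
      hence "ln (real m * s) / real m \<le> 17 / 25" by simp
      hence "16 / 25 \<le> T / real m" using Tm lnp by linarith
      hence "0.8\<^sup>2 \<le> a\<^sup>2" unfolding a2 by (simp add: power2_eq_square)
      hence "0.8 \<le> a" using a0 by (rule power2_le_imp_le)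
      hence "3 * 0.8\<^sup>2 / (6 + 4 * 0.8) \<le> 3 * a\<^sup>2 / (6 + 4 * a)" by (intro pade_mono) auto
      hence "0.208 \<le> 3 * a\<^sup>2 / (6 + 4 * a)" by (simp add: power2_eq_square)
      hence "real m * 0.208 \<le> g" unfolding g_def by (rule mult_left_mono) simp
      hence g: "0.208 * real m \<le> g" by (simp only: mult.commute)
      \<comment> \<open>The square of what has to be shown: 2.507 bounds sqrt (2 pi), 2.4 is the
        Stirling constant, and 0.416 is twice the gain rate 0.208.\<close>
      have "real m * (2.507 / 2.4)\<^sup>2 \<le> exp (0.416 * real m)"
        using 5
      proof (induction m rule: nat_induct_at_least)
        case base
        have "1 + 0.248 \<le> exp (0.248 :: real)" by (rule exp_ge_add_one_self)
        hence "2.718 * 1.248 \<le> exp 1 * exp (0.248 :: real)" using e by (intro mult_mono) auto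
        also have "\<dots> = exp (0.416 * real 3)" by (simp add: exp_add[symmetric])
        finally show ?case by (simp add: power2_eq_square)
      next
        case (Suc k)
        have "1 + 0.416 \<le> exp (0.416 :: real)" by (rule exp_ge_add_one_self)
        hence "real k * (2.507 / 2.4)\<^sup>2 * 1.416 \<le> exp (0.416 * real k) * exp 0.416"
          using Suc.IH by (intro mult_mono) auto
        also have "\<dots> = exp (0.416 * real (Suc k))" by (simp add: exp_add[symmetric] algebra_simps)
        finally show ?case using Suc.hyps by (simp add: power2_eq_square)
      qed
      also have "exp (0.416 * real m) = (exp (0.208 * real m))\<^sup>2" by (simp add: exp_double[symmetric])
      also have "real m * (2.507 / 2.4)\<^sup>2 = (sqrt (real m) * (2.507 / 2.4))\<^sup>2"
        unfolding power_mult_distrib by simp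
      finally have sm: "sqrt (real m) * (2.507 / 2.4) \<le> exp (0.208 * real m)"
        by (rule power2_le_imp_le) simp
      have "c * (12 / 5 * sqrt (real m)) \<le> 1"
      proof -
        have "c * (12 / 5 * sqrt (real m)) \<le> (real m / exp 1) ^ m / fact m * (12 / 5 * sqrt (real m))"
          using choose by (intro mult_right_mono) auto
        also have "\<dots> = (12 / 5 * sqrt (real m) * (real m / exp 1) ^ m) / fact m" by (simp add: mult_ac)
        also have "\<dots> \<le> fact m / fact m" by (rule divide_right_mono[OF fact_lower_bound[OF m(1)]]) simp
        finally show ?thesis by simp
      qed
      moreover have "c * (real m * s) = c * (12 / 5 * sqrt (real m)) * (sqrt (real m) * (s / 2.4))"
      proof -
        define w where "w = sqrt (real m)"
        have w: "real m = w * w" by (simp add: w_def)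
        have "c * ((w * w) * s) = c * (12 / 5 * w) * (w * (s / 2.4))" by simp
        thus ?thesis unfolding w[symmetric] unfolding w_def .
      qed
      moreover have "0 \<le> sqrt (real m) * (s / 2.4)" using s by simp
      ultimately have "c * (real m * s) \<le> 1 * (sqrt (real m) * (s / 2.4))"
        by (metis mult_right_mono)
      also have "\<dots> \<le> sqrt (real m) * (2.507 / 2.4)"
        unfolding mult_1 using s by (intro mult_left_mono divide_right_mono) auto
      also have "\<dots> \<le> exp g" using sm g by (smt (verit) exp_le_cancel_iff)
      finally show ?thesis by (simp add: exp_minus field_simps)
    qed
  qed
  have "c * exp (- g) * eps \<le> eps / (real m * s)"
    using mult_right_mono[OF key, of "eps / (real m * s)"] eps rm s by (simp add: field_simps)
  thus "real (p choose m) * exp (- T / 2 - real m * (3 * a\<^sup>2 / (6 + 4 * a))) \<le> eps / real m / sqrt (2 * pi)"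
    using E by (simp add: g_def s_def)
qed

section \<open>The tail of \<open>\<sigma>\<^sup>*\<^sub>m\<close>\<close>

lemma gaussian_response_distr:
  assumes gr: "gaussian_response M Y X b s" and X: "X \<in> carrier_mat n p" and n: "0 < n" and s: "0 < s"
  defines "V \<equiv> \<lambda>\<omega>. \<lambda>i\<in>{..<n}. (Y \<omega> - X *\<^sub>v b) $ i / s"
  shows "V \<in> measurable M (stdN_pow {..<n})"
    and "distr M (stdN_pow {..<n}) V = (stdN_pow {..<n})"
    and "\<And>i. i < n \<Longrightarrow> (\<lambda>\<omega>. (Y \<omega> - X *\<^sub>v b) $ i) \<in> borel_measurable M"
proof -
  interpret prob_space M using gr by (simp add: gaussian_response_def)
  define e where "e i \<omega> = (Y \<omega> - X *\<^sub>v b) $ i" for i \<omega>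
  have ind: "indep_vars (\<lambda>_. borel) e {..<n}" and d: "\<And>i. i < n \<Longrightarrow> distributed M lborel (e i) (normal_density 0 s)"
    using gr X by (auto simp: gaussian_response_def e_def[abs_def])
  have em: "e i \<in> borel_measurable M" if "i < n" for i
    using distributed_measurable[OF d[OF that]] by simp
  thus "\<And>i. i < n \<Longrightarrow> (\<lambda>\<omega>. (Y \<omega> - X *\<^sub>v b) $ i) \<in> borel_measurable M" by (simp add: e_def[abs_def])
  have ind': "indep_vars (\<lambda>_. borel) (\<lambda>i \<omega>. e i \<omega> / s) {..<n}"
    by (rule indep_vars_compose2[OF ind]) simp
  have dist: "distr M borel (\<lambda>\<omega>. e i \<omega> / s) = stdN" if "i < n" for i
  proof -
    have "distributed M lborel (\<lambda>\<omega>. (e i \<omega> - 0) / s) std_normal_density"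
      using d[OF that] normal_standard_normal_convert[OF s] by blast
    hence "distr M lborel (\<lambda>\<omega>. e i \<omega> / s) = stdN"
      using distributed_distr_eq_density by (fastforce simp: stdN_def)
    moreover have "distr M borel (\<lambda>\<omega>. e i \<omega> / s) = distr M lborel (\<lambda>\<omega>. e i \<omega> / s)"
      by (rule distr_cong) simp_all
    ultimately show ?thesis by simp
  qed
  have sets: "sets (stdN_pow {..<n}) = sets (\<Pi>\<^sub>M i\<in>{..<n}. (borel :: real measure))"
    by (rule sets_PiM_cong) simp_all
  have Ve: "V = (\<lambda>\<omega>. \<lambda>i\<in>{..<n}. e i \<omega> / s)" by (simp add: V_def e_def)
  have "V \<in> measurable M (\<Pi>\<^sub>M i\<in>{..<n}. borel)"
    unfolding Ve using em by (intro measurable_restrict) auto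
  thus "V \<in> measurable M (stdN_pow {..<n})" using measurable_cong_sets[OF refl sets] by blast
  have "distr M (stdN_pow {..<n}) V = distr M (\<Pi>\<^sub>M i\<in>{..<n}. borel) V"
    by (rule distr_cong) (simp_all add: sets)
  also have "\<dots> = (\<Pi>\<^sub>M i\<in>{..<n}. distr M borel (\<lambda>\<omega>. e i \<omega> / s))"
    unfolding Ve
    by (rule indep_vars_iff_distr_eq_PiM'[THEN iffD1, OF _ _ ind']) (use n em in auto)
  also have "\<dots> = (stdN_pow {..<n})" by (rule PiM_cong) (use dist in auto)
  finally show "distr M (stdN_pow {..<n}) V = (stdN_pow {..<n})" .
qed

lemma measure_gaussian_response:
  assumes gr: "gaussian_response M Y X b s" and X: "X \<in> carrier_mat n p" and n: "0 < n" and s: "0 < s"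
    and A: "{x \<in> space (stdN_pow {..<n}). P x} \<in> sets (stdN_pow {..<n})"
  defines "V \<equiv> \<lambda>\<omega>. \<lambda>i\<in>{..<n}. (Y \<omega> - X *\<^sub>v b) $ i / s"
  shows "{\<omega> \<in> space M. P (V \<omega>)} \<in> sets M"
    and "emeasure M {\<omega> \<in> space M. P (V \<omega>)}
      = emeasure (stdN_pow {..<n}) {x \<in> space (stdN_pow {..<n}). P x}"
proof -
  let ?P = "stdN_pow {..<n}"
  let ?A = "{x \<in> space ?P. P x}"
  note D = gaussian_response_distr[OF gr X n s, folded V_def]
  have eq: "V -` ?A \<inter> space M = {\<omega> \<in> space M. P (V \<omega>)}"
    using measurable_space[OF D(1)] by auto
  show "{\<omega> \<in> space M. P (V \<omega>)} \<in> sets M"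
    using measurable_sets[OF D(1) A] unfolding eq .
  have "emeasure ?P ?A = emeasure (distr M ?P V) ?A" unfolding D(2) ..
  also have "\<dots> = emeasure M (V -` ?A \<inter> space M)" by (rule emeasure_distr[OF D(1) A])
  finally show "emeasure M {\<omega> \<in> space M. P (V \<omega>)} = emeasure ?P ?A" unfolding eq ..
qed

lemma scaled_vec_standardize:
  assumes v: "v \<in> carrier_vec n" and s: "0 < s"
  shows "scaled_vec n v = (s / sqrt (real n)) *\<^sub>R fseq_of n (\<lambda>i\<in>{..<n}. v $ i / s)"
  using s unfolding scaled_vec_def fseq_of_scaleR by (auto intro!: fseq_of_cong)

text \<open>Sequences in the span vanish from \<open>dim_row X\<close> on, so pairing them with the
  noise involves only coordinates carried by the product measure.\<close>

lemma fseq_of_coord_span: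
  assumes "u \<in> span (scaled_col X ` B)"
  shows "fseq_of (dim_row X) (coord u) = u"
  using assms
proof (induction rule: span_induct_alt)
  case base
  show ?case by (simp add: zero_fseq.rep_eq fseq_of_zero)
next
  case (step c z y)
  have "fseq_of n (coord (fseq_of n f)) = fseq_of n f" for n f
    by (rule fseq_of_cong) (simp add: fseq_of.rep_eq)
  hence z: "fseq_of (dim_row X) (coord z) = z"
    using step(1) by (auto simp: scaled_col_def scaled_vec_def fseq_of_scaleR)
  have "fseq_of (dim_row X) (coord (c *\<^sub>R z + y))
      = c *\<^sub>R fseq_of (dim_row X) (coord z) + fseq_of (dim_row X) (coord y)"
    by (simp add: fseq_of_add fseq_of_scaleR plus_fseq.rep_eq scaleR_fseq.rep_eq)
  thus ?case using z step(2) by simp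
qed

lemma card_supersets:
  assumes S: "S \<subseteq> {..<p}"
  shows "card {B. S \<subseteq> B \<and> B \<subseteq> {..<p} \<and> card (B - S) = k} = ((p - card S) choose k)"
proof -
  have fS: "finite S" using S finite_subset by blast
  have "bij_betw (\<lambda>B. B - S) {B. S \<subseteq> B \<and> B \<subseteq> {..<p} \<and> card (B - S) = k} {R. R \<subseteq> {..<p} - S \<and> card R = k}"
  proof (rule bij_betwI[where g = "\<lambda>R. S \<union> R"])
    show "(\<union>) S \<in> {R. R \<subseteq> {..<p} - S \<and> card R = k} \<rightarrow> {B. S \<subseteq> B \<and> B \<subseteq> {..<p} \<and> card (B - S) = k}"
    proof
      fix R assume R: "R \<in> {R. R \<subseteq> {..<p} - S \<and> card R = k}"
      hence "S \<union> R - S = R" by auto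
      thus "S \<union> R \<in> {B. S \<subseteq> B \<and> B \<subseteq> {..<p} \<and> card (B - S) = k}" using R S by auto
    qed
  qed auto
  hence "card {B. S \<subseteq> B \<and> B \<subseteq> {..<p} \<and> card (B - S) = k} = card {R. R \<subseteq> {..<p} - S \<and> card R = k}"
    by (rule bij_betw_same_card)
  also have "\<dots> = (card ({..<p} - S) choose k)" by (rule n_subsets) simp
  also have "card ({..<p} - S) = p - card S" using S fS by (simp add: card_Diff_subset)
  finally show ?thesis .
qed

text \<open>Stated through a measurable cover: the orthonormal expansion provides an explicitly
  measurable event, and measurability of \<open>proj\<close> in the response need not be
  discussed.\<close>

lemma projection_norm_tail:
  assumes gr: "gaussian_response M Y X b s" and X: "X \<in> carrier_mat n p" and b: "b \<in> carrier_vec p"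
    and n: "0 < n" and s: "0 < s" and B: "B \<subseteq> {..<p}" and D: "0 < D" "real (card B) \<le> D" and t: "0 \<le> t"
  shows "\<exists>A \<in> sets M. {\<omega> \<in> space M. sqrt D + t \<le> l2norm (proj X B (Y \<omega> - X *\<^sub>v b)) / s} \<subseteq> A
    \<and> measure M A \<le> exp (- t\<^sup>2 / 2 - D * (t / sqrt D - ln (1 + t / sqrt D)))"
proof -
  let ?a = "scaled_col X ` B"
  define V where "V \<omega> = (\<lambda>i\<in>{..<n}. (Y \<omega> - X *\<^sub>v b) $ i / s)" for \<omega>
  have fB: "finite B" using B finite_subset by blast
  obtain U where U: "finite U" "card U \<le> card ?a" "span U = span ?a" "\<forall>u\<in>U. norm u = 1"
      "\<forall>u\<in>U. \<forall>w\<in>U. u \<noteq> w \<longrightarrow> inner u w = 0"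
    using orthonormal_basis_exists[OF finite_imageI[OF fB, of "scaled_col X"]]
    by (elim exE conjE) (rule that)
  have cU: "real (card U) \<le> D" using U(2) card_image_le[OF fB, of "scaled_col X"] D by linarith
  have Un: "fseq_of n (coord u) = u" if "u \<in> U" for u
    using fseq_of_coord_span[of u X B] that X U(3) by (auto intro: span_base)
  define P where "P x \<longleftrightarrow> (sqrt D + t)\<^sup>2 \<le> (\<Sum>u\<in>U. (inner (fseq_of n x) u)\<^sup>2)" for x
  have meas: "{x \<in> space (stdN_pow {..<n}). P x} \<in> sets (stdN_pow {..<n})"
    unfolding P_def by measurable
  define A where "A = {\<omega> \<in> space M. P (V \<omega>)}"
  note mg = measure_gaussian_response[OF gr X n s meas, folded V_def, folded A_def]
  have "emeasure M A \<le> ennreal (exp (- t\<^sup>2 / 2 - D * (t / sqrt D - ln (1 + t / sqrt D))))"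
    unfolding mg(2) P_def by (rule chi_tail) (use U Un D cU t in auto)
  hence "measure M A \<le> exp (- t\<^sup>2 / 2 - D * (t / sqrt D - ln (1 + t / sqrt D)))"
    unfolding measure_def by (rule enn2real_leI[rotated]) simp
  moreover have "{\<omega> \<in> space M. sqrt D + t \<le> l2norm (proj X B (Y \<omega> - X *\<^sub>v b)) / s} \<subseteq> A"
  proof safe
    fix \<omega> assume w: "\<omega> \<in> space M" and le: "sqrt D + t \<le> l2norm (proj X B (Y \<omega> - X *\<^sub>v b)) / s"
    let ?v = "Y \<omega> - X *\<^sub>v b"
    have v: "?v \<in> carrier_vec n" using gr w X b by (auto simp: gaussian_response_def)
    have po: "is_orthoproj ?a (scaled_vec n ?v) (orthoproj U (scaled_vec n ?v))"
      using U by (intro orthonormal_orthoproj(1)) auto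
    have "scaled_vec n (proj X B ?v) = orthoproj U (scaled_vec n ?v)"
      by (rule is_orthoproj_unique[OF proj_is_orthoproj(2)[OF X v B n] po])
    hence "(l2norm (proj X B ?v) / sqrt (real n))\<^sup>2 = (norm (orthoproj U (scaled_vec n ?v)))\<^sup>2"
      using proj_is_orthoproj(1)[OF X v B n] norm_scaled_vec[of "proj X B ?v" n] by simp
    also have "\<dots> = (\<Sum>u\<in>U. (inner (scaled_vec n ?v) u)\<^sup>2)"
      using U by (intro orthonormal_orthoproj(2)[of U ?a]) auto
    also have "\<dots> = (s / sqrt (real n))\<^sup>2 * (\<Sum>u\<in>U. (inner (fseq_of n (V \<omega>)) u)\<^sup>2)"
      unfolding scaled_vec_standardize[OF v s] V_def
      unfolding inner_scaleR_left power_mult_distrib sum_distrib_left ..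
    finally have "(l2norm (proj X B ?v) / s)\<^sup>2 = (\<Sum>u\<in>U. (inner (fseq_of n (V \<omega>)) u)\<^sup>2)"
      using n s by (simp add: power_divide field_simps)
    moreover have "(sqrt D + t)\<^sup>2 \<le> (l2norm (proj X B ?v) / s)\<^sup>2" using le D t by (intro power_mono) auto
    ultimately show "\<omega> \<in> A" using w by (simp add: A_def P_def)
  qed
  ultimately show ?thesis using mg(1) by blast
qed

lemma sigma_star_m_tail:
  assumes n: "0 < n" and X: "X \<in> carrier_mat n p" and b: "b \<in> carrier_vec p" and s: "0 < s"
    and gr: "gaussian_response M Y X b s" and m: "1 \<le> m" "m \<le> p" and eps: "0 < eps"
  shows "measure M {\<omega> \<in> space M. sqrt (real m + real (card (supp b)))
        + sqrt (2 * real m * ln (exp 1 * real p / real m) + 2 * ln (1 / eps))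
      \<le> sigma_star_m X (Y \<omega>) b m (supp b) * sqrt (real n) / s} \<le> eps / real m / sqrt (2 * pi)"
    (is "measure M ?E \<le> _")
proof (cases "eps < real m * sqrt (2 * pi)")
  \<comment> \<open>Here the claimed bound is at least 1.\<close>
  case False
  interpret prob_space M using gr by (simp add: gaussian_response_def)
  have "1 \<le> eps / real m / sqrt (2 * pi)" using False m by (simp add: divide_simps mult.commute)
  thus ?thesis using prob_le_1[of ?E] by linarith
next
  case True
  interpret prob_space M using gr by (simp add: gaussian_response_def)
  define S where "S = supp b"
  define T where "T = 2 * real m * ln (exp 1 * real p / real m) + 2 * ln (1 / eps)"
  define t where "t = sqrt T"
  define D where "D = real m + real (card S)"
  define a where "a = sqrt T / sqrt (real m)"
  define k where "k = min m (p - card S)"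
  define q where "q = exp (- t\<^sup>2 / 2 - D * (t / sqrt D - ln (1 + t / sqrt D)))"
  note ub = chi_union_bound[OF m eps True, folded T_def, folded a_def]
  have t: "0 \<le> t" "t\<^sup>2 = T" using ub(1) by (simp_all add: t_def)
  have Sp: "S \<subseteq> {..<p}" using b by (auto simp: S_def supp_def)
  have fS: "finite S" using Sp finite_subset by blast
  have D: "0 < D" "real m \<le> D" using m by (simp_all add: D_def)
  have "real m * (3 * a\<^sup>2 / (6 + 4 * a)) \<le> D * (t / sqrt D - ln (1 + t / sqrt D))"
    using chi_tail_gain[of "real m" D t] m D t by (simp add: a_def t_def)
  hence q: "q \<le> exp (- T / 2 - real m * (3 * a\<^sup>2 / (6 + 4 * a)))" by (simp add: q_def t(2))
  define \<B> where "\<B> = {B. S \<subseteq> B \<and> B \<subseteq> {..<p} \<and> card (B - S) = k}"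
  have f\<B>: "finite \<B>" by (rule finite_subset[of _ "Pow {..<p}"]) (auto simp: \<B>_def)
  have c\<B>: "card \<B> \<le> p choose m"
  proof -
    have "card \<B> = ((p - card S) choose k)" unfolding \<B>_def by (rule card_supersets[OF Sp])
    also have "\<dots> \<le> p choose m"
    proof (cases "m \<le> p - card S")
      case True
      thus ?thesis by (simp add: k_def binomial_right_mono)
    next
      \<comment> \<open>With fewer than \<open>m\<close> indices outside the support, the full index
        set is the only model.\<close>
      case False
      have "0 < p choose m" using m by (simp add: zero_less_binomial)
      thus ?thesis using False by (simp add: k_def Suc_le_eq)
    qed
    finally show ?thesis .
  qed
  define Q where "Q B A \<longleftrightarrow> A \<in> sets M
    \<and> {\<omega> \<in> space M. sqrt D + t \<le> l2norm (proj X B (Y \<omega> - X *\<^sub>v b)) / s} \<subseteq> A \<and> measure M A \<le> q" for B A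
  have "\<exists>A. Q B A" if "B \<in> \<B>" for B
  proof -
    have B: "S \<subseteq> B" "B \<subseteq> {..<p}" "card (B - S) \<le> m" using that by (auto simp: \<B>_def k_def)
    have "finite B" using B(2) finite_subset by blast
    hence "card B = card (B - S) + card S" using B(1) fS by (simp add: card_Diff_subset card_mono)
    hence cB: "real (card B) \<le> D" using B(3) by (simp add: D_def)
    show ?thesis
      using projection_norm_tail[OF gr X b n s B(2) D(1) cB t(1)] unfolding Q_def q_def by blast
  qed
  then obtain A where "\<forall>B\<in>\<B>. Q B (A B)" using bchoice[of \<B> Q] by blast
  hence A: "\<And>B. B \<in> \<B> \<Longrightarrow> A B \<in> sets M"
      "\<And>B. B \<in> \<B> \<Longrightarrow> {\<omega> \<in> space M. sqrt D + t \<le> l2norm (proj X B (Y \<omega> - X *\<^sub>v b)) / s} \<subseteq> A B"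
      "\<And>B. B \<in> \<B> \<Longrightarrow> measure M (A B) \<le> q"
    by (simp_all add: Q_def)
  have sub: "?E \<subseteq> (\<Union>B\<in>\<B>. A B)"
  proof
    fix \<omega> assume w: "\<omega> \<in> ?E"
    let ?f = "\<lambda>B. l2norm (proj X B (Y \<omega> - X *\<^sub>v b)) / sqrt (real n)"
    have sig: "sigma_star_m X (Y \<omega>) b m S = Max (?f ` \<B>)"
      unfolding sigma_star_m_def \<B>_def k_def using X by (intro arg_cong[where f = Max]) auto
    have "\<B> \<noteq> {}"
    proof -
      have "k \<le> card ({..<p} - S)" using Sp fS by (simp add: k_def card_Diff_subset)
      then obtain R where "R \<subseteq> {..<p} - S" "card R = k" by (metis obtain_subset_with_card_n)
      moreover from this have "S \<union> R - S = R" by auto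
      ultimately have "S \<union> R \<in> \<B>" using Sp by (auto simp: \<B>_def)
      thus ?thesis by blast
    qed
    hence "Max (?f ` \<B>) \<in> ?f ` \<B>" using f\<B> by (intro Max_in) auto
    then obtain B where B: "B \<in> \<B>" "Max (?f ` \<B>) = ?f B" by auto
    have "sqrt D + t \<le> ?f B * sqrt (real n) / s"
      using w sig B(2) by (simp add: D_def S_def t_def T_def)
    hence "sqrt D + t \<le> l2norm (proj X B (Y \<omega> - X *\<^sub>v b)) / s" using n by simp
    thus "\<omega> \<in> (\<Union>B\<in>\<B>. A B)" using A(2)[OF B(1)] B(1) w by auto
  qed
  have "measure M ?E \<le> measure M (\<Union>B\<in>\<B>. A B)"
  \<comment> \<open>Outside the sigma-algebra \<open>measure\<close> is 0 by definition, so the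
    inequality holds in both cases.\<close>
  proof (cases "?E \<in> sets M")
    case True
    show ?thesis by (intro finite_measure_mono sub sets.finite_UN f\<B> A(1))
  next
    case False
    show ?thesis unfolding measure_notin_sets[OF False] by (rule measure_nonneg)
  qed
  also have "\<dots> \<le> (\<Sum>B\<in>\<B>. measure M (A B))"
    by (rule finite_measure_subadditive_finite[OF f\<B>]) (intro image_subsetI A(1))
  also have "\<dots> \<le> (\<Sum>B\<in>\<B>. q)" by (intro sum_mono A(3))
  also have "\<dots> \<le> real (p choose m) * q" using c\<B> by (simp add: q_def mult_right_mono)
  also have "\<dots> \<le> real (p choose m) * exp (- T / 2 - real m * (3 * a\<^sup>2 / (6 + 4 * a)))"
    using q by (intro mult_left_mono) auto
  also have "\<dots> \<le> eps / real m / sqrt (2 * pi)" by (rule ub(2))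
  finally show ?thesis .
qed

section \<open>The tail of \<open>z\<^sup>*\<close>\<close>

text \<open>With \<open>T\<close> the full index set both terms of the maximum are at most 0. This
  covers negative \<open>lam0\<close>, so that \<open>tau_star\<close> is nonnegative for either
  sign of the penalty and \<tau> < 1 gives \<tau>^2 < 1.\<close>

lemma mu_nonpos:
  assumes "-1 \<le> xi" "lam \<le> 0"
  shows "mu X b lam xi = 0"
proof -
  have "mu_inf X b lam xi \<le> mu_term X b lam xi {..<dim_col X} (1/2)" by (rule mu_inf_le) auto
  also have "\<dots> \<le> 0"
  proof -
    have "ereal lam * card_over_kappa2 X xi' T \<le> 0 * card_over_kappa2 X xi' T" for xi' T
      using assms(2) by (intro ereal_mult_right_mono card_over_kappa2_nonneg) simp
    thus ?thesis by (simp add: mu_term_def l1on_def zero_ereal_def[symmetric])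
  qed
  finally have "mu_inf X b lam xi = 0" using mu_inf_finite(1)[of X b lam xi] by (rule antisym)
  thus ?thesis by (simp add: mu_eq)
qed

lemma rms_residual_nonneg: "0 \<le> rms_residual X y b"
  by (simp add: rms_residual_def l2norm_nonneg)

lemma tau_star_nonneg:
  assumes "1 < xi"
  shows "0 \<le> tau_star X y b lam0 xi"
proof (cases "0 \<le> lam0")
  case True
  thus ?thesis using assms by (simp add: tau_star_def mu_nonneg rms_residual_nonneg)
next
  case False
  hence "rms_residual X y b * lam0 \<le> 0" using rms_residual_nonneg[of X y b] by (simp add: mult_nonneg_nonpos)
  thus ?thesis using assms by (simp add: tau_star_def mu_nonpos)
qed

lemma linfnorm_eq:
  assumes X: "X \<in> carrier_mat n p" and v: "v \<in> carrier_vec n"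
  shows "linfnorm ((1 / real n) \<cdot>\<^sub>v (X\<^sup>T *\<^sub>v v))
    = Max ((\<lambda>j. \<bar>(\<Sum>i<n. X $$ (i, j) * v $ i) / real n\<bar>) ` {..<p})"
  unfolding linfnorm_def using assms
  by (intro arg_cong[where f = Max] image_cong) (auto simp: scalar_prod_def atLeast0LessThan)

lemma l2norm_eq: "v \<in> carrier_vec n \<Longrightarrow> l2norm v = sqrt (\<Sum>i<n. (v $ i)\<^sup>2)"
  by (simp add: l2norm_def)

lemma gaussian_response_measurable:
  assumes gr: "gaussian_response M Y X b s" and X: "X \<in> carrier_mat n p" and b: "b \<in> carrier_vec p"
    and n: "0 < n" and s: "0 < s"
  shows "(\<lambda>\<omega>. rms_residual X (Y \<omega>) b) \<in> borel_measurable M"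
    and "(\<lambda>\<omega>. z_star X (Y \<omega>) b) \<in> borel_measurable M"
    and "-1 \<le> xi \<Longrightarrow> (\<lambda>\<omega>. tau_star X (Y \<omega>) b lam0 xi) \<in> borel_measurable M"
proof -
  define e where "e i \<omega> = (Y \<omega> - X *\<^sub>v b) $ i" for i \<omega>
  have em[measurable]: "e i \<in> borel_measurable M" if "i \<in> {..<n}" for i
    using gaussian_response_distr(3)[OF gr X n s, of i] that by (simp add: e_def[abs_def])
  have v: "Y \<omega> - X *\<^sub>v b \<in> carrier_vec n" if "\<omega> \<in> space M" for \<omega>
    using gr that X b by (auto simp: gaussian_response_def)
  have "(\<lambda>\<omega>. sqrt (\<Sum>i<n. (e i \<omega>)\<^sup>2) / sqrt (real n)) \<in> borel_measurable M" by measurable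
  thus rms[measurable]: "(\<lambda>\<omega>. rms_residual X (Y \<omega>) b) \<in> borel_measurable M"
    by (rule measurable_cong[THEN iffD2, rotated])
      (use X in \<open>simp add: rms_residual_def l2norm_eq[OF v] e_def\<close>)
  have "(\<lambda>\<omega>. Max ((\<lambda>j. \<bar>(\<Sum>i<n. X $$ (i, j) * e i \<omega>) / real n\<bar>) ` {..<p}) / rms_residual X (Y \<omega>) b)
      \<in> borel_measurable M"
    by (intro borel_measurable_divide borel_measurable_Max rms) simp_all
  thus "(\<lambda>\<omega>. z_star X (Y \<omega>) b) \<in> borel_measurable M"
    by (rule measurable_cong[THEN iffD2, rotated])
      (use X in \<open>simp add: z_star_def linfnorm_eq[OF X v] e_def\<close>)
  assume xi: "-1 \<le> xi"
  \<comment> \<open>\<open>mu\<close> contains an uncountable infimum over \<open>v\<close>, for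
    which countable closure properties give nothing; monotonicity in the level makes it
    Borel.\<close>
  have "mono (\<lambda>l. mu X b l xi)" by (rule monoI) (rule mu_mono[OF xi])
  hence [measurable]: "(\<lambda>l. mu X b l xi) \<in> borel_measurable borel" by (rule borel_measurable_mono)
  show "(\<lambda>\<omega>. tau_star X (Y \<omega>) b lam0 xi) \<in> borel_measurable M"
    unfolding tau_star_def by measurable
qed

text \<open>\<open>z_star\<close> is a ratio, so \<open>s\<close> cancels. For each \<open>j\<close>
  the event is a cap around the unit vector obtained from column \<open>j\<close> by division by
  sqrt n, and the union bound runs over the columns.\<close>

lemma z_star_tail:
  assumes gr: "gaussian_response M Y X b s" and X: "X \<in> carrier_mat n p" and b: "b \<in> carrier_vec p"
    and n: "3 < n" and p: "0 < p" and s: "0 < s" and col: "\<And>j. j < p \<Longrightarrow> (l2norm (col X j))\<^sup>2 = real n"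
    and L: "2 \<le> L"
  shows "1 - real p * (sqrt (real n / (real n - 3)) * (exp (- L) / sqrt (pi * L)))
    \<le> measure M {\<omega> \<in> space M. z_star X (Y \<omega>) b \<le> sqrt (2 / real n * L)}"
proof -
  interpret prob_space M using gr by (simp add: gaussian_response_def)
  have n0: "0 < n" using n by simp
  define q where "q = sqrt (real n / (real n - 3)) * (exp (- L) / sqrt (pi * L))"
  have q0: "0 \<le> q" using n L by (simp add: q_def)
  define c where "c j i = X $$ (i, j) / sqrt (real n)" for i j
  have c1: "(\<Sum>i<n. (c j i)\<^sup>2) = 1" if "j < p" for j
  proof -
    have "(l2norm (col X j))\<^sup>2 = (\<Sum>i<n. (X $$ (i, j))\<^sup>2)"
      using X that by (simp add: l2norm_def sum_nonneg)
    thus ?thesis using col[OF that] n0 by (simp add: c_def power_divide sum_divide_distrib[symmetric])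
  qed
  define V where "V \<omega> = (\<lambda>i\<in>{..<n}. (Y \<omega> - X *\<^sub>v b) $ i / s)" for \<omega>
  define P where "P j x \<longleftrightarrow> 2 * L / real n * (\<Sum>i<n. (x i)\<^sup>2) < (\<Sum>i<n. c j i * x i)\<^sup>2" for j x
  have meas: "{x \<in> space (stdN_pow {..<n}). P j x} \<in> sets (stdN_pow {..<n})" for j
    unfolding P_def by measurable
  define A where "A j = {\<omega> \<in> space M. P j (V \<omega>)}" for j
  note mg = measure_gaussian_response[OF gr X n0 s meas, folded V_def, folded A_def]
  have Aq: "measure M (A j) \<le> q" if "j < p" for j
  proof -
    have "emeasure M (A j) \<le> ennreal q"
      unfolding mg(2) P_def q_def by (rule spherical_cap_tail_exp[OF n c1[OF that] L])
    thus ?thesis unfolding measure_def by (rule enn2real_leI[OF q0])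
  qed
  define x where "x = sqrt (2 / real n * L)"
  have x0: "0 < x" using L n0 by (simp add: x_def)
  let ?E = "{\<omega> \<in> space M. z_star X (Y \<omega>) b \<le> x}"
  have zm: "(\<lambda>\<omega>. z_star X (Y \<omega>) b) \<in> borel_measurable M"
    by (rule gaussian_response_measurable(2)[OF gr X b n0 s])
  have E: "?E \<in> sets M" using zm by measurable
  have "space M - ?E \<subseteq> (\<Union>j\<in>{..<p}. A j)"
  proof
    fix \<omega> assume "\<omega> \<in> space M - ?E"
    hence w: "\<omega> \<in> space M" and z: "x < z_star X (Y \<omega>) b" by auto
    define v where "v = Y \<omega> - X *\<^sub>v b"
    have v: "v \<in> carrier_vec n" using gr w X b by (auto simp: gaussian_response_def v_def)
    define r where "r = rms_residual X (Y \<omega>) b"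
    have r: "r = sqrt (\<Sum>i<n. (v $ i)\<^sup>2) / sqrt (real n)"
      using l2norm_eq[OF v] X by (simp add: r_def rms_residual_def v_def)
    define W where "W = (\<lambda>j. \<bar>(\<Sum>i<n. X $$ (i, j) * v $ i) / real n\<bar>) ` {..<p}"
    have zW: "z_star X (Y \<omega>) b = Max W / r"
      using linfnorm_eq[OF X v] X by (simp add: z_star_def r_def v_def W_def)
    have rp: "0 < r"
    proof -
      \<comment> \<open>Division by zero would give \<open>z_star\<close> the value 0, but it
        exceeds x > 0 here.\<close>
      have "r \<noteq> 0" using z x0 zW by auto
      thus ?thesis using rms_residual_nonneg[of X "Y \<omega>" b] by (simp add: r_def)
    qed
    have "Max W \<in> W" unfolding W_def using p by (intro Max_in) auto
    then obtain j where j: "j < p" "Max W = \<bar>(\<Sum>i<n. X $$ (i, j) * v $ i) / real n\<bar>"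
      by (auto simp: W_def)
    have "x * r < \<bar>(\<Sum>i<n. X $$ (i, j) * v $ i) / real n\<bar>"
      using z unfolding zW j(2) by (simp only: pos_less_divide_eq[OF rp])
    hence "(x * r)\<^sup>2 < \<bar>(\<Sum>i<n. X $$ (i, j) * v $ i) / real n\<bar>\<^sup>2"
      using x0 rp by (intro power_strict_mono) auto
    hence sq: "x\<^sup>2 * r\<^sup>2 < ((\<Sum>i<n. X $$ (i, j) * v $ i) / real n)\<^sup>2"
      unfolding power2_abs power_mult_distrib .
    have x2: "x\<^sup>2 = 2 * L / real n" using L by (simp add: x_def)
    have r2: "r\<^sup>2 = s\<^sup>2 / real n * (\<Sum>i<n. (V \<omega> i)\<^sup>2)"
      using s by (simp add: r power_divide sum_nonneg V_def v_def sum_divide_distrib[symmetric])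
    have cv: "((\<Sum>i<n. X $$ (i, j) * v $ i) / real n)\<^sup>2 = s\<^sup>2 / real n * (\<Sum>i<n. c j i * V \<omega> i)\<^sup>2"
    proof -
      have "(\<Sum>i<n. c j i * V \<omega> i) = (\<Sum>i<n. X $$ (i, j) * v $ i) / (sqrt (real n) * s)"
        by (simp add: c_def V_def v_def sum_divide_distrib)
      thus ?thesis using s n0 by (simp add: power_divide power_mult_distrib power2_eq_square)
    qed
    have sn: "0 < s\<^sup>2 / real n" using s n0 by simp
    have "s\<^sup>2 / real n * (2 * L / real n * (\<Sum>i<n. (V \<omega> i)\<^sup>2)) < s\<^sup>2 / real n * (\<Sum>i<n. c j i * V \<omega> i)\<^sup>2"
      using sq unfolding x2 r2 cv by (simp only: mult_ac)
    hence "P j (V \<omega>)" unfolding P_def using sn by (simp only: mult_less_cancel_left_pos)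
    thus "\<omega> \<in> (\<Union>j\<in>{..<p}. A j)" using j(1) w by (auto simp: A_def)
  qed
  hence "measure M (space M - ?E) \<le> measure M (\<Union>j\<in>{..<p}. A j)"
    using mg(1) by (intro finite_measure_mono) auto
  also have "\<dots> \<le> (\<Sum>j<p. measure M (A j))"
    using mg(1) by (intro finite_measure_subadditive_finite) auto
  also have "\<dots> \<le> (\<Sum>j<p. q)" using Aq by (intro sum_mono) auto
  finally have "measure M (space M - ?E) \<le> real p * q" by simp
  thus ?thesis using prob_compl[OF E] by (simp add: q_def x_def)
qed

lemma z_star_event_probability:
  fixes p :: "nat \<Rightarrow> nat" and M :: "nat \<Rightarrow> 'a measure"
  assumes hyps: "\<And>n. X n \<in> carrier_mat n (p n) \<and> b n \<in> carrier_vec (p n) \<and>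
             1 < xi n \<and> 0 < s n \<and> 0 < eps n \<and>
             (\<forall>j<p n. (l2norm (col (X n) j))\<^sup>2 = real n) \<and>
             gaussian_response (M n) (Y n) (X n) (b n) (s n)"
    and lim: "filterlim (\<lambda>n. ln (real (p n) / eps n)) at_top sequentially"
    and lam: "\<forall>\<^sub>F n in sequentially. AE \<omega> in M n.
           tau_star (X n) (Y n \<omega>) (b n) (lam0 n) (xi n) < 1 \<and>
           sqrt (2 / real n * ln (real (p n) / eps n)) * (xi n + 1)
             / ((xi n - 1) * (1 - (tau_star (X n) (Y n \<omega>) (b n) (lam0 n) (xi n))\<^sup>2)) \<le> lam0 n"
  shows "\<exists>r :: nat \<Rightarrow> real. r \<longlonglongrightarrow> 0 \<and>
           (\<forall>\<^sub>F n in sequentially.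
              1 - (1 + r n) * eps n / sqrt (pi * ln (real (p n) / eps n))
              \<le> measure (M n) {\<omega> \<in> space (M n).
                   z_star (X n) (Y n \<omega>) (b n)
                   \<le> (1 - (tau_star (X n) (Y n \<omega>) (b n) (lam0 n) (xi n))\<^sup>2)
                       * lam0 n * (xi n - 1) / (xi n + 1)})"
proof (intro exI conjI)
  \<comment> \<open>The o(1) term is the relative loss in the cap bound and depends on
    \<open>n\<close> alone.\<close>
  let ?r = "\<lambda>n :: nat. sqrt (real n / (real n - 3)) - 1"
  show "?r \<longlonglongrightarrow> 0" by real_asymp
  have "\<forall>\<^sub>F n in sequentially. 2 \<le> ln (real (p n) / eps n)"
    using lim by (simp add: filterlim_at_top)
  moreover have "\<forall>\<^sub>F n :: nat in sequentially. 3 < n" by (rule eventually_gt_at_top)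
  ultimately show "\<forall>\<^sub>F n in sequentially.
      1 - (1 + ?r n) * eps n / sqrt (pi * ln (real (p n) / eps n))
      \<le> measure (M n) {\<omega> \<in> space (M n). z_star (X n) (Y n \<omega>) (b n)
          \<le> (1 - (tau_star (X n) (Y n \<omega>) (b n) (lam0 n) (xi n))\<^sup>2) * lam0 n * (xi n - 1) / (xi n + 1)}"
    using lam
  proof eventually_elim
    case (elim n)
    define L where "L = ln (real (p n) / eps n)"
    have L: "2 \<le> L" using elim(1) by (simp add: L_def)
    have X: "X n \<in> carrier_mat n (p n)" and b: "b n \<in> carrier_vec (p n)" and xi: "1 < xi n" and s: "0 < s n"
      and eps: "0 < eps n" and col: "\<And>j. j < p n \<Longrightarrow> (l2norm (col (X n) j))\<^sup>2 = real n"
      and gr: "gaussian_response (M n) (Y n) (X n) (b n) (s n)" using hyps[of n] by auto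
    have n0: "0 < n" using elim(2) by simp
    interpret prob_space "M n" using gr by (simp add: gaussian_response_def)
    \<comment> \<open>For p = 0 the convention ln 0 = 0 would give L = 0.\<close>
    have p: "0 < p n"
    proof (rule ccontr)
      assume "\<not> 0 < p n"
      hence "L = 0" by (simp add: L_def)
      thus False using L by simp
    qed
    have eL: "real (p n) * exp (- L) = eps n"
      using p eps by (simp add: L_def exp_minus)
    let ?z = "\<lambda>\<omega>. z_star (X n) (Y n \<omega>) (b n)"
    let ?t = "\<lambda>\<omega>. tau_star (X n) (Y n \<omega>) (b n) (lam0 n) (xi n)"
    let ?B = "\<lambda>\<omega>. (1 - (?t \<omega>)\<^sup>2) * lam0 n * (xi n - 1) / (xi n + 1)"
    note gm = gaussian_response_measurable[OF gr X b n0 s]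
    have tm: "?t \<in> borel_measurable (M n)" using xi by (intro gm(3)) simp
    have "1 - (1 + ?r n) * eps n / sqrt (pi * L)
        = 1 - real (p n) * (sqrt (real n / (real n - 3)) * (exp (- L) / sqrt (pi * L)))"
      unfolding eL[symmetric] by simp
    also have "\<dots> \<le> prob {\<omega> \<in> space (M n). ?z \<omega> \<le> sqrt (2 / real n * L)}"
      by (rule z_star_tail[OF gr X b elim(2) p s col L])
    also have "\<dots> \<le> prob {\<omega> \<in> space (M n). ?z \<omega> \<le> ?B \<omega>}"
    \<comment> \<open>The threshold is random through \<tau>_* and the condition on
      \<open>lam0\<close> holds only almost surely, so the events are compared up to null
      sets.\<close>
    proof (rule finite_measure_mono_AE)
      show "{\<omega> \<in> space (M n). ?z \<omega> \<le> ?B \<omega>} \<in> events" using gm(2) tm by measurable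
      show "AE \<omega> in M n. \<omega> \<in> {\<omega> \<in> space (M n). ?z \<omega> \<le> sqrt (2 / real n * L)}
          \<longrightarrow> \<omega> \<in> {\<omega> \<in> space (M n). ?z \<omega> \<le> ?B \<omega>}"
        using elim(3)
      proof eventually_elim
        case (elim \<omega>)
        have t1: "(?t \<omega>)\<^sup>2 < 1"
          using elim tau_star_nonneg[OF xi, of "X n" "Y n \<omega>" "b n" "lam0 n"]
          by (simp add: abs_square_less_1)
        have "sqrt (2 / real n * L) * (xi n + 1) \<le> lam0 n * ((xi n - 1) * (1 - (?t \<omega>)\<^sup>2))"
          using elim t1 xi by (subst (asm) pos_divide_le_eq) (auto simp: L_def)
        hence "sqrt (2 / real n * L) \<le> ?B \<omega>"
          using xi by (simp add: pos_le_divide_eq mult_ac)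
        thus ?case by auto
      qed
    qed
    finally show ?case unfolding L_def .
  qed
qed

theorem theorem3:
  shows
    "(\<forall>n p X y (b :: real vec) xi lam0 bhat shat bbar (m::nat).
        0 < n \<longrightarrow> 0 < p \<longrightarrow> X \<in> carrier_mat n p \<longrightarrow> y \<in> carrier_vec n \<longrightarrow> b \<in> carrier_vec p \<longrightarrow>
        1 < xi \<longrightarrow> 0 < lam0 \<longrightarrow> 0 < rms_residual X y b \<longrightarrow>
        is_scaled_lasso X y lam0 bhat shat \<longrightarrow>
        is_least_squares X y (supp bhat) bbar \<longrightarrow>
        ereal (xi\<^sup>2) * card_over_kappa2 X xi (supp b)
          < ereal (real m) / ereal (kappa_plus X m (supp b)) \<longrightarrow>
        z_star X y b \<le> (1 - (tau_star X y b lam0 xi)\<^sup>2) * lam0 * (xi - 1) / (xi + 1) \<longrightarrow>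
        (let S = supp b; lamhat = shat * lam0; et = eta_star X b lamhat xi;
             sm = sigma_star_m X y b (m - 1) S; sbar = rms_residual X y bbar;
             tau = tau_star X y b lam0 xi
         in card (supp bhat - S) < m \<and>
            shat\<^sup>2 - (sm + sqrt et)\<^sup>2 \<le> sbar\<^sup>2 \<and>
            sbar\<^sup>2 \<le> shat\<^sup>2 \<and>
            (tau < 1 \<longrightarrow> lamhat \<le> rms_residual X y b * lam0 / (1 - tau\<^sup>2)) \<and>
            kappa_minus X (m - 1) S * (l2norm (bbar - b))\<^sup>2
              \<le> (l2norm (X *\<^sub>v bbar - X *\<^sub>v b))\<^sup>2 / real n \<and>
            (l2norm (X *\<^sub>v bbar - X *\<^sub>v b))\<^sup>2 / real n \<le> (sm + 2 * sqrt et)\<^sup>2))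
     \<and>
     (\<forall>(p :: nat \<Rightarrow> nat) X b xi s lam0 eps (M :: nat \<Rightarrow> 'a measure) Y.
        (\<forall>n. X n \<in> carrier_mat n (p n) \<and> b n \<in> carrier_vec (p n) \<and>
             1 < xi n \<and> 0 < s n \<and> 0 < eps n \<and>
             (\<forall>j<p n. (l2norm (col (X n) j))\<^sup>2 = real n) \<and>
             gaussian_response (M n) (Y n) (X n) (b n) (s n)) \<longrightarrow>
        filterlim (\<lambda>n. ln (real (p n) / eps n)) at_top sequentially \<longrightarrow>
        (\<forall>\<^sub>F n in sequentially. ln (real (p n) / eps n) < real n - 2) \<longrightarrow>
        (\<forall>\<^sub>F n in sequentially. AE \<omega> in M n.
           tau_star (X n) (Y n \<omega>) (b n) (lam0 n) (xi n) < 1 \<and>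
           sqrt (2 / real n * ln (real (p n) / eps n)) * (xi n + 1)
             / ((xi n - 1) * (1 - (tau_star (X n) (Y n \<omega>) (b n) (lam0 n) (xi n))\<^sup>2)) \<le> lam0 n) \<longrightarrow>
        (\<exists>r :: nat \<Rightarrow> real. r \<longlonglongrightarrow> 0 \<and>
           (\<forall>\<^sub>F n in sequentially.
              1 - (1 + r n) * eps n / sqrt (pi * ln (real (p n) / eps n))
              \<le> measure (M n) {\<omega> \<in> space (M n).
                   z_star (X n) (Y n \<omega>) (b n)
                   \<le> (1 - (tau_star (X n) (Y n \<omega>) (b n) (lam0 n) (xi n))\<^sup>2)
                       * lam0 n * (xi n - 1) / (xi n + 1)})))
     \<and>
     (\<forall>n p X b s (M :: 'a measure) Y (m::nat) eps.
        0 < n \<longrightarrow> X \<in> carrier_mat n p \<longrightarrow> b \<in> carrier_vec p \<longrightarrow> 0 < s \<longrightarrow>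
        (\<forall>j<p. (l2norm (col X j))\<^sup>2 = real n) \<longrightarrow>
        gaussian_response M Y X b s \<longrightarrow>
        1 \<le> m \<longrightarrow> m \<le> p \<longrightarrow> 0 < eps \<longrightarrow>
        measure M {\<omega> \<in> space M.
            sqrt (real m + real (card (supp b)))
              + sqrt (2 * real m * ln (exp 1 * real p / real m) + 2 * ln (1 / eps))
            \<le> sigma_star_m X (Y \<omega>) b m (supp b) * sqrt (real n) / s}
          \<le> eps / real m / sqrt (2 * pi))"
proof (intro conjI allI impI, goal_cases)
  case (1 n p X y b xi lam0 bhat shat bbar m)
  show ?case
    unfolding Let_def
    using scaled_lasso_least_squares[OF 1]
      scaled_lasso_noise_event_consequences(3)[OF 1(1-9) 1(12)] by blast
next
  case (2 p X b xi s lam0 eps M Y)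
  show ?case by (rule z_star_event_probability[OF _ 2(2,4)]) (use 2(1) in blast)
next
  case (3 n p X b s M Y m eps)
  show ?case by (rule sigma_star_m_tail[OF 3(1-4,6-9)])
qed

end
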